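(* Let $A>0$. Suppose that $c_i(0)\ge0$ and $c_i(0)\in H^2(\mathbb{R}^3)\cap L^1(\mathbb{R}^3)$ for all $i\in\{1,\dots,N\}$, and that $\int_{\mathbb{R}^3}\rho_0\,dx=0$. Let $(c_1,\dots,c_N)$ be the corresponding solution of the Nernst--Planck--Darcy system on $\mathbb{R}^3$. Then $$\lim_{t\to\infty}\left|\int_{\{|x|\le A\}}c_i(x,t)\log c_i(x,t)\,dx\right|=0$$ for all $i\in\{1,\dots,N\}$.
   Context: Fix an integer $N\ge1$, a common diffusivity $D>0$, and real valences $z_1,\dots,z_N$ with equal absolute values $|z_1|=\dots=|z_N|=z$. The Nernst--Planck--Darcy (NPD) system on $\mathbb{R}^3$, with decay at infinity, is the system for the ionic concentrations $c_i(x,t)$, the velocity $u$, the pressure $p$ and the potential $\phi$: $$\partial_t c_i+u\cdot\nabla c_i-D\Delta c_i-z_iD\,\nabla\cdot(c_i\nabla\phi)=0\quad(i=1,\dots,N),$$ $$u+\nabla p=-\rho\nabla\phi,\qquad \nabla\cdot u=0,\qquad -\Delta\phi=\rho,\qquad \rho:=\sum_{i=1}^N z_ic_i,$$ with initial data $c_i(\cdot,0)=c_i(0)$ and $\rho_0:=\sum_i z_ic_i(0)$. Decay at infinity means in particular $\phi=(-\Delta)^{-1}\rho$ and $u=-\mathbb{P}(\rho\nabla\phi)$, where $\mathbb{P}$ is the Leray projector onto divergence-free fields. For nonnegative initial data in $H^1\cap L^1$ with $\int\rho_0=0$, the system has a unique smooth solution, nonnegativity of the $c_i$ is preserved, and the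 solution is global in time; "the solution" refers to this one. The convention $0\log0=0$ is used. *)

theory Defs
  imports "HOL-Analysis.Analysis"
begin

section \<open>Smooth functions and classical differential operators\<close>

text \<open>Only meaningful for open \<open>S\<close>.\<close>

primrec C_k_on :: "nat \<Rightarrow> 'a::euclidean_space set \<Rightarrow> ('a \<Rightarrow> 'b::real_normed_vector) \<Rightarrow> bool" where
  "C_k_on 0 S f \<longleftrightarrow> continuous_on S f"
| "C_k_on (Suc k) S f \<longleftrightarrow>
     f differentiable_on S \<and> (\<forall>b\<in>Basis. C_k_on k S (\<lambda>x. frechet_derivative f (at x) b))"

definition smooth_on :: "'a::euclidean_space set \<Rightarrow> ('a \<Rightarrow> 'b::real_normed_vector) \<Rightarrow> bool" where
  "smooth_on S f \<longleftrightarrow> (\<forall>k. C_k_on k S f)"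

definition partial :: "3 \<Rightarrow> (real^3 \<Rightarrow> real) \<Rightarrow> real^3 \<Rightarrow> real" where
  "partial j f x = frechet_derivative f (at x) (axis j 1)"

definition grad :: "(real^3 \<Rightarrow> real) \<Rightarrow> real^3 \<Rightarrow> real^3" where
  "grad f x = (\<chi> j. partial j f x)"

definition divergence :: "(real^3 \<Rightarrow> real^3) \<Rightarrow> real^3 \<Rightarrow> real" where
  "divergence F x = (\<Sum>j\<in>UNIV. partial j (\<lambda>y. F y $ j) x)"

definition laplacian :: "(real^3 \<Rightarrow> real) \<Rightarrow> real^3 \<Rightarrow> real" where
  "laplacian f x = divergence (grad f) x"

section \<open>Sobolev spaces\<close>

definition test_function :: "(real^3 \<Rightarrow> real) \<Rightarrow> bool" where
  "test_function \<psi> \<longleftrightarrow> smooth_on UNIV \<psi> \<and> bounded {x. \<psi> x \<noteq> 0}"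

definition in_L2 :: "(real^3 \<Rightarrow> 'b::{real_normed_vector, second_countable_topology}) \<Rightarrow> bool" where
  "in_L2 f \<longleftrightarrow> f \<in> borel_measurable lborel \<and> integrable lborel (\<lambda>x. (norm (f x))\<^sup>2)"

definition locally_integrable :: "(real^3 \<Rightarrow> real) \<Rightarrow> bool" where
  "locally_integrable f \<longleftrightarrow> (\<forall>R. set_integrable lborel (cball 0 R) f)"

definition has_weak_partial :: "3 \<Rightarrow> (real^3 \<Rightarrow> real) \<Rightarrow> (real^3 \<Rightarrow> real) \<Rightarrow> bool" where
  "has_weak_partial j f g \<longleftrightarrow> locally_integrable f \<and> locally_integrable g \<and>
     (\<forall>\<psi>. test_function \<psi> \<longrightarrow>
        (LINT x|lborel. f x * partial j \<psi> x) = - (LINT x|lborel. g x * \<psi> x))"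

text \<open>A representative; weak derivatives are unique only up to null sets.\<close>

definition weak_partial :: "3 \<Rightarrow> (real^3 \<Rightarrow> real) \<Rightarrow> real^3 \<Rightarrow> real" where
  "weak_partial j f = (SOME g. has_weak_partial j f g)"

text \<open>\<open>sobolev k f\<close> says that \<open>f\<close> belongs to \<open>H\<^sup>k\<close>, the \<open>L\<^sup>2\<close>-based space of order \<open>k\<close>.\<close>

primrec sobolev :: "nat \<Rightarrow> (real^3 \<Rightarrow> real) \<Rightarrow> bool" where
  "sobolev 0 f \<longleftrightarrow> in_L2 f"
| "sobolev (Suc k) f \<longleftrightarrow> in_L2 f \<and> (\<forall>j. \<exists>g. has_weak_partial j f g \<and> sobolev k g)"

definition H1_norm :: "(real^3 \<Rightarrow> real) \<Rightarrow> real" where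
  "H1_norm f =
     sqrt ((LINT x|lborel. (f x)\<^sup>2) + (\<Sum>j\<in>UNIV. LINT x|lborel. (weak_partial j f x)\<^sup>2))"

section \<open>Newtonian potential and Leray projector\<close>

text \<open>The inverse of the negative Laplacian with decay at infinity.\<close>

definition newtonian_potential :: "(real^3 \<Rightarrow> real) \<Rightarrow> real^3 \<Rightarrow> real" where
  "newtonian_potential f x = (LINT y|lborel. f y / (4 * pi * dist x y))"

definition weakly_div_free :: "(real^3 \<Rightarrow> real^3) \<Rightarrow> bool" where
  "weakly_div_free v \<longleftrightarrow> (\<forall>\<psi>. test_function \<psi> \<longrightarrow> (LINT x|lborel. v x \<bullet> grad \<psi> x) = 0)"

text \<open>\<open>v\<close> represents the orthogonal projection in \<open>L\<^sup>2\<close> of \<open>f\<close> onto the closed subspace of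
  divergence-free fields. It is a relation because \<open>v\<close> is determined only up to null sets.\<close>

definition leray_projection :: "(real^3 \<Rightarrow> real^3) \<Rightarrow> (real^3 \<Rightarrow> real^3) \<Rightarrow> bool" where
  "leray_projection f v \<longleftrightarrow> in_L2 f \<and> in_L2 v \<and> weakly_div_free v \<and>
     (\<forall>w. in_L2 w \<and> weakly_div_free w \<longrightarrow> (LINT x|lborel. (f x - v x) \<bullet> w x) = 0)"

section \<open>The Nernst--Planck--Darcy system\<close>

definition charge_density ::
    "nat \<Rightarrow> (nat \<Rightarrow> real) \<Rightarrow> (nat \<Rightarrow> real \<Rightarrow> real^3 \<Rightarrow> real) \<Rightarrow> real \<Rightarrow> real^3 \<Rightarrow> real" where
  "charge_density N z c t x = (\<Sum>i\<in>{1..N}. z i * c i t x)"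

text \<open>Global solutions, smooth for positive times, which attain their initial data \<open>c i 0\<close> by
  continuity of \<open>t \<mapsto> c i t\<close> from \<open>[0,\<infinity>)\<close> into \<open>H\<^sup>1 \<inter> L\<^sup>1\<close>; this is a class in which solutions
  with data in \<open>H\<^sup>1 \<inter> L\<^sup>1\<close> are unique (the pressure up to a function of time). Nonnegativity is
  not part of the definition.\<close>

definition npd_solution ::
    "nat \<Rightarrow> real \<Rightarrow> (nat \<Rightarrow> real) \<Rightarrow> (nat \<Rightarrow> real \<Rightarrow> real^3 \<Rightarrow> real) \<Rightarrow>
     (real \<Rightarrow> real^3 \<Rightarrow> real^3) \<Rightarrow> (real \<Rightarrow> real^3 \<Rightarrow> real) \<Rightarrow> (real \<Rightarrow> real^3 \<Rightarrow> real) \<Rightarrow> bool" where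
  "npd_solution N D z c u p \<phi> \<longleftrightarrow>
     (\<forall>i\<in>{1..N}. smooth_on ({0<..} \<times> UNIV) (\<lambda>(t, x). c i t x)) \<and>
     smooth_on ({0<..} \<times> UNIV) (\<lambda>(t, x). u t x) \<and>
     smooth_on ({0<..} \<times> UNIV) (\<lambda>(t, x). p t x) \<and>
     smooth_on ({0<..} \<times> UNIV) (\<lambda>(t, x). \<phi> t x) \<and>
     (\<forall>i\<in>{1..N}. \<forall>t\<ge>0. sobolev 1 (c i t) \<and> integrable lborel (c i t)) \<and>
     (\<forall>i\<in>{1..N}. \<forall>t\<ge>0.
        ((\<lambda>s. H1_norm (\<lambda>x. c i s x - c i t x)) \<longlongrightarrow> 0) (at t within {0..}) \<and>
        ((\<lambda>s. LINT x|lborel. \<bar>c i s x - c i t x\<bar>) \<longlongrightarrow> 0) (at t within {0..})) \<and>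
     (\<forall>i\<in>{1..N}. \<forall>t>0. \<forall>x.
        deriv (\<lambda>s. c i s x) t + u t x \<bullet> grad (c i t) x - D * laplacian (c i t) x
          - z i * D * divergence (\<lambda>y. c i t y *\<^sub>R grad (\<phi> t) y) x = 0) \<and>
     (\<forall>t>0. \<forall>x.
        u t x + grad (p t) x = - (charge_density N z c t x *\<^sub>R grad (\<phi> t) x) \<and>
        divergence (u t) x = 0 \<and>
        - laplacian (\<phi> t) x = charge_density N z c t x) \<and>
     (\<forall>t>0. \<phi> t = newtonian_potential (charge_density N z c t)) \<and>
     (\<forall>t>0. leray_projection (\<lambda>x. charge_density N z c t x *\<^sub>R grad (\<phi> t) x) (\<lambda>x. - u t x))"

end

(*  The species of valence \<zeta> and those of valence -\<zeta> are lumped into two total concentrations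
    \<sigma>; each solves a drift-diffusion equation. Testing it with J'(\<sigma>) \<theta>, where \<theta> is a cutoff at radius R,
    gives an energy identity whose reaction term has a sign for convex J, because
    \<rho> = \<zeta> (\<sigma>_+ - \<sigma>_-). With J a smooth function of linear growth the errors caused by the
    cutoff vanish as R tends to infinity: they only need c in L^1 and L^2, u in L^2 and a bounded
    gradient of the potential, which follows from Hardy's inequality. Approximating |y| - y and |y|
    gives positivity and control of the L^1 norm; approximating y^2 gives
    E(t) + 2 D \<integral>\<integral> |\<nabla>\<sigma>|^2 \<le> E(s) for the sum E of the squared L^2 norms of the two \<sigma>. As the
    L^1 norms are bounded, Nash's inequality bounds the dissipation below while E stays away from
    0, so E tends to 0, and |y ln y| \<le> \<eta> + C y^2 concludes.  *)

theory Submission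
  imports Defs "HOL-Computational_Algebra.Polynomial"
begin

section \<open>Directional derivatives and integration by parts\<close>

text \<open>The solution class gives smoothness for positive times and continuity in time with
  values in H^1 and L^1, but no decay of derivatives, so every cutoff error must be paid with those
  norms. If |J(y)| <= k |y|, the transport error is at most a constant times k/R times integrals of
  w^2, |u|^2 and |w|, whereas J(y) = y^2 would produce w^2 |u|. The truncated square has slope 2m,
  so the radius is tied to it by R = m^2 and the error is O(1/m). Its reaction function y J'(y) -
  J(y) is even and increases only for y >= 0, so positivity has to precede the quadratic energy; for
  the approximation of |y| this function is uniformly small, so that step works without a sign.
  Bounds on [s,T] may depend on s and T, as R tends to infinity with both fixed. The estimates start
  at s > 0, where the equation holds, and the data at time 0 enter through L^1 continuity. The H^1
  norm is built on chosen weak derivatives, which must first be identified with the classical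
  ones.\<close>

definition has_partial :: "3 \<Rightarrow> (real^3 \<Rightarrow> real) \<Rightarrow> (real^3 \<Rightarrow> real) \<Rightarrow> bool" where
  "has_partial j f f' \<longleftrightarrow>
     (\<forall>x. ((\<lambda>h. f (x + h *\<^sub>R axis j 1)) has_real_derivative f' x) (at 0))"

text \<open>The derivative at parameter \<open>h0\<close> is the derivative at 0 based at the
  shifted point. The mean value theorem and the fundamental theorem of calculus along a line need
  this form.\<close>

lemma has_partial_line:
  assumes "has_partial j f f'"
  shows "((\<lambda>h. f (x + h *\<^sub>R axis j 1)) has_real_derivative f' (x + h0 *\<^sub>R axis j 1)) (at h0)"
proof -
  have "((\<lambda>h. f ((x + h0 *\<^sub>R axis j 1) + h *\<^sub>R axis j 1)) has_real_derivative
      f' (x + h0 *\<^sub>R axis j 1)) (at 0)"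
    using assms unfolding has_partial_def by blast
  then have "((\<lambda>h. f ((x + h0 *\<^sub>R axis j 1) + (h - h0) *\<^sub>R axis j 1)) has_real_derivative
      f' (x + h0 *\<^sub>R axis j 1)) (at h0)"
    using DERIV_at_within_shift[of "\<lambda>h. f ((x + h0 *\<^sub>R axis j 1) + (h - h0) *\<^sub>R axis j 1)" _ h0 0 UNIV]
    by (simp add: algebra_simps)
  then show ?thesis
    by (simp add: algebra_simps)
qed

lemma has_partialD:
  "has_partial j f f' \<Longrightarrow> ((\<lambda>h. f (x + h *\<^sub>R axis j 1)) has_real_derivative f' x) (at 0)"
  by (simp add: has_partial_def)

lemma has_partialI:
  "(\<And>x. ((\<lambda>h. f (x + h *\<^sub>R axis j 1)) has_real_derivative f' x) (at 0)) \<Longrightarrow> has_partial j f f'"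
  by (simp add: has_partial_def)

lemma has_partial_nth: "has_partial j (\<lambda>x. x $ i) (\<lambda>x. if i = j then 1 else 0)"
  by (rule has_partialI) (auto simp: axis_def intro!: derivative_eq_intros)

lemma has_partial_add:
  "has_partial j f f' \<Longrightarrow> has_partial j g g' \<Longrightarrow> has_partial j (\<lambda>x. f x + g x) (\<lambda>x. f' x + g' x)"
  by (rule has_partialI) (intro DERIV_add has_partialD)

lemma has_partial_diff:
  "has_partial j f f' \<Longrightarrow> has_partial j g g' \<Longrightarrow> has_partial j (\<lambda>x. f x - g x) (\<lambda>x. f' x - g' x)"
  by (rule has_partialI) (intro DERIV_diff has_partialD)

lemma has_partial_mult:
  assumes "has_partial j f f'" "has_partial j g g'"
  shows "has_partial j (\<lambda>x. f x * g x) (\<lambda>x. f' x * g x + f x * g' x)"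
proof (rule has_partialI)
  fix x
  show "((\<lambda>h. f (x + h *\<^sub>R axis j 1) * g (x + h *\<^sub>R axis j 1)) has_real_derivative
      f' x * g x + f x * g' x) (at 0)"
    by (rule DERIV_mult[OF has_partialD[OF assms(1)] has_partialD[OF assms(2)], THEN DERIV_cong]) simp
qed

lemma has_partial_cmult: "has_partial j f f' \<Longrightarrow> has_partial j (\<lambda>x. k * f x) (\<lambda>x. k * f' x)"
  by (rule has_partialI) (intro DERIV_cmult has_partialD)

lemma has_partial_sum:
  "(\<And>i. i \<in> I \<Longrightarrow> has_partial j (f i) (f' i)) \<Longrightarrow>
     has_partial j (\<lambda>x. \<Sum>i\<in>I. f i x) (\<lambda>x. \<Sum>i\<in>I. f' i x)"
  by (rule has_partialI) (intro DERIV_sum has_partialD)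

lemma has_partial_compose:
  assumes "\<And>y. (J has_real_derivative J' y) (at y)" "has_partial j f f'"
  shows "has_partial j (\<lambda>x. J (f x)) (\<lambda>x. J' (f x) * f' x)"
proof (rule has_partialI)
  fix x
  show "((\<lambda>h. J (f (x + h *\<^sub>R axis j 1))) has_real_derivative J' (f x) * f' x) (at 0)"
    using DERIV_chain2[OF assms(1)[of "f (x + 0 *\<^sub>R axis j 1)"] has_partialD[OF assms(2), of x]] by simp
qed

lemma has_partial_cong:
  "has_partial j f f' \<Longrightarrow> (\<And>x. f' x = g' x) \<Longrightarrow> has_partial j f g'"
  by (simp add: has_partial_def)

text \<open>The bridge from Frechet derivatives to derivatives along a line.
  \<open>has_partial\<close> is purely one-dimensional, so it inherits the rules of
  \<open>DERIV\<close> and applies to cutoffs and compositions without a proof that these are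
  Frechet differentiable.\<close>

lemma differentiable_line_deriv:
  assumes "(f :: 'a::real_normed_vector \<Rightarrow> 'b::real_normed_vector) differentiable at x"
  shows "((\<lambda>h. f (x + h *\<^sub>R v)) has_vector_derivative frechet_derivative f (at x) v) (at 0)"
proof -
  have f: "(f has_derivative frechet_derivative f (at x)) (at (x + 0 *\<^sub>R v))"
    using assms frechet_derivative_works[of f "at x"] by simp
  have l: "((\<lambda>h. x + h *\<^sub>R v) has_derivative (\<lambda>h. h *\<^sub>R v)) (at 0)"
    by (auto intro!: derivative_eq_intros)
  have "linear (frechet_derivative f (at x))"
    using assms by (simp add: linear_frechet_derivative)
  then show ?thesis
    using diff_chain_at[OF l f] unfolding has_vector_derivative_def o_def
    by (simp add: linear_cmul)
qed

lemma has_partial_partial: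
  assumes "\<And>x. f differentiable at x"
  shows "has_partial j f (partial j f)"
  unfolding partial_def
  by (rule has_partialI)
    (use differentiable_line_deriv[OF assms] in \<open>simp add: has_real_derivative_iff_has_vector_derivative\<close>)

lemma partial_eqI:
  assumes "f differentiable at x" "((\<lambda>h. f (x + h *\<^sub>R axis j 1)) has_real_derivative d) (at 0)"
  shows "partial j f x = d"
  using differentiable_line_deriv[OF assms(1), of "axis j 1"] assms(2)
  unfolding partial_def has_real_derivative_iff_has_vector_derivative
  by (rule vector_derivative_unique_at)

lemma has_partial_partial_eq:
  "f differentiable at x \<Longrightarrow> has_partial j f f' \<Longrightarrow> partial j f x = f' x"
  by (rule partial_eqI) (auto dest: has_partialD)

section \<open>Derivatives of compactly supported functions integrate to zero\<close>

lemma integrable_continuous_compact_support: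
  fixes f :: "'a::euclidean_space \<Rightarrow> 'b::euclidean_space"
  assumes "continuous_on UNIV f" "compact K" "\<And>x. x \<notin> K \<Longrightarrow> f x = 0"
  shows "integrable lborel f"
proof -
  have "integrable lborel (\<lambda>x. indicator K x *\<^sub>R f x)"
    using borel_integrable_compact[OF assms(2) continuous_on_subset[OF assms(1)]] by auto
  moreover have "(\<lambda>x. indicator K x *\<^sub>R f x) = f"
    using assms(3) by (auto simp: indicator_def)
  ultimately show ?thesis by simp
qed

lemma integrable_translate:
  fixes f :: "'a::euclidean_space \<Rightarrow> real"
  assumes "integrable lborel f"
  shows "integrable lborel (\<lambda>x. f (x + v))"
proof -
  have "integrable (distr lborel borel ((+) v)) f"
    using assms lborel_distr_plus[of v] by simp
  then have "integrable lborel (\<lambda>x. f (v + x))"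
    using borel_measurable_integrable[OF assms]
    by (subst (asm) integrable_distr_eq) (auto simp: measurable_lborel1)
  then show ?thesis by (simp add: add.commute)
qed

lemma integral_translate:
  fixes f :: "'a::euclidean_space \<Rightarrow> real"
  assumes "f \<in> borel_measurable borel"
  shows "(LINT x|lborel. f (x + v)) = (LINT x|lborel. f x)"
proof -
  have "(LINT x|lborel. f x) = (LINT x|distr lborel borel ((+) v). f x)"
    by (simp add: lborel_distr_plus)
  also have "\<dots> = (LINT x|lborel. f (v + x))"
    using assms by (subst integral_distr) auto
  finally show ?thesis by (simp add: add.commute)
qed

text \<open>Difference quotients integrate to zero by translation invariance of Lebesgue measure.
  The mean value theorem bounds them uniformly, so dominated convergence passes this on to the
  derivative.\<close>

lemma integral_partial_eq_0:
  assumes f': "has_partial j f f'" and cf: "continuous_on UNIV f" and cf': "continuous_on UNIV f'"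
    and supp: "\<And>x. x \<notin> cball a R \<Longrightarrow> f x = 0"
  shows "(LINT x|lborel. f' x) = 0"
proof -
  let ?e = "axis j 1 :: real^3"
  have [simp]: "norm ?e = 1" by (simp add: norm_axis_1)
  have supp': "f' x = 0" if "x \<notin> cball a R" for x
  proof -
    have "isCont (\<lambda>h. x + h *\<^sub>R ?e) 0" by (intro continuous_intros)
    then have "((\<lambda>h. x + h *\<^sub>R ?e) \<longlongrightarrow> x) (at 0)" by (simp add: isCont_def)
    moreover have "open (- cball a R)" by auto
    ultimately have "eventually (\<lambda>h. x + h *\<^sub>R ?e \<in> - cball a R) (at 0)"
      using that topological_tendstoD by blast
    then have "eventually (\<lambda>h. f (x + h *\<^sub>R ?e) = 0) (nhds 0)"
      using that supp unfolding eventually_at_filter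
      by (auto elim!: eventually_mono)
    then have "((\<lambda>h. f (x + h *\<^sub>R ?e)) has_real_derivative 0) (at 0)"
      by (subst DERIV_cong_ev[where g="\<lambda>_. 0"]) auto
    then show ?thesis using has_partialD[OF f', of x] DERIV_unique by blast
  qed
  obtain B where B: "\<And>x. \<bar>f' x\<bar> \<le> B" "B \<ge> 0"
  proof -
    have "compact (f' ` cball a R)"
      by (intro compact_continuous_image continuous_on_subset[OF cf']) auto
    then obtain B where B: "\<And>y. y \<in> f' ` cball a R \<Longrightarrow> norm y \<le> B"
      using compact_imp_bounded bounded_iff by metis
    have "\<bar>f' x\<bar> \<le> max B 0" for x
      using B[of "f' x"] supp'[of x] by (cases "x \<in> cball a R") auto
    then show thesis by (intro that[of "max B 0"]) auto
  qed
  \<comment> \<open>Increments of length at most 1 keep all quotients supported in the ball of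
    radius \<open>R + 1\<close>, on which the dominating function lives.\<close>
  define h where "h n = 1 / (real n + 1)" for n
  have h: "0 < h n" "h n \<le> 1" for n by (auto simp: h_def)
  define q where "q n x = (f (x + h n *\<^sub>R ?e) - f x) / h n" for n x
  have [measurable]: "f \<in> borel_measurable borel" "f' \<in> borel_measurable borel"
    using cf cf' by (auto intro: borel_measurable_continuous_onI)
  have intf: "integrable lborel f"
    by (rule integrable_continuous_compact_support[OF cf compact_cball supp])
  have q0: "(LINT x|lborel. q n x) = 0" for n
    unfolding q_def using integrable_translate[OF intf] intf integral_translate[of f]
    by simp
  have q_bound: "\<bar>q n x\<bar> \<le> B * indicator (cball a (R + 1)) x" for n x
  proof (cases "x \<in> cball a (R + 1)")
    case True
    obtain y where "f (x + h n *\<^sub>R ?e) - f (x + 0 *\<^sub>R ?e) = (h n - 0) * f' (x + y *\<^sub>R ?e)"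
      using MVT2[of 0 "h n" "\<lambda>k. f (x + k *\<^sub>R ?e)" "\<lambda>k. f' (x + k *\<^sub>R ?e)"] h(1)[of n]
        has_partial_line[OF f'] by metis
    then have "q n x = f' (x + y *\<^sub>R ?e)" using h(1)[of n] by (simp add: q_def)
    then show ?thesis using B True by simp
  next
    case False
    have "dist a x \<le> dist a (x + h n *\<^sub>R ?e) + h n"
      using dist_triangle[of a x "x + h n *\<^sub>R ?e"] h(1)[of n] by (simp add: dist_norm)
    then have "x + h n *\<^sub>R ?e \<notin> cball a R" "x \<notin> cball a R"
      using False h(2)[of n] by auto
    then show ?thesis using supp False by (simp add: q_def)
  qed
  have q_lim: "(\<lambda>n. q n x) \<longlonglongrightarrow> f' x" for x
  proof -
    have "((\<lambda>k. (f (x + k *\<^sub>R ?e) - f x) / k) \<longlongrightarrow> f' x) (at 0)"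
      using has_partialD[OF f', of x] by (simp add: DERIV_def)
    moreover have "filterlim h (at 0) sequentially"
      unfolding filterlim_at
      using h LIMSEQ_inverse_real_of_nat
      by (auto simp: h_def[abs_def] inverse_eq_divide add.commute less_imp_neq[symmetric] intro!: always_eventually)
    ultimately show ?thesis unfolding q_def by (rule filterlim_compose)
  qed
  have "(\<lambda>n. LINT x|lborel. q n x) \<longlonglongrightarrow> (LINT x|lborel. f' x)"
  proof (rule integral_dominated_convergence[where w="\<lambda>x. B * indicator (cball a (R + 1)) x"])
    show "integrable lborel (\<lambda>x. B * indicator (cball a (R + 1)) x :: real)"
      by (intro integrable_mult_right integrable_real_indicator) (auto simp flip: infinity_ennreal_def intro!: emeasure_bounded_finite)
    show "q n \<in> borel_measurable lborel" for n unfolding q_def by measurable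
  qed (use q_bound q_lim in auto)
  then show ?thesis using q0 by (simp add: LIMSEQ_const_iff)
qed

section \<open>Cutoff functions\<close>

text \<open>The third power of the positive part makes this twice continuously differentiable, which
  is the regularity that the integrations by parts use, with derivatives that are explicit
  polynomials on the ball.\<close>

definition cutoff :: "real^3 \<Rightarrow> real \<Rightarrow> real^3 \<Rightarrow> real" where
  "cutoff a R x = (max 0 (1 - (norm (x - a))\<^sup>2 / R\<^sup>2)) ^ 3"

definition cutoff_d :: "real^3 \<Rightarrow> real \<Rightarrow> 3 \<Rightarrow> real^3 \<Rightarrow> real" where
  "cutoff_d a R j x = - 6 * (x $ j - a $ j) / R\<^sup>2 * (max 0 (1 - (norm (x - a))\<^sup>2 / R\<^sup>2))\<^sup>2"

definition cutoff_dd :: "real^3 \<Rightarrow> real \<Rightarrow> 3 \<Rightarrow> real^3 \<Rightarrow> real" where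
  "cutoff_dd a R j x = - 6 / R\<^sup>2 * (max 0 (1 - (norm (x - a))\<^sup>2 / R\<^sup>2))\<^sup>2
     + 24 * (x $ j - a $ j)\<^sup>2 / R ^ 4 * max 0 (1 - (norm (x - a))\<^sup>2 / R\<^sup>2)"

text \<open>The exponent is written \<open>k + 2\<close> because a positive part needs at least a
  square to be differentiable at 0; there the difference quotient is at most |h|^(k+1).\<close>

lemma DERIV_pos_part_power:
  "((\<lambda>y::real. (max 0 y) ^ (k + 2)) has_real_derivative real (k + 2) * (max 0 y) ^ (k + 1)) (at y)"
proof -
  consider "y > 0" | "y < 0" | "y = 0" by linarith
  then show ?thesis
  proof cases
    case 1
    have "((\<lambda>y::real. y ^ (k + 2)) has_real_derivative real (k + 2) * (max 0 y) ^ (k + 1)) (at y)"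
      using 1 DERIV_pow[of "k + 2" y] by simp
    moreover have "eventually (\<lambda>y::real. y > 0) (nhds y)"
      using 1 eventually_gt_at_top by (intro eventually_nhds_in_open[of "{0<..}", simplified]) auto
    ultimately show ?thesis
      by (subst DERIV_cong_ev[where g="\<lambda>y. y ^ (k + 2)"]) (auto elim: eventually_mono)
  next
    case 2
    have "eventually (\<lambda>y::real. y < 0) (nhds y)"
      using 2 by (intro eventually_nhds_in_open[of "{..<0}", simplified]) auto
    then show ?thesis using 2
      by (subst DERIV_cong_ev[where g="\<lambda>y. 0"]) (auto elim: eventually_mono simp: max_def)
  next
    case 3
    have "((\<lambda>h::real. (max 0 h) ^ (k + 2) / h) \<longlongrightarrow> 0) (at 0)"
    proof (rule Lim_null_comparison)
      show "eventually (\<lambda>h::real. norm ((max 0 h) ^ (k + 2) / h) \<le> \<bar>h\<bar> ^ (k + 1)) (at 0)"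
        by (rule always_eventually) (auto simp: max_def mult_nonpos_nonneg)
      show "((\<lambda>h::real. \<bar>h\<bar> ^ (k + 1)) \<longlongrightarrow> 0) (at 0)"
        by (auto intro!: tendsto_eq_intros)
    qed
    then show ?thesis using 3 by (simp add: DERIV_def)
  qed
qed

lemma has_partial_norm_sq: "has_partial j (\<lambda>x. (norm (x - a))\<^sup>2) (\<lambda>x. 2 * (x $ j - a $ j))"
proof (rule has_partialI)
  fix x :: "real^3"
  have "(norm (x + h *\<^sub>R axis j 1 - a))\<^sup>2 = (norm (x - a))\<^sup>2 + 2 * h * (x $ j - a $ j) + h\<^sup>2" for h
  proof -
    have "(norm ((x - a) + h *\<^sub>R axis j 1))\<^sup>2 = (norm (x - a))\<^sup>2 + 2 * h * ((x - a) $ j) + h\<^sup>2"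
      unfolding power2_norm_eq_inner inner_add_left inner_add_right
      by (simp add: inner_axis inner_axis' power2_eq_square)
    then show ?thesis by (simp add: algebra_simps)
  qed
  then show "((\<lambda>h. (norm (x + h *\<^sub>R axis j 1 - a))\<^sup>2) has_real_derivative 2 * (x $ j - a $ j)) (at 0)"
    by (auto intro!: derivative_eq_intros)
qed

lemma has_partial_cutoff_base:
  "has_partial j (\<lambda>x. 1 - (norm (x - a))\<^sup>2 / R\<^sup>2) (\<lambda>x. - 2 * (x $ j - a $ j) / R\<^sup>2)"
  by (rule has_partialI, rule DERIV_cong[OF DERIV_diff[OF DERIV_const
      DERIV_cdivide[OF has_partialD[OF has_partial_norm_sq]]]]) (simp add: divide_inverse algebra_simps)

lemma has_partial_cutoff: "has_partial j (cutoff a R) (cutoff_d a R j)"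
proof -
  have "has_partial j (cutoff a R)
    (\<lambda>x. (real (1 + 2) * (max 0 (1 - (norm (x - a))\<^sup>2 / R\<^sup>2)) ^ (1 + 1)) * (- 2 * (x $ j - a $ j) / R\<^sup>2))"
    using has_partial_compose[OF DERIV_pos_part_power[where k=1] has_partial_cutoff_base[of j a R]]
    by (simp add: cutoff_def[abs_def] numeral_3_eq_3)
  then show ?thesis
    by (rule has_partial_cong) (simp add: cutoff_d_def power2_eq_square)
qed

lemma has_partial_cutoff_d: "has_partial j (cutoff_d a R j) (cutoff_dd a R j)"
proof -
  have 1: "has_partial j (\<lambda>x. - 6 * (x $ j - a $ j) / R\<^sup>2) (\<lambda>x. - 6 / R\<^sup>2)"
    by (rule has_partialI, rule DERIV_cong[OF DERIV_cdivide[OF DERIV_cmult[OF DERIV_diff[OF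
        has_partialD[OF has_partial_nth] DERIV_const]]]]) simp
  have 2: "has_partial j (\<lambda>x. (max 0 (1 - (norm (x - a))\<^sup>2 / R\<^sup>2))\<^sup>2)
     (\<lambda>x. 2 * max 0 (1 - (norm (x - a))\<^sup>2 / R\<^sup>2) * (- 2 * (x $ j - a $ j) / R\<^sup>2))"
    using has_partial_compose[OF DERIV_pos_part_power[where k=0] has_partial_cutoff_base[of j a R]]
    by (simp add: numeral_2_eq_2)
  have "R\<^sup>2 * R\<^sup>2 = R ^ 4" using power_add[of R 2 2] by simp
  \<comment> \<open>With Q for R^2 this holds for Q = 0 as well, since division by zero yields
    0.\<close>
  have eq: "- 6 / Q * m\<^sup>2 + - 6 * d / Q * (2 * m * (- 2 * d / Q)) = - 6 / Q * m\<^sup>2 + 24 * d\<^sup>2 / (Q * Q) * m"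
    for Q m d :: real
    by (simp add: power2_eq_square)
  show ?thesis
    using has_partial_mult[OF 1 2] unfolding cutoff_d_def
    by (rule has_partial_cong) (simp only: cutoff_dd_def eq flip: \<open>R\<^sup>2 * R\<^sup>2 = R ^ 4\<close>)
qed

lemma continuous_cutoff:
  "continuous_on S (cutoff a R)" "continuous_on S (cutoff_d a R j)" "continuous_on S (cutoff_dd a R j)"
  unfolding cutoff_def cutoff_d_def cutoff_dd_def divide_inverse
  by (intro continuous_intros)+

lemma cutoff_nonneg: "0 \<le> cutoff a R x"
  by (simp add: cutoff_def)

lemma cutoff_le_1: "cutoff a R x \<le> 1"
  by (simp add: cutoff_def power_le_one)

lemma cutoff_base_outside:
  assumes "x \<notin> cball a R" "R > 0"
  shows "max 0 (1 - (norm (x - a))\<^sup>2 / R\<^sup>2) = 0"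
proof -
  have "R\<^sup>2 \<le> (norm (x - a))\<^sup>2"
    using assms by (intro power_mono) (auto simp: dist_norm norm_minus_commute)
  then show ?thesis using assms by (simp add: field_simps)
qed

lemma cutoff_outside:
  assumes "x \<notin> cball a R" "R > 0"
  shows "cutoff a R x = 0" "cutoff_d a R j x = 0" "cutoff_dd a R j x = 0"
  using cutoff_base_outside[OF assms] by (simp_all add: cutoff_def cutoff_d_def cutoff_dd_def)

lemma cutoff_d_le:
  assumes "R > 0"
  shows "\<bar>cutoff_d a R j x\<bar> \<le> 6 / R"
proof (cases "x \<in> cball a R")
  case True
  let ?m = "max 0 (1 - (norm (x - a))\<^sup>2 / R\<^sup>2)"
  have j: "\<bar>x $ j - a $ j\<bar> \<le> R"
    using True component_le_norm_cart[of "x - a" j] by (simp add: dist_norm norm_minus_commute)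
  have "?m\<^sup>2 \<le> 1" by (simp add: power_le_one)
  then have "\<bar>x $ j - a $ j\<bar> * ?m\<^sup>2 \<le> R * 1"
    using j by (intro mult_mono) auto
  then have "6 * (\<bar>x $ j - a $ j\<bar> * ?m\<^sup>2) / R\<^sup>2 \<le> 6 * R / R\<^sup>2"
    by (intro divide_right_mono) auto
  also have "\<dots> = 6 / R" using assms by (simp add: power2_eq_square)
  finally have "6 * (\<bar>x $ j - a $ j\<bar> * ?m\<^sup>2) / R\<^sup>2 \<le> 6 / R" .
  moreover have "\<bar>cutoff_d a R j x\<bar> = 6 * (\<bar>x $ j - a $ j\<bar> * ?m\<^sup>2) / R\<^sup>2"
    unfolding cutoff_d_def abs_mult abs_divide by (simp del: right_diff_distrib)
  ultimately show ?thesis by simp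
qed (use cutoff_outside assms in auto)

text \<open>The 30 is 6 + 24, the sizes of the two terms of \<open>cutoff_dd\<close> on the
  ball.\<close>

lemma cutoff_dd_le:
  assumes "R > 0"
  shows "\<bar>cutoff_dd a R j x\<bar> \<le> 30 / R\<^sup>2"
proof (cases "x \<in> cball a R")
  case True
  let ?m = "max 0 (1 - (norm (x - a))\<^sup>2 / R\<^sup>2)"
  have "\<bar>x $ j - a $ j\<bar> \<le> R"
    using True component_le_norm_cart[of "x - a" j] by (simp add: dist_norm norm_minus_commute)
  then have j: "(x $ j - a $ j)\<^sup>2 \<le> R\<^sup>2" using assms by (simp add: abs_le_square_iff[symmetric])
  have m: "?m\<^sup>2 \<le> 1" "?m \<le> 1" "0 \<le> ?m" by (simp_all add: power_le_one)
  have R4: "R ^ 4 = R\<^sup>2 * R\<^sup>2" using power_add[of R 2 2] by simp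
  have "24 * (x $ j - a $ j)\<^sup>2 / R ^ 4 * ?m \<le> 24 * R\<^sup>2 / R ^ 4 * 1"
    using j m by (intro mult_mono divide_right_mono) auto
  also have "\<dots> = 24 / R\<^sup>2"
  proof -
    have "R\<^sup>2 \<noteq> 0" using assms by simp
    then show ?thesis unfolding R4 by (metis mult.right_neutral nonzero_mult_divide_mult_cancel_right)
  qed
  finally have 1: "24 * (x $ j - a $ j)\<^sup>2 / R ^ 4 * ?m \<le> 24 / R\<^sup>2" .
  have 2: "0 \<le> 24 * (x $ j - a $ j)\<^sup>2 / R ^ 4 * ?m" by simp
  have 3: "6 / R\<^sup>2 * ?m\<^sup>2 \<le> 6 / R\<^sup>2 * 1" using m by (intro mult_left_mono) auto
  have 4: "0 \<le> 6 / R\<^sup>2 * ?m\<^sup>2" by simp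
  have "\<bar>cutoff_dd a R j x\<bar> \<le> 6 / R\<^sup>2 + 24 / R\<^sup>2"
  proof -
    have "cutoff_dd a R j x = 24 * (x $ j - a $ j)\<^sup>2 / R ^ 4 * ?m - 6 / R\<^sup>2 * ?m\<^sup>2"
      by (simp add: cutoff_dd_def)
    moreover have "c = p - q \<Longrightarrow> p \<le> A \<Longrightarrow> 0 \<le> p \<Longrightarrow> q \<le> B * 1 \<Longrightarrow> 0 \<le> q \<Longrightarrow> \<bar>c\<bar> \<le> B + A"
      for c p q A B :: real by linarith
    ultimately show ?thesis using 1 2 3 4 by blast
  qed
  then show ?thesis by (simp flip: add_divide_distrib)
qed (use cutoff_outside assms in auto)

lemma cutoff_tendsto_1:
  assumes "filterlim R at_top sequentially"
  shows "(\<lambda>n. cutoff a (R n) x) \<longlonglongrightarrow> 1"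
proof -
  have "(\<lambda>n. (norm (x - a))\<^sup>2 / (R n)\<^sup>2) \<longlonglongrightarrow> 0"
    by (intro tendsto_divide_0[OF tendsto_const] filterlim_at_top_imp_at_infinity
        filterlim_pow_at_top assms) auto
  then have "(\<lambda>n. (max 0 (1 - (norm (x - a))\<^sup>2 / (R n)\<^sup>2)) ^ 3) \<longlonglongrightarrow> (max 0 (1 - 0)) ^ 3"
    by (intro tendsto_intros)
  then show ?thesis by (simp add: cutoff_def)
qed

section \<open>Smooth functions of time and space\<close>

lemma frechet_derivative_cong_open:
  assumes "open S" "x \<in> S" "\<And>y. y \<in> S \<Longrightarrow> f y = g y" "f differentiable at x"
  shows "g differentiable at x" "frechet_derivative g (at x) = frechet_derivative f (at x)"
proof -
  have "(f has_derivative frechet_derivative f (at x)) (at x)"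
    using assms(4) frechet_derivative_works by blast
  then have g: "(g has_derivative frechet_derivative f (at x)) (at x)"
    by (rule has_derivative_transform_within_open[OF _ assms(1,2)]) (use assms(3) in auto)
  then show "g differentiable at x" by (auto simp: differentiable_def)
  show "frechet_derivative g (at x) = frechet_derivative f (at x)"
    using frechet_derivative_at[OF g] by simp
qed

text \<open>Derivatives of time slices agree with joint Frechet derivatives only on
  \<open>spacetime\<close>, so smoothness has to be transferred through equality on an open
  set.\<close>

lemma C_k_on_cong:
  assumes "open S" "\<And>x. x \<in> S \<Longrightarrow> f x = g x" "C_k_on k S f"
  shows "C_k_on k S g"
  using assms(2,3)
proof (induction k arbitrary: f g)
  case 0
  then show ?case by (auto cong: continuous_on_cong)
next
  case (Suc k)
  have d: "f differentiable at x" if "x \<in> S" for x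
    using Suc.prems(2) that assms(1) by (auto simp: differentiable_on_eq_differentiable_at)
  note fg = frechet_derivative_cong_open[OF assms(1) _ Suc.prems(1) d]
  have "C_k_on k S (\<lambda>x. frechet_derivative g (at x) b)" if "b \<in> Basis" for b
  proof (rule Suc.IH)
    show "C_k_on k S (\<lambda>x. frechet_derivative f (at x) b)" using Suc.prems(2) that by simp
    show "frechet_derivative f (at x) b = frechet_derivative g (at x) b" if "x \<in> S" for x
      by (subst fg(2)) (use that in auto)
  qed
  moreover have "g differentiable_on S"
    unfolding differentiable_on_eq_differentiable_at[OF assms(1)] using fg(1) by blast
  ultimately show ?case by simp
qed

lemma smooth_on_cong:
  "open S \<Longrightarrow> (\<And>x. x \<in> S \<Longrightarrow> f x = g x) \<Longrightarrow> smooth_on S f \<Longrightarrow> smooth_on S g"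
  unfolding smooth_on_def using C_k_on_cong by blast

lemma smooth_on_continuous_on: "smooth_on S f \<Longrightarrow> continuous_on S f"
  unfolding smooth_on_def using C_k_on.simps(1) by blast

lemma smooth_on_differentiable:
  assumes "smooth_on S f" "open S" "x \<in> S"
  shows "f differentiable at x"
proof -
  have "C_k_on (Suc 0) S f" using assms(1) unfolding smooth_on_def by blast
  then show ?thesis using assms(2,3) by (auto simp: differentiable_on_eq_differentiable_at)
qed

lemma smooth_on_frechet_derivative:
  assumes "smooth_on S f" "b \<in> Basis"
  shows "smooth_on S (\<lambda>x. frechet_derivative f (at x) b)"
  unfolding smooth_on_def
proof
  fix k
  have "C_k_on (Suc k) S f" using assms(1) unfolding smooth_on_def by blast
  then show "C_k_on k S (\<lambda>x. frechet_derivative f (at x) b)" using assms(2) by simp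
qed

lemma C_k_on_vec_nth:
  fixes f :: "'a::euclidean_space \<Rightarrow> real^'n"
  assumes "open S" "C_k_on k S f"
  shows "C_k_on k S (\<lambda>x. f x $ j)"
  using assms(2)
proof (induction k arbitrary: f)
  case 0
  then show ?case by (auto intro!: continuous_intros)
next
  case (Suc k)
  have d: "(f has_derivative frechet_derivative f (at x)) (at x)" if "x \<in> S" for x
    using Suc.prems that assms(1) frechet_derivative_works
    by (auto simp: differentiable_on_eq_differentiable_at)
  have dj: "((\<lambda>x. f x $ j) has_derivative (\<lambda>h. frechet_derivative f (at x) h $ j)) (at x)" if "x \<in> S" for x
    using bounded_linear.has_derivative[OF bounded_linear_vec_nth d[OF that]] .
  have eq: "frechet_derivative f (at x) b $ j = frechet_derivative (\<lambda>x. f x $ j) (at x) b" if "x \<in> S" for x b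
    using frechet_derivative_at[OF dj[OF that]] by metis
  have "C_k_on k S (\<lambda>x. frechet_derivative (\<lambda>x. f x $ j) (at x) b)" if "b \<in> Basis" for b
    using Suc.prems that
    by (intro C_k_on_cong[OF assms(1) eq Suc.IH[of "\<lambda>x. frechet_derivative f (at x) b"]]) auto
  moreover have "(\<lambda>x. f x $ j) differentiable at x" if "x \<in> S" for x
    using dj[OF that] by (auto simp: differentiable_def)
  ultimately show ?case
    using assms(1) by (auto simp: differentiable_on_eq_differentiable_at)
qed

lemma smooth_on_vec_nth:
  fixes f :: "'a::euclidean_space \<Rightarrow> real^'n"
  shows "open S \<Longrightarrow> smooth_on S f \<Longrightarrow> smooth_on S (\<lambda>x. f x $ j)"
  unfolding smooth_on_def using C_k_on_vec_nth by blast

abbreviation spacetime :: "(real \<times> (real^3)) set" where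
  "spacetime \<equiv> {0<..} \<times> UNIV"

lemma open_spacetime: "open spacetime"
  by (intro open_Times) auto

lemma spacetime_slice:
  fixes f :: "real \<Rightarrow> real^3 \<Rightarrow> 'b::real_normed_vector"
  assumes "smooth_on spacetime (\<lambda>(t, x). f t x)" "t > 0"
  shows "(f t has_derivative (\<lambda>h. frechet_derivative (\<lambda>(t, x). f t x) (at (t, x)) (0, h))) (at x)"
    "((\<lambda>s. f s x) has_derivative (\<lambda>h. frechet_derivative (\<lambda>(t, x). f t x) (at (t, x)) (h, 0))) (at t)"
proof -
  let ?F = "\<lambda>(t, x). f t x"
  have F: "(?F has_derivative frechet_derivative ?F (at (t, x))) (at (t, x))"
    using smooth_on_differentiable[OF assms(1) open_spacetime, of "(t, x)"] assms(2)
    by (simp add: frechet_derivative_works)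
  have "((\<lambda>y. (t, y)) has_derivative (\<lambda>h. (0, h))) (at x)"
    by (auto intro!: derivative_eq_intros)
  from diff_chain_at[OF this F]
  show "(f t has_derivative (\<lambda>h. frechet_derivative ?F (at (t, x)) (0, h))) (at x)"
    by (simp add: o_def)
  have "((\<lambda>s. (s, x)) has_derivative (\<lambda>h. (h, 0))) (at t)"
    by (auto intro!: derivative_eq_intros)
  from diff_chain_at[OF this F]
  show "((\<lambda>s. f s x) has_derivative (\<lambda>h. frechet_derivative ?F (at (t, x)) (h, 0))) (at t)"
    by (simp add: o_def)
qed

lemma smooth_slice_differentiable:
  assumes "smooth_on spacetime (\<lambda>(t, x). f t x)" "t > 0"
  shows "f t differentiable at x"
  using spacetime_slice(1)[OF assms] by (auto simp: differentiable_def)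

lemma smooth_has_partial:
  assumes "smooth_on spacetime (\<lambda>(t, x). f t x)" "t > 0"
  shows "has_partial j (f t) (partial j (f t))"
  by (rule has_partial_partial) (rule smooth_slice_differentiable[OF assms])

text \<open>On \<open>spacetime\<close> the partial derivative of a slice is the joint derivative in
  the direction \<open>(0, axis j 1)\<close>, and joint derivatives along basis vectors remain
  smooth.\<close>

lemma smooth_partial:
  assumes "smooth_on spacetime (\<lambda>(t, x). f t x)"
  shows "smooth_on spacetime (\<lambda>(t, x). partial j (f t) x)"
proof -
  have "(0, axis j 1) \<in> (Basis :: (real \<times> (real^3)) set)"
    by (auto simp: Basis_prod_def)
  from smooth_on_frechet_derivative[OF assms this] show ?thesis
    by (rule smooth_on_cong[OF open_spacetime, rotated])
      (auto simp: partial_def frechet_derivative_at[OF spacetime_slice(1)[OF assms], symmetric])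
qed

lemma smooth_has_deriv:
  assumes "smooth_on spacetime (\<lambda>(t, x). f t x)" "t > 0"
  shows "((\<lambda>s. f s x) has_real_derivative deriv (\<lambda>s. f s x) t) (at t)"
proof -
  have "(\<lambda>s. f s x) differentiable at t"
    using spacetime_slice(2)[OF assms] by (auto simp: differentiable_def)
  then show ?thesis
    by (simp add: DERIV_deriv_iff_real_differentiable)
qed

lemma smooth_deriv:
  assumes "smooth_on spacetime (\<lambda>(t, x). f t x)"
  shows "smooth_on spacetime (\<lambda>(t, x). deriv (\<lambda>s. f s x) t :: real)"
proof -
  let ?F = "\<lambda>(t, x). f t x"
  have eq: "deriv (\<lambda>s. f s x) t = frechet_derivative ?F (at (t, x)) (1, 0)" if "t > 0" for t x
  proof -
    have "(\<lambda>h. deriv (\<lambda>s. f s x) t * h) = (\<lambda>h. frechet_derivative ?F (at (t, x)) (h, 0))"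
      by (rule has_derivative_unique[OF smooth_has_deriv[OF assms that, unfolded has_field_derivative_def]
            spacetime_slice(2)[OF assms that]])
    from fun_cong[OF this, of 1] show ?thesis by simp
  qed
  have "(1, 0) \<in> (Basis :: (real \<times> (real^3)) set)"
    by (auto simp: Basis_prod_def)
  from smooth_on_frechet_derivative[OF assms this] show ?thesis
    by (rule smooth_on_cong[OF open_spacetime, rotated]) (auto simp: eq)
qed

lemma smooth_continuous_slice:
  assumes "continuous_on spacetime (\<lambda>(t, x). f t x)" "t > 0"
  shows "continuous_on UNIV (f t)"
proof -
  have "continuous_on UNIV (\<lambda>x. (\<lambda>(t, x). f t x) (t, x))"
    using assms by (intro continuous_on_compose2[OF assms(1)] continuous_intros) auto
  then show ?thesis by simp
qed

lemma smooth_slice_laplacian: "laplacian f x = (\<Sum>j\<in>UNIV. partial j (partial j f) x)"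
  by (simp add: laplacian_def divergence_def grad_def)

lemma inner_grad: "v \<bullet> grad f x = (\<Sum>j\<in>UNIV. v $ j * partial j f x)"
  by (simp add: inner_vec_def grad_def)

section \<open>Weak derivatives\<close>

lemma C_k_on_SucD:
  "C_k_on (Suc k) S f \<Longrightarrow> C_k_on k S f"
proof (induction k arbitrary: f)
  case 0
  then show ?case by (simp add: differentiable_imp_continuous_on)
next
  case (Suc k)
  then show ?case by (metis C_k_on.simps(2))
qed

lemma C_k_on_add:
  assumes "open S" "C_k_on k S f" "C_k_on k S g"
  shows "C_k_on k S (\<lambda>x. f x + g x)"
  using assms(2,3)
proof (induction k arbitrary: f g)
  case 0
  then show ?case by (auto intro!: continuous_intros)
next
  case (Suc k)
  have df: "f differentiable at x" and dg: "g differentiable at x" if "x \<in> S" for x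
    using Suc.prems that assms(1) by (auto simp: differentiable_on_eq_differentiable_at)
  have "C_k_on k S (\<lambda>x. frechet_derivative (\<lambda>x. f x + g x) (at x) b)" if b: "b \<in> Basis" for b
  proof (rule C_k_on_cong[OF assms(1)])
    show "C_k_on k S (\<lambda>x. frechet_derivative f (at x) b + frechet_derivative g (at x) b)"
      using Suc.prems b by (intro Suc.IH) auto
    show "frechet_derivative f (at x) b + frechet_derivative g (at x) b =
        frechet_derivative (\<lambda>x. f x + g x) (at x) b" if "x \<in> S" for x
      using frechet_derivative_at[OF has_derivative_add[OF frechet_derivative_works[THEN iffD1, OF df[OF that]]
            frechet_derivative_works[THEN iffD1, OF dg[OF that]]]] by metis
  qed
  then show ?case
    using df dg assms(1) by (auto simp: differentiable_on_eq_differentiable_at)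
qed

lemma C_k_on_mult:
  fixes f g :: "'a::euclidean_space \<Rightarrow> real"
  assumes "open S" "C_k_on k S f" "C_k_on k S g"
  shows "C_k_on k S (\<lambda>x. f x * g x)"
  using assms(2,3)
proof (induction k arbitrary: f g)
  case 0
  then show ?case by (auto intro!: continuous_intros)
next
  case (Suc k)
  have df: "f differentiable at x" and dg: "g differentiable at x" if "x \<in> S" for x
    using Suc.prems that assms(1) by (auto simp: differentiable_on_eq_differentiable_at)
  have "C_k_on k S (\<lambda>x. frechet_derivative (\<lambda>x. f x * g x) (at x) b)" if b: "b \<in> Basis" for b
  proof (rule C_k_on_cong[OF assms(1)])
    show "C_k_on k S (\<lambda>x. f x * frechet_derivative g (at x) b + frechet_derivative f (at x) b * g x)"
      using Suc.prems b C_k_on_SucD[OF Suc.prems(1)] C_k_on_SucD[OF Suc.prems(2)]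
      by (intro C_k_on_add assms(1) Suc.IH) auto
    show "f x * frechet_derivative g (at x) b + frechet_derivative f (at x) b * g x =
        frechet_derivative (\<lambda>x. f x * g x) (at x) b" if "x \<in> S" for x
      using frechet_derivative_at[OF has_derivative_mult[OF frechet_derivative_works[THEN iffD1, OF df[OF that]]
            frechet_derivative_works[THEN iffD1, OF dg[OF that]]]] by metis
  qed
  then show ?case
    using df dg assms(1) by (auto simp: differentiable_on_eq_differentiable_at)
qed

lemma C_k_on_const: "C_k_on k S (\<lambda>x. c)"
proof (induction k arbitrary: c)
  case (Suc k)
  then show ?case by (simp add: frechet_derivative_const)
qed auto

lemma C_k_on_prod:
  fixes f :: "'i \<Rightarrow> 'a::euclidean_space \<Rightarrow> real"
  assumes "open S" "finite I" "\<And>i. i \<in> I \<Longrightarrow> C_k_on k S (f i)"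
  shows "C_k_on k S (\<lambda>x. \<Prod>i\<in>I. f i x)"
  using assms(2,3) by (induction I) (auto intro!: C_k_on_mult C_k_on_const assms(1))

section \<open>Smooth bump functions\<close>

definition flat :: "real poly \<Rightarrow> real \<Rightarrow> real" where
  "flat P y = (if y \<le> 0 then 0 else poly P (1 / y) * exp (- (1 / y)))"

lemma poly_mult_exp_neg_tendsto_0: "((\<lambda>y::real. poly P y * exp (- y)) \<longlongrightarrow> 0) at_top"
proof -
  have "((\<lambda>y::real. \<Sum>i\<le>degree P. coeff P i * (y ^ i / exp y)) \<longlongrightarrow> (\<Sum>i\<le>degree P. coeff P i * 0)) at_top"
    by (intro tendsto_sum tendsto_mult tendsto_const tendsto_power_div_exp_0)
  then show ?thesis
    by (simp add: poly_altdef sum_distrib_right exp_minus field_simps sum_divide_distrib)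
qed

text \<open>Differentiating P(1/y) exp(-1/y) turns the polynomial P into X^2 (P - P'). The family
  \<open>flat P\<close> is therefore closed under differentiation, and smoothness follows by an
  induction that ranges over all P.\<close>

lemma DERIV_flat:
  "(flat P has_real_derivative flat (pCons 0 (pCons 0 (P - pderiv P))) y) (at y)"
proof -
  consider "y > 0" | "y < 0" | "y = 0" by linarith
  then show ?thesis
  proof cases
    case 1
    have "((\<lambda>y. poly P (1 / y) * exp (- (1 / y))) has_real_derivative
        flat (pCons 0 (pCons 0 (P - pderiv P))) y) (at y)"
      using 1 by (auto intro!: derivative_eq_intros poly_DERIV[THEN DERIV_chain2]
          simp: flat_def field_simps power2_eq_square)
    moreover have "eventually (\<lambda>y::real. y > 0) (nhds y)"
      using 1 by (intro eventually_nhds_in_open[of "{0<..}", simplified]) auto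
    ultimately show ?thesis
      by (subst DERIV_cong_ev[where g="\<lambda>y. poly P (1 / y) * exp (- (1 / y))"])
        (auto elim!: eventually_mono simp: flat_def)
  next
    case 2
    have "eventually (\<lambda>y::real. y < 0) (nhds y)"
      using 2 by (intro eventually_nhds_in_open[of "{..<0}", simplified]) auto
    then show ?thesis using 2
      by (subst DERIV_cong_ev[where g="\<lambda>y. 0"]) (auto elim!: eventually_mono simp: flat_def)
  next
    case 3
    \<comment> \<open>Dividing by h multiplies the polynomial in 1/h by X, so the quotient from the
      right is again a polynomial against a decaying exponential.\<close>
    have "((\<lambda>h. poly (pCons 0 P) (1 / h) * exp (- (1 / h))) \<longlongrightarrow> 0) (at_right 0)"
      using filterlim_compose[OF poly_mult_exp_neg_tendsto_0[of "pCons 0 P"] filterlim_inverse_at_top_right]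
      by (simp only: inverse_eq_divide)
    then have r: "((\<lambda>h. flat P h / h) \<longlongrightarrow> 0) (at_right 0)"
      by (rule Lim_transform_eventually)
        (auto simp: flat_def eventually_at_right_less eventually_at_filter)
    have l: "((\<lambda>h. flat P h / h) \<longlongrightarrow> 0) (at_left 0)"
      by (rule Lim_transform_eventually[OF tendsto_const])
        (auto simp: flat_def eventually_at_filter)
    show ?thesis using 3 filterlim_split_at[OF l r] by (simp add: DERIV_def flat_def)
  qed
qed

lemma C_k_on_flat_affine:
  "C_k_on k UNIV (\<lambda>x::real^3. flat P (c * x $ i + d))"
proof (induction k arbitrary: P)
  case 0
  have "continuous_on UNIV (flat P)"
    by (intro continuous_at_imp_continuous_on ballI DERIV_isCont[OF DERIV_flat])
  moreover have "continuous_on UNIV (\<lambda>x::real^3. c * x $ i + d)"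
    by (intro continuous_intros)
  ultimately have "continuous_on UNIV (\<lambda>x::real^3. flat P (c * x $ i + d))"
    by (rule continuous_on_compose2) simp
  then show ?case by simp
next
  case (Suc k)
  let ?P = "pCons 0 (pCons 0 (P - pderiv P))"
  have d: "((\<lambda>x::real^3. flat P (c * x $ i + d)) has_derivative
      (\<lambda>h. flat ?P (c * x $ i + d) * (c * h $ i))) (at x)" for x
  proof -
    have "((\<lambda>x::real^3. c * x $ i + d) has_derivative (\<lambda>h. c * h $ i + 0)) (at x)"
      by (intro has_derivative_add has_derivative_const has_derivative_mult_right
          bounded_linear_imp_has_derivative bounded_linear_vec_nth)
    from has_derivative_compose[OF this DERIV_flat[unfolded has_field_derivative_def]]
    show ?thesis by simp
  qed
  have "C_k_on k UNIV (\<lambda>x. frechet_derivative (\<lambda>x::real^3. flat P (c * x $ i + d)) (at x) b)" for b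
    unfolding frechet_derivative_at[OF d, symmetric]
    by (intro C_k_on_mult Suc.IH C_k_on_const) auto
  then show ?case
    using d by (auto simp: differentiable_on_def differentiable_def)
qed

text \<open>One factor for each face of the box, with arguments expanded as n x + d to match
  \<open>C_k_on_flat_affine\<close>. These functions stay below the indicator of the open box and
  converge to it as n grows.\<close>

definition box_bump :: "nat \<Rightarrow> real^3 \<Rightarrow> real^3 \<Rightarrow> real^3 \<Rightarrow> real" where
  "box_bump n a b x = (\<Prod>i\<in>UNIV. flat 1 (n * x $ i + - (n * a $ i)) * flat 1 (- n * x $ i + n * b $ i))"

lemma flat_1_bounds: "0 \<le> flat 1 y" "flat 1 y \<le> 1"
  by (auto simp: flat_def)

lemma mem_box_vec: "x \<in> box a (b :: real^3) \<longleftrightarrow> (\<forall>i. a $ i < x $ i \<and> x $ i < b $ i)"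
  by (simp add: mem_box_cart)

lemma box_bump_bounds: "0 \<le> box_bump n a b x" "box_bump n a b x \<le> 1"
  unfolding box_bump_def by (auto intro!: prod_nonneg prod_le_1 mult_le_one mult_nonneg_nonneg flat_1_bounds)

lemma box_bump_outside:
  assumes "x \<notin> box a b"
  shows "box_bump n a b x = 0"
proof -
  obtain i where "x $ i \<le> a $ i \<or> b $ i \<le> x $ i" using assms by (auto simp: mem_box_vec not_less)
  then have "n * x $ i + - (n * a $ i) \<le> 0 \<or> - n * x $ i + n * b $ i \<le> 0"
    by (auto intro: mult_left_mono)
  then have "flat 1 (n * x $ i + - (n * a $ i)) * flat 1 (- n * x $ i + n * b $ i) = 0"
    by (auto simp: flat_def)
  then show ?thesis unfolding box_bump_def by (intro prod_zero) auto
qed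

lemma test_function_box_bump: "test_function (box_bump n a b)"
proof -
  have "{x. box_bump n a b x \<noteq> 0} \<subseteq> box a b" using box_bump_outside by blast
  moreover have "C_k_on k UNIV (box_bump n a b)" for k
    unfolding box_bump_def[abs_def]
    by (intro C_k_on_prod C_k_on_mult C_k_on_flat_affine) auto
  ultimately show ?thesis
    unfolding test_function_def smooth_on_def using bounded_subset[OF bounded_box] by blast
qed

lemma flat_1_tendsto_1:
  assumes "y > 0"
  shows "(\<lambda>n. flat 1 (real n * y)) \<longlonglongrightarrow> 1"
proof -
  have "(\<lambda>n. exp (- (1 / y * inverse (real n)))) \<longlonglongrightarrow> exp (- (1 / y * 0))"
    by (intro tendsto_intros lim_inverse_n)
  \<comment> \<open>The index n = 0 is left out: \<open>flat 1 0\<close> is 0, whereas the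
    exponential is 1 there because \<open>inverse 0\<close> is 0.\<close>
  moreover have "eventually (\<lambda>n. exp (- (1 / y * inverse (real n))) = flat 1 (real n * y)) sequentially"
    using assms by (intro eventually_sequentiallyI[of 1]) (auto simp: flat_def field_simps mult_le_0_iff)
  ultimately show ?thesis by (simp add: Lim_transform_eventually)
qed

lemma box_bump_tendsto: "(\<lambda>n. box_bump n a b x) \<longlonglongrightarrow> indicator (box a b) x"
proof (cases "x \<in> box a b")
  case True
  have "(\<lambda>n. \<Prod>i\<in>UNIV. flat 1 (real n * (x $ i - a $ i)) * flat 1 (real n * (b $ i - x $ i))) \<longlonglongrightarrow> (\<Prod>i\<in>(UNIV::3 set). 1 * 1)"
    using True by (intro tendsto_prod tendsto_mult flat_1_tendsto_1) (auto simp: mem_box_vec)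
  then show ?thesis using True by (simp add: box_bump_def algebra_simps)
qed (simp add: box_bump_outside)

section \<open>The fundamental lemma of the calculus of variations\<close>

lemma locally_integrable_measurable:
  assumes "locally_integrable g"
  shows "g \<in> borel_measurable borel"
proof (rule borel_measurable_LIMSEQ_real)
  show "(\<lambda>x. indicator (cball 0 (real n)) x *\<^sub>R g x) \<in> borel_measurable borel" for n
    using borel_measurable_integrable[OF assms[unfolded locally_integrable_def set_integrable_def, rule_format, of "real n"]]
    by simp
  show "(\<lambda>n. indicator (cball 0 (real n)) x *\<^sub>R g x) \<longlonglongrightarrow> g x" for x
  proof (rule tendsto_eventually)
    obtain m where "norm x \<le> real m" using real_arch_simple by blast
    then show "eventually (\<lambda>n. indicator (cball 0 (real n)) x *\<^sub>R g x = g x) sequentially"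
      by (intro eventually_sequentiallyI[of m]) auto
  qed
qed

lemma locally_integrable_mult:
  assumes "locally_integrable g" "\<psi> \<in> borel_measurable borel" "\<And>x. \<bar>\<psi> x\<bar> \<le> B"
    "\<And>x. x \<notin> cball 0 R \<Longrightarrow> \<psi> x = 0"
  shows "integrable lborel (\<lambda>x. g x * \<psi> x)"
proof (rule Bochner_Integration.integrable_bound)
  show "integrable lborel (\<lambda>x. B * (indicator (cball 0 R) x *\<^sub>R g x))"
    using assms(1) unfolding locally_integrable_def set_integrable_def by auto
  show "(\<lambda>x. g x * \<psi> x) \<in> borel_measurable lborel"
    using locally_integrable_measurable[OF assms(1)] assms(2) by measurable
  have "\<bar>g x * \<psi> x\<bar> \<le> \<bar>B * (indicator (cball 0 R) x * g x)\<bar>" for x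
  proof (cases "x \<in> cball 0 R")
    case True
    have "\<bar>\<psi> x\<bar> \<le> \<bar>B\<bar>" using assms(3)[of x] by linarith
    then have "\<bar>g x\<bar> * \<bar>\<psi> x\<bar> \<le> \<bar>g x\<bar> * \<bar>B\<bar>" by (intro mult_left_mono) auto
    then show ?thesis using True by (simp add: abs_mult mult.commute)
  qed (use assms(4) in auto)
  then show "AE x in lborel. norm (g x * \<psi> x) \<le> norm (B * (indicator (cball 0 R) x *\<^sub>R g x))"
    by simp
qed

text \<open>The bump functions are admissible tests and are dominated by the indicator to which they
  converge, so the vanishing of the integrals passes to boxes.\<close>

lemma integral_box_eq_0:
  assumes g: "locally_integrable g" and z: "\<And>\<psi>. test_function \<psi> \<Longrightarrow> (LINT x|lborel. g x * \<psi> x) = 0"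
  shows "integrable lborel (\<lambda>x. g x * indicator (box a b) x)"
    "(LINT x|lborel. g x * indicator (box a b) x) = 0"
proof -
  obtain R where R: "box a b \<subseteq> cball 0 R"
    using bounded_box[of a b] unfolding bounded_iff by (meson mem_cball_0 subsetI)
  have [measurable]: "g \<in> borel_measurable borel" by (rule locally_integrable_measurable[OF g])
  have bm [measurable]: "box_bump n a b \<in> borel_measurable borel" for n
    using test_function_box_bump[of n a b] smooth_on_continuous_on
    by (auto simp: test_function_def intro: borel_measurable_continuous_onI)
  show i: "integrable lborel (\<lambda>x. g x * indicator (box a b) x)"
    by (rule locally_integrable_mult[OF g, where B=1 and R=R]) (use R in \<open>auto simp: indicator_def\<close>)
  have "(\<lambda>n. LINT x|lborel. g x * box_bump n a b x) \<longlonglongrightarrow> (LINT x|lborel. g x * indicator (box a b) x)"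
  proof (rule integral_dominated_convergence[where w="\<lambda>x. \<bar>g x * indicator (box a b) x\<bar>"])
    show "AE x in lborel. (\<lambda>n. g x * box_bump n a b x) \<longlonglongrightarrow> g x * indicator (box a b) x"
      by (intro AE_I2 tendsto_mult tendsto_const box_bump_tendsto)
    show "AE x in lborel. norm (g x * box_bump n a b x) \<le> \<bar>g x * indicator (box a b) x\<bar>" for n
    proof (rule AE_I2)
      fix x
      have "\<bar>g x\<bar> * box_bump n a b x \<le> \<bar>g x\<bar> * indicator (box a b) x"
        using box_bump_bounds box_bump_outside by (intro mult_left_mono) (auto simp: indicator_def)
      then show "norm (g x * box_bump n a b x) \<le> \<bar>g x * indicator (box a b) x\<bar>"
        using box_bump_bounds(1)[of n a b x] by (simp add: abs_mult)
    qed
  qed (use i in auto)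
  then show "(LINT x|lborel. g x * indicator (box a b) x) = 0"
    using z[OF test_function_box_bump] by (simp add: LIMSEQ_const_iff)
qed

text \<open>The positive and the negative part of g, taken as densities, define measures that agree
  on the intersection-stable family of boxes and are finite on an exhausting sequence of cubes;
  hence they are equal. Evaluating them on {g > 0} and {g < 0} forces the integral of |g| to be
  zero.\<close>

lemma AE_eq_0_if_box_integrals_eq_0:
  fixes g :: "real^3 \<Rightarrow> real"
  assumes [measurable]: "g \<in> borel_measurable borel"
    and i: "\<And>a b. integrable lborel (\<lambda>x. g x * indicator (box a b) x)"
    and z: "\<And>a b. (LINT x|lborel. g x * indicator (box a b) x) = 0"
  shows "AE x in lborel. g x = 0"
proof -
  let ?P = "density lborel (\<lambda>x. ennreal (g x))" and ?N = "density lborel (\<lambda>x. ennreal (- g x))"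
  have fin: "(\<integral>\<^sup>+x. ennreal (g x) * indicator (box a b) x \<partial>lborel) = (\<integral>\<^sup>+x. ennreal (- g x) * indicator (box a b) x \<partial>lborel)
      \<and> (\<integral>\<^sup>+x. ennreal (g x) * indicator (box a b) x \<partial>lborel) < \<infinity>" for a b
  proof -
    let ?f = "\<lambda>x. g x * indicator (box a b) x"
    \<comment> \<open>The factor s, taken as 1 and as -1, treats both parts at once.\<close>
    have e: "(\<integral>\<^sup>+x. ennreal (s * g x) * indicator (box a b) x \<partial>lborel) = ennreal (LINT x|lborel. max 0 (s * ?f x))" for s :: real
    proof -
      have "(\<integral>\<^sup>+x. ennreal (s * g x) * indicator (box a b) x \<partial>lborel) = (\<integral>\<^sup>+x. ennreal (max 0 (s * ?f x)) \<partial>lborel)"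
        by (intro nn_integral_cong) (auto simp: indicator_def max_def ennreal_neg)
      also have "\<dots> = ennreal (LINT x|lborel. max 0 (s * ?f x))"
        by (intro nn_integral_eq_integral) (use i in auto)
      finally show ?thesis .
    qed
    have "(LINT x|lborel. max 0 (1 * ?f x)) - (LINT x|lborel. max 0 (-1 * ?f x)) = (LINT x|lborel. max 0 (1 * ?f x) - max 0 (-1 * ?f x))"
      by (subst Bochner_Integration.integral_diff) (use i in auto)
    also have "\<dots> = (LINT x|lborel. ?f x)"
      by (intro Bochner_Integration.integral_cong) (auto simp: max_def)
    also have "\<dots> = 0" by (rule z)
    finally show ?thesis using e[of 1] e[of "-1"] by simp
  qed
  have "?P = ?N"
  proof (rule measure_eqI_generator_eq[where E="range (\<lambda>(a, b). box a b)" and \<Omega>=UNIV and A="\<lambda>n. box (- (real n *\<^sub>R One)) (real n *\<^sub>R One)"])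
    show "Int_stable (range (\<lambda>(a, b). box a b :: (real^3) set))"
    proof (intro Int_stableI)
      fix X Y :: "(real^3) set"
      assume "X \<in> range (\<lambda>(a, b). box a b)" "Y \<in> range (\<lambda>(a, b). box a b)"
      then obtain a b a' b' where "X = box a b" "Y = box a' b'" by auto
      then have "X \<inter> Y = (\<lambda>(a, b). box a b) (\<Sum>i\<in>Basis. max (a \<bullet> i) (a' \<bullet> i) *\<^sub>R i, \<Sum>i\<in>Basis. min (b \<bullet> i) (b' \<bullet> i) *\<^sub>R i)"
        by (simp only: box_Int_box split_conv)
      then show "X \<inter> Y \<in> range (\<lambda>(a, b). box a b)" by (rule range_eqI)
    qed
    show "emeasure ?P X = emeasure ?N X" if "X \<in> range (\<lambda>(a, b). box a b)" for X
      using that fin by (auto simp: emeasure_density)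
    show "sets ?P = sigma_sets UNIV (range (\<lambda>(a, b). box a b))" "sets ?N = sigma_sets UNIV (range (\<lambda>(a, b). box a b))"
      by (simp_all add: borel_eq_box)
    show "emeasure ?P (box (- (real n *\<^sub>R One)) (real n *\<^sub>R One)) \<noteq> \<infinity>" for n
      using fin[of "- (real n *\<^sub>R One)" "real n *\<^sub>R One"] by (auto simp: emeasure_density)
    show "(\<Union>n. box (- (real n *\<^sub>R One)) (real n *\<^sub>R One)) = (UNIV :: (real^3) set)"
      using UN_box_eq_UNIV by auto
  qed auto
  note eq = this
  have "(\<integral>\<^sup>+x. ennreal \<bar>g x\<bar> \<partial>lborel) = emeasure ?P {x. g x > 0} + emeasure ?N {x. g x < 0}"
  proof -
    have "(\<integral>\<^sup>+x. ennreal \<bar>g x\<bar> \<partial>lborel) = (\<integral>\<^sup>+x. ennreal (g x) * indicator {x. g x > 0} x + ennreal (- g x) * indicator {x. g x < 0} x \<partial>lborel)"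
      by (intro nn_integral_cong) (auto simp: indicator_def)
    then show ?thesis by (simp add: emeasure_density nn_integral_add)
  qed
  \<comment> \<open>After the swap each density is zero on the set where it is evaluated, since
    \<open>ennreal\<close> sends negative numbers to 0.\<close>
  also have "\<dots> = emeasure ?N {x. g x > 0} + emeasure ?P {x. g x < 0}" by (simp add: eq)
  also have "emeasure ?N {x. g x > 0} = (\<integral>\<^sup>+x. ennreal (- g x) * indicator {x. g x > 0} x \<partial>lborel)"
    by (rule emeasure_density) auto
  also have "(\<lambda>x. ennreal (- g x) * indicator {x. g x > 0} x) = (\<lambda>x. 0)"
    by (rule ext) (auto split: split_indicator simp: ennreal_neg)
  also have "emeasure ?P {x. g x < 0} = (\<integral>\<^sup>+x. ennreal (g x) * indicator {x. g x < 0} x \<partial>lborel)"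
    by (rule emeasure_density) auto
  also have "(\<lambda>x. ennreal (g x) * indicator {x. g x < 0} x) = (\<lambda>x. 0)"
    by (rule ext) (auto split: split_indicator simp: ennreal_neg)
  finally have "AE x in lborel. ennreal \<bar>g x\<bar> = 0"
    by (subst nn_integral_0_iff_AE[symmetric]) auto
  then show ?thesis by (simp add: ennreal_eq_0_iff)
qed

section \<open>Weak and classical derivatives coincide\<close>

lemma test_function_facts:
  assumes "test_function \<psi>"
  obtains R B where "continuous_on UNIV \<psi>" "\<And>x. \<psi> differentiable at x" "continuous_on UNIV (partial j \<psi>)"
    "\<And>x. x \<notin> cball 0 R \<Longrightarrow> \<psi> x = 0" "\<And>x. \<bar>\<psi> x\<bar> \<le> B"
proof -
  have s: "smooth_on UNIV \<psi>" using assms by (simp add: test_function_def)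
  have c: "continuous_on UNIV \<psi>" by (rule smooth_on_continuous_on[OF s])
  have "axis j 1 \<in> (Basis :: (real^3) set)" by simp
  then have c': "continuous_on UNIV (partial j \<psi>)"
    unfolding partial_def[abs_def] by (intro smooth_on_continuous_on smooth_on_frechet_derivative s)
  obtain R where "{x. \<psi> x \<noteq> 0} \<subseteq> cball 0 R"
    using assms unfolding test_function_def bounded_iff by (meson mem_cball_0 subsetI)
  then have R: "\<psi> x = 0" if "x \<notin> cball 0 R" for x using that by blast
  have "compact (\<psi> ` cball 0 R)"
    by (intro compact_continuous_image continuous_on_subset[OF c]) auto
  then obtain B where B: "\<And>y. y \<in> \<psi> ` cball 0 R \<Longrightarrow> norm y \<le> B"
    using compact_imp_bounded bounded_iff by metis
  have "\<bar>\<psi> x\<bar> \<le> max B 0" for x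
    using B[of "\<psi> x"] R[of x] by (cases "x \<in> cball 0 R") auto
  then show thesis using that c c' R smooth_on_differentiable[OF s] by blast
qed

lemma continuous_locally_integrable:
  assumes "continuous_on UNIV f"
  shows "locally_integrable f"
  unfolding locally_integrable_def set_integrable_def
  by (intro allI borel_integrable_compact compact_cball continuous_on_subset[OF assms] subset_UNIV)

lemma has_weak_partial_classical:
  assumes f: "has_partial j f f'" and c: "continuous_on UNIV f" "continuous_on UNIV f'"
  shows "has_weak_partial j f f'"
  unfolding has_weak_partial_def
proof (intro conjI allI impI continuous_locally_integrable c)
  fix \<psi> assume t: "test_function \<psi>"
  obtain R B where \<psi>: "continuous_on UNIV \<psi>" "\<And>x. \<psi> differentiable at x" "continuous_on UNIV (partial j \<psi>)"
    "\<And>x. x \<notin> cball 0 R \<Longrightarrow> \<psi> x = 0" "\<And>x. \<bar>\<psi> x\<bar> \<le> B"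
    using test_function_facts[OF t, where j=j] by metis
  have p0: "partial j \<psi> x = 0" if "x \<notin> cball 0 R" for x
  proof -
    have "frechet_derivative (\<lambda>x. 0) (at x) = frechet_derivative \<psi> (at x)"
      by (rule frechet_derivative_cong_open(2)[of "- cball 0 R"]) (use that \<psi> in auto)
    then show ?thesis by (simp add: partial_def flip: \<open>frechet_derivative (\<lambda>x. 0) (at x) = _\<close>)
  qed
  have i: "integrable lborel (\<lambda>x. f x * partial j \<psi> x)" "integrable lborel (\<lambda>x. f' x * \<psi> x)"
    using p0 \<psi> c by (intro integrable_continuous_compact_support[of _ "cball 0 R"] continuous_intros; auto)+
  have "(LINT x|lborel. f' x * \<psi> x + f x * partial j \<psi> x) = 0"
    by (rule integral_partial_eq_0[OF has_partial_mult[OF f has_partial_partial[OF \<psi>(2)]], where a=0 and R=R])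
      (use \<psi> c in \<open>auto intro!: continuous_intros\<close>)
  then show "(LINT x|lborel. f x * partial j \<psi> x) = - (LINT x|lborel. f' x * \<psi> x)"
    using i by simp
qed

text \<open>The difference of two weak derivatives integrates to zero against every test function,
  and the fundamental lemma applies.\<close>

lemma weak_partial_unique:
  assumes "has_weak_partial j f g" "has_weak_partial j f h"
  shows "AE x in lborel. g x = h x"
proof -
  have l: "locally_integrable g" "locally_integrable h" using assms by (auto simp: has_weak_partial_def)
  have ld: "locally_integrable (\<lambda>x. g x - h x)"
    using l unfolding locally_integrable_def set_integrable_def
    by (simp only: scaleR_diff_right) (intro allI Bochner_Integration.integrable_diff; blast)
  have z: "(LINT x|lborel. (g x - h x) * \<psi> x) = 0" if t: "test_function \<psi>" for \<psi>
  proof -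
    obtain R B where \<psi>: "continuous_on UNIV \<psi>" "\<And>x. \<psi> differentiable at x" "continuous_on UNIV (partial j \<psi>)"
      "\<And>x. x \<notin> cball 0 R \<Longrightarrow> \<psi> x = 0" "\<And>x. \<bar>\<psi> x\<bar> \<le> B"
      using test_function_facts[OF t, where j=j] by metis
    have "integrable lborel (\<lambda>x. k x * \<psi> x)" if "locally_integrable k" for k
    proof (rule locally_integrable_mult[OF that])
      show "\<psi> \<in> borel_measurable borel" by (rule borel_measurable_continuous_onI[OF \<psi>(1)])
    qed (use \<psi> in auto)
    from this[OF l(1)] this[OF l(2)]
    have "integrable lborel (\<lambda>x. g x * \<psi> x)" "integrable lborel (\<lambda>x. h x * \<psi> x)" .
    moreover have "(LINT x|lborel. g x * \<psi> x) = (LINT x|lborel. h x * \<psi> x)"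
    proof -
      have "(LINT x|lborel. f x * partial j \<psi> x) = - (LINT x|lborel. g x * \<psi> x)"
        "(LINT x|lborel. f x * partial j \<psi> x) = - (LINT x|lborel. h x * \<psi> x)"
        using assms t unfolding has_weak_partial_def by auto
      then show ?thesis by simp
    qed
    ultimately show ?thesis by (simp add: left_diff_distrib)
  qed
  have "AE x in lborel. g x - h x = 0"
    by (rule AE_eq_0_if_box_integrals_eq_0[OF locally_integrable_measurable[OF ld] integral_box_eq_0[OF ld z]])
  then show ?thesis by simp
qed

lemma in_L2_cong_AE:
  fixes f g :: "real^3 \<Rightarrow> real"
  assumes "in_L2 f" "AE x in lborel. f x = g x" "g \<in> borel_measurable borel"
  shows "in_L2 g"
proof -
  have [measurable]: "f \<in> borel_measurable borel" using assms(1) by (simp add: in_L2_def)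
  have "integrable lborel (\<lambda>x. (norm (g x))\<^sup>2) \<longleftrightarrow> integrable lborel (\<lambda>x. (norm (f x))\<^sup>2)"
    using assms(2,3) by (intro integrable_cong_AE) auto
  then show ?thesis using assms by (simp add: in_L2_def)
qed

text \<open>\<open>weak_partial\<close> is a choice among representatives; whichever one is chosen,
  uniqueness ties it to the continuous classical derivative.\<close>

lemma weak_partial_classical:
  assumes "has_partial j f f'" "continuous_on UNIV f" "continuous_on UNIV f'"
  shows "AE x in lborel. weak_partial j f x = f' x"
proof -
  note w = has_weak_partial_classical[OF assms]
  have "has_weak_partial j f (weak_partial j f)"
    unfolding weak_partial_def by (rule someI[of "has_weak_partial j f", OF w])
  then show ?thesis by (rule weak_partial_unique[OF _ w])
qed

lemma sobolev_classical:
  assumes "sobolev 1 f" "has_partial j f f'" "continuous_on UNIV f" "continuous_on UNIV f'"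
  shows "in_L2 f'"
proof -
  note w = has_weak_partial_classical[OF assms(2-4)]
  obtain g where g: "has_weak_partial j f g" "in_L2 g"
    using assms(1) unfolding One_nat_def by auto
  show ?thesis
    by (rule in_L2_cong_AE[OF g(2) weak_partial_unique[OF g(1) w] borel_measurable_continuous_onI[OF assms(4)]])
qed

section \<open>Hardy's inequality and the gradient of the Newtonian potential\<close>

text \<open>Fatou's lemma, packaged so that integrability of the limit comes together with the
  bound. It removes cutoffs and regularisations where no dominating function is at hand.\<close>

lemma integral_le_of_tendsto:
  fixes f :: "nat \<Rightarrow> 'a \<Rightarrow> real"
  assumes i: "\<And>n. integrable M (f n)" and nn: "\<And>n x. 0 \<le> f n x"
    and B: "\<And>n. integral\<^sup>L M (f n) \<le> B n" and BB: "B \<longlonglongrightarrow> b"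
    and g: "g \<in> borel_measurable M" and l: "AE x in M. (\<lambda>n. f n x) \<longlonglongrightarrow> g x"
  shows "integrable M g" "integral\<^sup>L M g \<le> b"
proof -
  have gnn: "AE x in M. 0 \<le> g x"
    using l by eventually_elim (rule LIMSEQ_le_const, use nn in auto)
  have Bnn: "0 \<le> B n" for n
    using B[of n] integral_nonneg_AE[of "f n" M] nn order_trans by blast
  have bnn: "0 \<le> b" by (rule LIMSEQ_le_const[OF BB]) (use Bnn in auto)
  have "(\<integral>\<^sup>+x. ennreal (g x) \<partial>M) = (\<integral>\<^sup>+x. liminf (\<lambda>n. ennreal (f n x)) \<partial>M)"
  proof (rule nn_integral_cong_AE)
    show "AE x in M. ennreal (g x) = liminf (\<lambda>n. ennreal (f n x))"
      using l by eventually_elim (intro lim_imp_Liminf[symmetric] tendsto_ennrealI; simp)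
  qed
  also have "\<dots> \<le> liminf (\<lambda>n. \<integral>\<^sup>+x. ennreal (f n x) \<partial>M)"
    by (rule nn_integral_liminf) (use i in auto)
  also have "\<dots> = liminf (\<lambda>n. ennreal (integral\<^sup>L M (f n)))"
    using nn_integral_eq_integral[OF i] nn by simp
  also have "\<dots> \<le> liminf (\<lambda>n. ennreal (B n))"
    by (intro Liminf_mono always_eventually allI ennreal_leI B)
  also have "\<dots> = ennreal b"
    by (intro lim_imp_Liminf tendsto_ennrealI BB) simp
  finally have le: "(\<integral>\<^sup>+x. ennreal (g x) \<partial>M) \<le> ennreal b" .
  show ig: "integrable M g"
  proof (rule integrableI_nonneg[OF g gnn])
    show "(\<integral>\<^sup>+x. ennreal (g x) \<partial>M) < \<infinity>" using le ennreal_less_top[of b] by (simp add: le_less_trans)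
  qed
  have "ennreal (integral\<^sup>L M g) \<le> ennreal b"
    using le nn_integral_eq_integral[OF ig gnn] by simp
  then show "integral\<^sup>L M g \<le> b" using bnn by (simp add: ennreal_le_iff)
qed

lemma norm_sq_eq_sum: "(norm (v :: real^3))\<^sup>2 = (\<Sum>j\<in>UNIV. (v $ j)\<^sup>2)"
  unfolding power2_norm_eq_inner inner_vec_def by (simp add: power2_eq_square)

text \<open>Test the gradient with the field \<open>(y - x) / (|y - x|\<^sup>2 + e)\<close>, whose divergence dominates
  \<open>1 / (|y - x|\<^sup>2 + e)\<close>.\<close>

lemma hardy_local:
  fixes f :: "real^3 \<Rightarrow> real"
  assumes f: "\<And>j. has_partial j f (f' j)" and cf: "continuous_on UNIV f" "\<And>j. continuous_on UNIV (f' j)"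
    and i: "integrable lborel (\<lambda>y. (f y)\<^sup>2)" "\<And>j. integrable lborel (\<lambda>y. (f' j y)\<^sup>2)"
    and e: "e > 0" and R: "R > 0"
  shows "(LINT y|lborel. cutoff x R y * ((f y)\<^sup>2 / ((norm (y - x))\<^sup>2 + e)))
    \<le> 4 * (LINT y|lborel. (\<Sum>j\<in>UNIV. (f' j y)\<^sup>2)) + 36 / R * (1 + 1 / e) * (LINT y|lborel. (f y)\<^sup>2)"
proof -
  \<comment> \<open>The shift by e > 0 removes the singularity at y = x and makes the field
    \<open>V\<close> continuously differentiable on the whole space.\<close>
  define s where "s y = (norm (y - x))\<^sup>2 + e" for y
  define v where "v j y = y $ j - x $ j" for j and y :: "real^3"
  let ?\<theta> = "cutoff x R" and ?\<theta>' = "cutoff_d x R"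
  have s: "s y > 0" "e \<le> s y" for y using e by (auto simp: s_def add_nonneg_pos)
  have sv: "(\<Sum>j\<in>UNIV. (v j y)\<^sup>2) = s y - e" for y
    unfolding s_def v_def norm_sq_eq_sum by simp
  have cs: "continuous_on UNIV s" "\<And>j. continuous_on UNIV (v j)"
    unfolding s_def v_def by (intro continuous_intros)+
  define V where "V j y = v j y / s y" for j y
  define V' where "V' j y = 1 / s y - 2 * (v j y)\<^sup>2 / (s y)\<^sup>2" for j y
  have V: "has_partial j (V j) (V' j)" for j
  proof (rule has_partialI)
    fix y
    have 1: "((\<lambda>h. v j (y + h *\<^sub>R axis j 1)) has_real_derivative 1) (at 0)"
      unfolding v_def by (rule DERIV_cong[OF DERIV_diff[OF has_partialD[OF has_partial_nth] DERIV_const]]) simp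
    have 2: "((\<lambda>h. s (y + h *\<^sub>R axis j 1)) has_real_derivative 2 * v j y) (at 0)"
      unfolding s_def v_def by (rule DERIV_cong[OF DERIV_add[OF has_partialD[OF has_partial_norm_sq] DERIV_const]]) simp
    have "s (y + 0 *\<^sub>R axis j 1) \<noteq> 0" using s[of y] by simp
    from DERIV_divide[OF 1 2 this] show "((\<lambda>h. V j (y + h *\<^sub>R axis j 1)) has_real_derivative V' j y) (at 0)"
      unfolding V_def V'_def using s(1)[of y]
      by (rule_tac DERIV_cong) (auto simp: field_simps power2_eq_square)
  qed
  have cV: "continuous_on UNIV (V j)" "continuous_on UNIV (V' j)" for j
    unfolding V_def V'_def using cs s(1) by (auto intro!: continuous_intros simp: less_imp_neq[THEN not_sym])
  define F where "F j y = ?\<theta> y * ((f y * f y) * V j y)" for j y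
  define F' where "F' j y = ?\<theta>' j y * ((f y * f y) * V j y) + ?\<theta> y * ((f' j y * f y + f y * f' j y) * V j y + (f y * f y) * V' j y)" for j y
  have F: "has_partial j (F j) (F' j)" for j
    unfolding F_def F'_def by (intro has_partial_mult has_partial_cutoff f V)
  have cF: "continuous_on UNIV (F j)" "continuous_on UNIV (F' j)" for j
    unfolding F_def F'_def by (intro continuous_intros continuous_cutoff cf cV)+
  have z: "F j y = 0" "F' j y = 0" if "y \<notin> cball x R" for j y
    using cutoff_outside[OF that R] by (simp_all add: F_def F'_def)
  have iF: "integrable lborel (F' j)" "(LINT y|lborel. F' j y) = 0" for j
    using integral_partial_eq_0[OF F cF z(1)] integrable_continuous_compact_support[OF cF(2) compact_cball z(2)] by auto
  \<comment> \<open>The divergence of \<theta> f^2 V is expanded. Young's inequality is weighted so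
    that the cross term costs half of \<theta> f^2 / s, which is absorbed on the left, plus twice
    the squared gradient.\<close>
  have pw: "1/2 * (?\<theta> y * ((f y)\<^sup>2 / s y)) \<le> (\<Sum>j\<in>UNIV. F' j y) + 2 * (\<Sum>j\<in>UNIV. (f' j y)\<^sup>2) + 18 / R * (1 + 1 / e) * (f y)\<^sup>2" for y
  proof -
    \<comment> \<open>This crude bound enters only next to derivatives of the cutoff, whose
      contribution disappears as R grows with e fixed.\<close>
    have V1: "\<bar>V j y\<bar> \<le> 1 + 1 / e" for j
    proof -
      have "(v j y)\<^sup>2 \<le> s y"
        using member_le_sum[of j UNIV "\<lambda>j. (v j y)\<^sup>2"] sv[of y] e by simp
      moreover have "2 * \<bar>v j y\<bar> \<le> (v j y)\<^sup>2 + 1"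
        using zero_le_power2[of "\<bar>v j y\<bar> - 1"] by (simp add: power2_eq_square algebra_simps)
      ultimately have "\<bar>v j y\<bar> \<le> s y + 1" using s(1)[of y] by linarith
      then have "\<bar>v j y\<bar> / s y \<le> (s y + 1) / s y" using s(1)[of y] by (intro divide_right_mono) auto
      also have "\<dots> = 1 + 1 / s y" using s(1)[of y] by (simp add: add_divide_distrib)
      also have "\<dots> \<le> 1 + 1 / e" using s[of y] e by (simp add: frac_le)
      finally show ?thesis using s(1)[of y] by (simp add: V_def)
    qed
    have a: "- (?\<theta>' j y * ((f y * f y) * V j y)) \<le> 6 / R * ((1 + 1 / e) * (f y)\<^sup>2)" for j
    proof -
      have "\<bar>?\<theta>' j y\<bar> * ((f y)\<^sup>2 * \<bar>V j y\<bar>) \<le> 6 / R * ((f y)\<^sup>2 * (1 + 1 / e))"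
        by (intro mult_mono mult_left_mono cutoff_d_le V1 R) (use R in auto)
      moreover have "- (?\<theta>' j y * ((f y * f y) * V j y)) \<le> \<bar>?\<theta>' j y\<bar> * ((f y)\<^sup>2 * \<bar>V j y\<bar>)"
        by (rule order_trans[OF abs_ge_minus_self]) (simp add: abs_mult power2_eq_square)
      ultimately show ?thesis by (simp add: mult.commute)
    qed
    have b: "- ((f' j y * f y + f y * f' j y) * V j y) \<le> 1/2 * ((f y)\<^sup>2 * (V j y)\<^sup>2) + 2 * (f' j y)\<^sup>2" for j
      using zero_le_power2[of "f y * V j y + 2 * f' j y"] by (simp add: power2_eq_square algebra_simps)
    have V2: "(\<Sum>j\<in>UNIV. (V j y)\<^sup>2) \<le> 1 / s y"
    proof -
      have "(\<Sum>j\<in>UNIV. (V j y)\<^sup>2) = (s y - e) / (s y)\<^sup>2"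
        unfolding V_def power_divide sum_divide_distrib[symmetric] sv ..
      also have "\<dots> \<le> s y / (s y)\<^sup>2" using e by (intro divide_right_mono) auto
      also have "\<dots> = 1 / s y" using s(1)[of y] by (simp add: power2_eq_square)
      finally show ?thesis .
    qed
    \<comment> \<open>The divergence is 3/s - 2 |v|^2 / s^2, and |v|^2 = s - e leaves at least
      1/s.\<close>
    have V3: "(\<Sum>j\<in>UNIV. V' j y) \<ge> 1 / s y"
    proof -
      have "(\<Sum>j\<in>UNIV. V' j y) = 3 / s y - 2 * (s y - e) / (s y)\<^sup>2"
        unfolding V'_def sum_subtractf sum_divide_distrib[symmetric] sum_distrib_left[symmetric] sv
        by simp
      moreover have "2 * (s y - e) / (s y)\<^sup>2 \<le> 2 * s y / (s y)\<^sup>2" using e by (intro divide_right_mono) auto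
      moreover have "2 * s y / (s y)\<^sup>2 = 2 / s y" using s(1)[of y] by (simp add: power2_eq_square)
      ultimately show ?thesis by (simp add: diff_divide_distrib[symmetric] le_diff_eq add_divide_distrib[symmetric])
    qed
    have c: "?\<theta> y * (- (\<Sum>j\<in>UNIV. (f' j y * f y + f y * f' j y) * V j y)) \<le> ?\<theta> y * (1/2 * ((f y)\<^sup>2 / s y)) + 2 * (\<Sum>j\<in>UNIV. (f' j y)\<^sup>2)"
    proof -
      have "- (\<Sum>j\<in>UNIV. (f' j y * f y + f y * f' j y) * V j y) \<le> (\<Sum>j\<in>UNIV. 1/2 * ((f y)\<^sup>2 * (V j y)\<^sup>2) + 2 * (f' j y)\<^sup>2)"
        unfolding sum_negf[symmetric] by (intro sum_mono b)
      also have "\<dots> = 1/2 * ((f y)\<^sup>2 * (\<Sum>j\<in>UNIV. (V j y)\<^sup>2)) + 2 * (\<Sum>j\<in>UNIV. (f' j y)\<^sup>2)"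
        by (simp add: sum.distrib sum_distrib_left)
      also have "\<dots> \<le> 1/2 * ((f y)\<^sup>2 * (1 / s y)) + 2 * (\<Sum>j\<in>UNIV. (f' j y)\<^sup>2)"
        using mult_left_mono[OF V2, of "(f y)\<^sup>2"] by simp
      finally have "?\<theta> y * (- (\<Sum>j\<in>UNIV. (f' j y * f y + f y * f' j y) * V j y)) \<le> ?\<theta> y * (1/2 * ((f y)\<^sup>2 * (1 / s y)) + 2 * (\<Sum>j\<in>UNIV. (f' j y)\<^sup>2))"
        by (intro mult_left_mono cutoff_nonneg)
      also have "\<dots> = ?\<theta> y * (1/2 * ((f y)\<^sup>2 * (1 / s y))) + ?\<theta> y * (2 * (\<Sum>j\<in>UNIV. (f' j y)\<^sup>2))"
        by (rule distrib_left)
      also have "\<dots> \<le> ?\<theta> y * (1/2 * ((f y)\<^sup>2 * (1 / s y))) + 1 * (2 * (\<Sum>j\<in>UNIV. (f' j y)\<^sup>2))"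
        by (intro add_left_mono mult_right_mono cutoff_le_1 mult_nonneg_nonneg sum_nonneg) auto
      finally show ?thesis by simp
    qed
    have d: "?\<theta> y * ((f y)\<^sup>2 / s y) \<le> ?\<theta> y * ((f y)\<^sup>2 * (\<Sum>j\<in>UNIV. V' j y))"
      using mult_left_mono[OF V3, of "(f y)\<^sup>2"] by (intro mult_left_mono cutoff_nonneg) simp
    have A: "(\<Sum>j\<in>UNIV. F' j y) = (\<Sum>j\<in>UNIV. ?\<theta>' j y * ((f y * f y) * V j y)) + ?\<theta> y * (\<Sum>j\<in>UNIV. (f' j y * f y + f y * f' j y) * V j y) + ?\<theta> y * ((f y)\<^sup>2 * (\<Sum>j\<in>UNIV. V' j y))"
      unfolding F'_def by (simp add: sum.distrib sum_distrib_left distrib_left power2_eq_square)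
    have B: "- (\<Sum>j\<in>UNIV. ?\<theta>' j y * ((f y * f y) * V j y)) \<le> (\<Sum>j\<in>(UNIV::3 set). 6 / R * ((1 + 1 / e) * (f y)\<^sup>2))"
      unfolding sum_negf[symmetric] by (intro sum_mono a)
    have C: "(\<Sum>j\<in>(UNIV::3 set). 6 / R * ((1 + 1 / e) * (f y)\<^sup>2)) = 18 / R * (1 + 1 / e) * (f y)\<^sup>2"
      by simp
    have gen: "1/2 * (t * q) \<le> S + G + C'"
      if "S = A + t * P + Q" "- A \<le> C" "C = C'" "t * (- P) \<le> t * (1/2 * q) + G" "t * q \<le> Q"
      for S A t P Q C C' q G :: real
      using that by (simp add: algebra_simps)
    show ?thesis by (rule gen[OF A B C c d])
  qed
  have il: "integrable lborel (\<lambda>y. ?\<theta> y * ((f y)\<^sup>2 / s y))"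
  proof (rule integrable_continuous_compact_support[of _ "cball x R"])
    show "continuous_on UNIV (\<lambda>y. ?\<theta> y * ((f y)\<^sup>2 / s y))"
      using cs s(1) cf by (auto intro!: continuous_intros continuous_cutoff simp: less_imp_neq[THEN not_sym])
  qed (use cutoff_outside R in auto)
  have "(LINT y|lborel. 1/2 * (?\<theta> y * ((f y)\<^sup>2 / s y))) \<le> (LINT y|lborel. (\<Sum>j\<in>UNIV. F' j y) + 2 * (\<Sum>j\<in>UNIV. (f' j y)\<^sup>2) + 18 / R * (1 + 1 / e) * (f y)\<^sup>2)"
    by (intro integral_mono pw Bochner_Integration.integrable_add Bochner_Integration.integrable_sum iF integrable_mult_right i il)
  also have "\<dots> = 2 * (LINT y|lborel. (\<Sum>j\<in>UNIV. (f' j y)\<^sup>2)) + 18 / R * (1 + 1 / e) * (LINT y|lborel. (f y)\<^sup>2)"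
    using iF i by (simp add: Bochner_Integration.integral_add Bochner_Integration.integral_sum Bochner_Integration.integrable_sum)
  finally have "1/2 * (LINT y|lborel. ?\<theta> y * ((f y)\<^sup>2 / s y))
      \<le> 2 * (LINT y|lborel. (\<Sum>j\<in>UNIV. (f' j y)\<^sup>2)) + 18 / R * (1 + 1 / e) * (LINT y|lborel. (f y)\<^sup>2)"
    by (simp only: integral_mult_right_zero)
  moreover have "1/2 * a \<le> 2 * b + 18 / R * c * d \<Longrightarrow> a \<le> 4 * b + 36 / R * c * d" for a b c d :: real
    by simp
  ultimately show ?thesis unfolding s_def by blast
qed

text \<open>R tends to infinity with e fixed, so the factor 1 + 1/e in the cutoff error does no
  harm. The limit of vanishing e is postponed to \<open>riesz_bound\<close>.\<close>

lemma hardy: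
  fixes f :: "real^3 \<Rightarrow> real"
  assumes f: "\<And>j. has_partial j f (f' j)" and cf: "continuous_on UNIV f" "\<And>j. continuous_on UNIV (f' j)"
    and i: "integrable lborel (\<lambda>y. (f y)\<^sup>2)" "\<And>j. integrable lborel (\<lambda>y. (f' j y)\<^sup>2)"
    and e: "e > 0"
  shows "integrable lborel (\<lambda>y. (f y)\<^sup>2 / ((norm (y - x))\<^sup>2 + e))"
    "(LINT y|lborel. (f y)\<^sup>2 / ((norm (y - x))\<^sup>2 + e)) \<le> 4 * (LINT y|lborel. (\<Sum>j\<in>UNIV. (f' j y)\<^sup>2))"
proof -
  let ?g = "\<lambda>y. (f y)\<^sup>2 / ((norm (y - x))\<^sup>2 + e)"
  have pos: "(norm (y - x))\<^sup>2 + e > 0" for y using e by (simp add: add_nonneg_pos)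
  have cg: "continuous_on UNIV ?g"
    using pos by (intro continuous_intros cf ballI less_imp_neq[THEN not_sym]) auto
  define n' where "n' n = real n + 1" for n
  have n': "n' n > 0" for n by (simp add: n'_def)
  have lim: "filterlim n' at_top sequentially"
    unfolding n'_def by (rule filterlim_at_top_mono[OF filterlim_real_sequentially]) auto
  let ?B = "\<lambda>n. 4 * (LINT y|lborel. (\<Sum>j\<in>UNIV. (f' j y)\<^sup>2)) + 36 / n' n * (1 + 1 / e) * (LINT y|lborel. (f y)\<^sup>2)"
  have "(\<lambda>n. 36 / n' n) \<longlonglongrightarrow> 0"
    by (intro tendsto_divide_0[OF tendsto_const] filterlim_at_top_imp_at_infinity lim)
  then have B: "?B \<longlonglongrightarrow> 4 * (LINT y|lborel. (\<Sum>j\<in>UNIV. (f' j y)\<^sup>2)) + 0 * (1 + 1 / e) * (LINT y|lborel. (f y)\<^sup>2)"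
    by (intro tendsto_intros)
  have nn: "0 \<le> cutoff x (n' n) y * ?g y" for n y
    using pos[of y] by (intro mult_nonneg_nonneg cutoff_nonneg divide_nonneg_pos) auto
  have ig: "integrable lborel (\<lambda>y. cutoff x (n' n) y * ?g y)" for n
  proof (rule integrable_continuous_compact_support[of _ "cball x (n' n)"])
    show "continuous_on UNIV (\<lambda>y. cutoff x (n' n) y * ?g y)"
      by (intro continuous_on_mult continuous_cutoff cg)
  qed (use cutoff_outside(1)[OF _ n'] in auto)
  have l: "AE y in lborel. (\<lambda>n. cutoff x (n' n) y * ?g y) \<longlonglongrightarrow> ?g y"
  proof (rule AE_I2)
    fix y
    have "(\<lambda>n. cutoff x (n' n) y * ?g y) \<longlonglongrightarrow> 1 * ?g y"
      by (intro tendsto_mult cutoff_tendsto_1 lim tendsto_const)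
    then show "(\<lambda>n. cutoff x (n' n) y * ?g y) \<longlonglongrightarrow> ?g y" by (simp only: mult_1_left)
  qed
  have m: "?g \<in> borel_measurable lborel" using borel_measurable_continuous_onI[OF cg] by simp
  note F = integral_le_of_tendsto[OF ig nn hardy_local[OF f cf i e n'] B m l]
  show "integrable lborel ?g" by (rule F(1))
  show "(LINT y|lborel. ?g y) \<le> 4 * (LINT y|lborel. (\<Sum>j\<in>UNIV. (f' j y)\<^sup>2))"
    using F(2) by simp
qed

section \<open>The Riesz potential and the Newtonian potential\<close>

definition riesz_const :: real where
  "riesz_const = 216 * measure lborel (cball (0 :: real^3) 2)"

text \<open>The singular kernel is handled by Hardy's inequality alone. Near x one has |f| <= f^2 +
  1/4, and 1/4 is at most 2 \<theta>^2 for the cutoff of radius 2 around x, so both terms are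
  squares to which \<open>hardy\<close> applies. Away from x the kernel is at most 1 and the L^1
  norm suffices.\<close>

lemma riesz_bound:
  fixes f :: "real^3 \<Rightarrow> real"
  assumes f: "\<And>j. has_partial j f (f' j)" and cf: "continuous_on UNIV f" "\<And>j. continuous_on UNIV (f' j)"
    and i: "integrable lborel (\<lambda>y. (f y)\<^sup>2)" "\<And>j. integrable lborel (\<lambda>y. (f' j y)\<^sup>2)"
    and i1: "integrable lborel (\<lambda>y. \<bar>f y\<bar>)"
  shows "integrable lborel (\<lambda>y. \<bar>f y\<bar> / (dist x y)\<^sup>2)"
    "(LINT y|lborel. \<bar>f y\<bar> / (dist x y)\<^sup>2)
      \<le> 4 * (LINT y|lborel. (\<Sum>j\<in>UNIV. (f' j y)\<^sup>2)) + riesz_const + (LINT y|lborel. \<bar>f y\<bar>)"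
proof -
  let ?\<theta> = "cutoff x 2"
  let ?B = "4 * (LINT y|lborel. (\<Sum>j\<in>UNIV. (f' j y)\<^sup>2)) + riesz_const + (LINT y|lborel. \<bar>f y\<bar>)"
  have sq: "cutoff_d x 2 j y ^ 2 \<le> 9 * indicator (cball x 2) y" for j y
  proof (cases "y \<in> cball x 2")
    case True
    have "(cutoff_d x 2 j y)\<^sup>2 \<le> 3\<^sup>2"
      using cutoff_d_le[of 2 x j y] by (subst abs_le_square_iff[symmetric]) simp
    then show ?thesis using True by simp
  qed (use cutoff_outside[of y x 2] in auto)
  have mb: "measure lborel (cball x 2) = measure lborel (cball (0::real^3) 2)"
    by (simp add: content_cball)
  have ib: "integrable lborel (\<lambda>y. \<Sum>j\<in>(UNIV::3 set). 9 * indicator (cball x 2) y :: real)"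
    by (intro Bochner_Integration.integrable_sum integrable_mult_right integrable_real_indicator)
      (auto simp flip: infinity_ennreal_def intro!: emeasure_bounded_finite)
  have i\<theta>: "integrable lborel (\<lambda>y. (?\<theta> y)\<^sup>2)" "integrable lborel (\<lambda>y. (cutoff_d x 2 j y)\<^sup>2)" for j
    using cutoff_outside[of _ x 2]
    by (intro integrable_continuous_compact_support[of _ "cball x 2"] continuous_intros continuous_cutoff; auto)+
  have "(LINT y|lborel. (\<Sum>j\<in>UNIV. (cutoff_d x 2 j y)\<^sup>2)) \<le> (LINT y|lborel. (\<Sum>j\<in>(UNIV::3 set). 9 * indicator (cball x 2) y))"
    by (intro integral_mono ib Bochner_Integration.integrable_sum i\<theta> sum_mono sq)
  also have "\<dots> = 27 * measure lborel (cball (0::real^3) 2)"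
    using mb by simp
  \<comment> \<open>This explains 216 = 8 * 27: the 8 is Hardy's constant 4 times the factor 2 in
    front of \<theta>^2, and 27 counts three components of size (6/2)^2 = 9.\<close>
  finally have \<theta>: "8 * (LINT y|lborel. (\<Sum>j\<in>UNIV. (cutoff_d x 2 j y)\<^sup>2)) \<le> riesz_const"
    by (simp add: riesz_const_def)
  define \<epsilon> where "\<epsilon> n = inverse (real n + 1)" for n
  have \<epsilon>: "\<epsilon> n > 0" for n by (simp add: \<epsilon>_def)
  have \<epsilon>0: "\<epsilon> \<longlonglongrightarrow> 0"
    using LIMSEQ_inverse_real_of_nat by (simp add: \<epsilon>_def[abs_def] add.commute)
  let ?s = "\<lambda>n y. (norm (y - x))\<^sup>2 + \<epsilon> n"
  have s: "?s n y > 0" for n y using \<epsilon>[of n] by (simp add: add_nonneg_pos)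
  have pw: "\<bar>f y\<bar> / ?s n y \<le> (f y)\<^sup>2 / ?s n y + 2 * ((?\<theta> y)\<^sup>2 / ?s n y) + \<bar>f y\<bar>" for n y
  proof (cases "norm (y - x) < 1")
    case True
    have "(norm (y - x))\<^sup>2 \<le> 1" using True by (simp add: power_le_one)
    then have "3 / 4 \<le> max 0 (1 - (norm (y - x))\<^sup>2 / 2\<^sup>2)" by (auto simp: max_def)
    then have "(3 / 4) ^ 6 \<le> (max 0 (1 - (norm (y - x))\<^sup>2 / 2\<^sup>2)) ^ 6" by (rule power_mono) simp
    moreover have "(?\<theta> y)\<^sup>2 = (max 0 (1 - (norm (y - x))\<^sup>2 / 2\<^sup>2)) ^ 6"
      unfolding cutoff_def power_mult[symmetric] by simp
    \<comment> \<open>Here 2 (3/4)^6 is about 0.36.\<close>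
    ultimately have "1 / 4 \<le> 2 * (?\<theta> y)\<^sup>2" by (simp add: power_divide)
    moreover have "\<bar>f y\<bar> \<le> (f y)\<^sup>2 + 1 / 4"
      using zero_le_power2[of "\<bar>f y\<bar> - 1 / 2"] by (simp add: power2_eq_square algebra_simps)
    ultimately have "\<bar>f y\<bar> \<le> (f y)\<^sup>2 + 2 * (?\<theta> y)\<^sup>2" by linarith
    then have "\<bar>f y\<bar> / ?s n y \<le> ((f y)\<^sup>2 + 2 * (?\<theta> y)\<^sup>2) / ?s n y"
      using s[where n=n and y=y] by (intro divide_right_mono) auto
    then show ?thesis by (simp add: add_divide_distrib)
  next
    case False
    then have "1 \<le> (norm (y - x))\<^sup>2" by (simp add: one_le_power)
    then have "1 \<le> ?s n y" using \<epsilon>[of n] by linarith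
    then have "\<bar>f y\<bar> / ?s n y \<le> \<bar>f y\<bar> / 1" by (intro divide_left_mono) auto
    moreover have "0 \<le> (f y)\<^sup>2 / ?s n y" "0 \<le> (?\<theta> y)\<^sup>2 / ?s n y" using s[where n=n and y=y] by (auto intro!: divide_nonneg_pos)
    ultimately show ?thesis by simp
  qed
  have nn: "0 \<le> \<bar>f y\<bar> / ?s n y" for n y using s[where n=n and y=y] by (auto intro!: divide_nonneg_pos)
  have c\<epsilon>: "continuous_on UNIV (\<lambda>y. \<bar>f y\<bar> / ?s n y)" for n
    using s by (intro continuous_intros cf ballI less_imp_neq[THEN not_sym]) auto
  note h1 = hardy[OF f cf i \<epsilon>, of x]
  note h2 = hardy[OF has_partial_cutoff continuous_cutoff(1) continuous_cutoff(2) i\<theta>(1) i\<theta>(2) \<epsilon>, of x]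
  have i3: "integrable lborel (\<lambda>y. (f y)\<^sup>2 / ?s n y + 2 * ((?\<theta> y)\<^sup>2 / ?s n y) + \<bar>f y\<bar>)" for n
    by (intro Bochner_Integration.integrable_add integrable_mult_right h1 h2 i1)
  have i\<epsilon>: "integrable lborel (\<lambda>y. \<bar>f y\<bar> / ?s n y)" for n
  proof (rule Bochner_Integration.integrable_bound[OF i3[where n=n]])
    show "(\<lambda>y. \<bar>f y\<bar> / ?s n y) \<in> borel_measurable lborel"
      using borel_measurable_continuous_onI[OF c\<epsilon>] by simp
    have "norm (\<bar>f y\<bar> / ?s n y) \<le> norm ((f y)\<^sup>2 / ?s n y + 2 * ((?\<theta> y)\<^sup>2 / ?s n y) + \<bar>f y\<bar>)" for y
      unfolding real_norm_def using pw[where n=n and y=y] nn[where n=n and y=y] by linarith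
    then show "AE y in lborel. norm (\<bar>f y\<bar> / ?s n y)
        \<le> norm ((f y)\<^sup>2 / ?s n y + 2 * ((?\<theta> y)\<^sup>2 / ?s n y) + \<bar>f y\<bar>)" by simp
  qed
  have le: "(LINT y|lborel. \<bar>f y\<bar> / ?s n y) \<le> ?B" for n
  proof -
    have "(LINT y|lborel. \<bar>f y\<bar> / ?s n y) \<le> (LINT y|lborel. (f y)\<^sup>2 / ?s n y + 2 * ((?\<theta> y)\<^sup>2 / ?s n y) + \<bar>f y\<bar>)"
      by (intro integral_mono i\<epsilon> i3 pw)
    also have "\<dots> = (LINT y|lborel. (f y)\<^sup>2 / ?s n y) + 2 * (LINT y|lborel. (?\<theta> y)\<^sup>2 / ?s n y) + (LINT y|lborel. \<bar>f y\<bar>)"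
      by (simp only: Bochner_Integration.integral_add Bochner_Integration.integrable_add integrable_mult_right integral_mult_right_zero h1(1) h2(1) i1)
    also have "\<dots> \<le> ?B" using h1(2)[of n] h2(2)[of n] \<theta> by linarith
    finally show ?thesis .
  qed
  \<comment> \<open>The point y = x is removed as a null set: division by zero there would give a
    value that is not the limit.\<close>
  have l: "AE y in lborel. (\<lambda>n. \<bar>f y\<bar> / ?s n y) \<longlonglongrightarrow> \<bar>f y\<bar> / (dist x y)\<^sup>2"
    using AE_lborel_singleton[of x]
  proof eventually_elim
    case (elim y)
    have "(\<lambda>n. \<bar>f y\<bar> / ?s n y) \<longlonglongrightarrow> \<bar>f y\<bar> / ((norm (y - x))\<^sup>2 + 0)"
      using elim by (intro tendsto_intros \<epsilon>0) auto
    then show ?case by (simp add: dist_norm norm_minus_commute)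
  qed
  have m: "(\<lambda>y. \<bar>f y\<bar> / (dist x y)\<^sup>2) \<in> borel_measurable lborel"
    using borel_measurable_continuous_onI[OF cf(1)] by simp
  note F = integral_le_of_tendsto[OF i\<epsilon> nn le tendsto_const m l]
  show "integrable lborel (\<lambda>y. \<bar>f y\<bar> / (dist x y)\<^sup>2)" by (rule F(1))
  show "(LINT y|lborel. \<bar>f y\<bar> / (dist x y)\<^sup>2) \<le> ?B" by (rule F(2))
qed

text \<open>A Lipschitz bound replaces differentiation under the singular integral: |1/a - 1/b| is
  at most |x - x'| / (ab), and 1/(ab) is at most half the sum of 1/a^2 and 1/b^2. The potential of a
  solution is smooth anyway, so its partial derivatives inherit the Lipschitz constant.\<close>

lemma newtonian_potential_lipschitz:
  assumes m: "f \<in> borel_measurable borel" and i1: "integrable lborel f"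
    and i2: "\<And>x. integrable lborel (\<lambda>y. \<bar>f y\<bar> / (dist x y)\<^sup>2)"
    and B: "\<And>x. (LINT y|lborel. \<bar>f y\<bar> / (dist x y)\<^sup>2) \<le> B"
  shows "\<bar>newtonian_potential f x - newtonian_potential f x'\<bar> \<le> B * dist x x'"
proof -
  have i: "integrable lborel (\<lambda>y. f y / (4 * pi * dist x y))" for x
  proof (rule Bochner_Integration.integrable_bound)
    show "integrable lborel (\<lambda>y. \<bar>f y\<bar> + \<bar>f y\<bar> / (dist x y)\<^sup>2)" using i1 i2 by simp
    have "\<bar>f y\<bar> / (4 * pi * dist x y) \<le> \<bar>f y\<bar> + \<bar>f y\<bar> / (dist x y)\<^sup>2" for y
    proof (cases "x = y")
      case False
      let ?d = "dist x y"
      have d: "?d > 0" using False by simp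
      have "1 / ?d \<le> 1 + (1 / ?d)\<^sup>2"
      proof -
        have "q \<le> 1 + q\<^sup>2" for q :: real
        proof -
          have "q\<^sup>2 - 2 * q + 1 \<ge> 0" using zero_le_power2[of "q - 1"] by (simp add: power2_diff)
          then show ?thesis using zero_le_power2[of q] by linarith
        qed
        then show ?thesis .
      qed
      then have 2: "1 / ?d \<le> 1 + 1 / ?d\<^sup>2" by (simp only: power_one_over)
      have "4 * pi \<ge> 1" using pi_gt3 by linarith
      then have "1 / (4 * pi * ?d) \<le> 1 / (1 * ?d)" using d by (intro divide_left_mono mult_right_mono) auto
      then have "1 / (4 * pi * ?d) \<le> 1 + 1 / ?d\<^sup>2" using 2 by simp
      from mult_left_mono[OF this, of "\<bar>f y\<bar>"] show ?thesis by (simp add: distrib_left)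
    qed auto
    then show "AE y in lborel. norm (f y / (4 * pi * dist x y)) \<le> norm (\<bar>f y\<bar> + \<bar>f y\<bar> / (dist x y)\<^sup>2)"
      by (auto simp: abs_mult)
  qed (use m in measurable)
  have pw: "AE y in lborel. \<bar>f y / (4 * pi * dist x y) - f y / (4 * pi * dist x' y)\<bar>
      \<le> dist x x' / 2 * (\<bar>f y\<bar> / (dist x y)\<^sup>2 + \<bar>f y\<bar> / (dist x' y)\<^sup>2)"
    using AE_lborel_singleton[of x] AE_lborel_singleton[of x']
  proof eventually_elim
    case (elim y)
    define a b where "a = dist x y" and "b = dist x' y"
    have ab: "a > 0" "b > 0" using elim by (auto simp: a_def b_def)
    have "\<bar>b - a\<bar> \<le> dist x x'" unfolding a_def b_def by (metis abs_dist_diff_le dist_commute)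
    then have "\<bar>1 / a - 1 / b\<bar> \<le> dist x x' * (1 / a * (1 / b))"
      using ab by (simp add: diff_frac_eq abs_mult divide_right_mono)
    also have "1 / a * (1 / b) \<le> 1 / 2 * (1 / a\<^sup>2 + 1 / b\<^sup>2)"
      using zero_le_power2[of "1 / a - 1 / b"] by (simp add: power2_eq_square algebra_simps)
    finally have 1: "\<bar>1 / a - 1 / b\<bar> \<le> dist x x' / 2 * (1 / a\<^sup>2 + 1 / b\<^sup>2)" by (simp add: mult_left_mono)
    have "f y / (4 * pi * a) - f y / (4 * pi * b) = f y / (4 * pi) * (1 / a - 1 / b)"
      by (simp add: right_diff_distrib)
    then have "\<bar>f y / (4 * pi * a) - f y / (4 * pi * b)\<bar> = \<bar>f y\<bar> / (4 * pi) * \<bar>1 / a - 1 / b\<bar>"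
      by (simp add: abs_mult)
    also have "\<dots> \<le> \<bar>f y\<bar> * (dist x x' / 2 * (1 / a\<^sup>2 + 1 / b\<^sup>2))"
    proof (intro mult_mono 1)
      have "4 * pi \<ge> 1" using pi_gt3 by linarith
      then have "\<bar>f y\<bar> / (4 * pi) \<le> \<bar>f y\<bar> / 1" by (intro divide_left_mono) auto
      then show "\<bar>f y\<bar> / (4 * pi) \<le> \<bar>f y\<bar>" by simp
    qed auto
    finally show ?case by (simp add: a_def b_def algebra_simps)
  qed
  have "\<bar>newtonian_potential f x - newtonian_potential f x'\<bar>
      = \<bar>LINT y|lborel. f y / (4 * pi * dist x y) - f y / (4 * pi * dist x' y)\<bar>"
    unfolding newtonian_potential_def using i by simp
  also have "\<dots> \<le> (LINT y|lborel. \<bar>f y / (4 * pi * dist x y) - f y / (4 * pi * dist x' y)\<bar>)"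
    by (rule integral_abs_bound)
  also have "\<dots> \<le> (LINT y|lborel. dist x x' / 2 * (\<bar>f y\<bar> / (dist x y)\<^sup>2 + \<bar>f y\<bar> / (dist x' y)\<^sup>2))"
    by (intro integral_mono_AE pw) (use i i2 in auto)
  also have "\<dots> = dist x x' / 2 * ((LINT y|lborel. \<bar>f y\<bar> / (dist x y)\<^sup>2) + (LINT y|lborel. \<bar>f y\<bar> / (dist x' y)\<^sup>2))"
    using i2 by simp
  also have "\<dots> \<le> dist x x' / 2 * (B + B)" by (intro mult_left_mono add_mono B) auto
  finally show ?thesis by (simp add: mult.commute)
qed

lemma has_partial_le_lipschitz:
  assumes "has_partial j f f'" "\<And>x x'. \<bar>f x - f x'\<bar> \<le> B * dist x x'"
  shows "\<bar>f' x\<bar> \<le> B"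
proof -
  have "((\<lambda>h. \<bar>(f (x + h *\<^sub>R axis j 1) - f x) / h\<bar>) \<longlongrightarrow> \<bar>f' x\<bar>) (at 0)"
    using has_partialD[OF assms(1), of x] by (intro tendsto_rabs) (simp add: DERIV_def)
  moreover have "\<bar>(f (x + h *\<^sub>R axis j 1) - f x) / h\<bar> \<le> B" if "h \<noteq> 0" for h
    using assms(2)[of "x + h *\<^sub>R axis j 1" x] that
    by (simp add: dist_norm norm_axis_1 abs_divide divide_le_eq)
  ultimately show ?thesis
    by (intro tendsto_upperbound[of _ _ "at 0"]) (auto simp: eventually_at_filter)
qed

section \<open>Energy identities for drift-diffusion equations\<close>

text \<open>A function on the product space that carries the time interval as an indicator, so that
  one application of Fubini serves both orders: the inner time integral for the fundamental theorem
  of calculus, the inner space integral for bounds on slices.\<close>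

definition slab :: "real \<Rightarrow> real \<Rightarrow> (real \<Rightarrow> real^3 \<Rightarrow> real) \<Rightarrow> real \<times> (real^3) \<Rightarrow> real" where
  "slab s T g p = indicator {s..T} (fst p) * g (fst p) (snd p)"

lemma integrable_slab:
  assumes c: "continuous_on spacetime (\<lambda>p. g (fst p) (snd p))" and s: "0 < s"
    and z: "\<And>t x. x \<notin> cball 0 R \<Longrightarrow> g t x = 0"
  shows "integrable lborel (slab s T g)"
proof -
  let ?K = "{s..T} \<times> cball (0 :: real^3) R"
  have "compact ?K" by (intro compact_Times) auto
  moreover have "continuous_on ?K (\<lambda>p. g (fst p) (snd p))"
    by (rule continuous_on_subset[OF c]) (use s in auto)
  ultimately have "integrable lborel (\<lambda>p. indicator ?K p *\<^sub>R g (fst p) (snd p))"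
    by (rule borel_integrable_compact)
  moreover have "(\<lambda>p. indicator ?K p *\<^sub>R g (fst p) (snd p)) = slab s T g"
    using z by (force simp: slab_def indicator_def)
  ultimately show ?thesis by simp
qed

lemma slab_integral:
  assumes "integrable lborel (slab s T g)"
  shows "(LINT p|lborel. slab s T g p) = (LINT t|lborel. indicator {s..T} t * (LINT x|lborel. g t x))"
    "integrable lborel (\<lambda>t. indicator {s..T} t * (LINT x|lborel. g t x))"
    "(LINT p|lborel. slab s T g p) = (LINT x|lborel. (LINT t|lborel. indicator {s..T} t * g t x))"
proof -
  have i: "integrable (lborel \<Otimes>\<^sub>M lborel) (slab s T g)" using assms by (simp add: lborel_prod)
  show "(LINT p|lborel. slab s T g p) = (LINT t|lborel. indicator {s..T} t * (LINT x|lborel. g t x))"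
    using lborel_pair.integral_fst'[OF i] by (simp add: lborel_prod slab_def[abs_def])
  show "integrable lborel (\<lambda>t. indicator {s..T} t * (LINT x|lborel. g t x))"
    using lborel_pair.integrable_fst'[OF i] by (simp add: slab_def)
  have "integrable (lborel \<Otimes>\<^sub>M lborel) (\<lambda>(t, x). indicator {s..T} t * g t x)"
    using i by (simp add: slab_def[abs_def] case_prod_beta')
  from lborel_pair.integral_snd[OF this]
  show "(LINT p|lborel. slab s T g p) = (LINT x|lborel. (LINT t|lborel. indicator {s..T} t * g t x))"
    by (simp add: lborel_prod slab_def[abs_def] case_prod_beta')
qed

lemma slab_integral_le:
  assumes i: "integrable lborel (slab s T g)" and K: "\<And>t. s \<le> t \<Longrightarrow> t \<le> T \<Longrightarrow> (LINT x|lborel. g t x) \<le> K"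
    and "s \<le> T"
  shows "(LINT p|lborel. slab s T g p) \<le> K * (T - s)"
proof -
  have "(LINT p|lborel. slab s T g p) \<le> (LINT t|lborel. indicator {s..T} t * K)"
    unfolding slab_integral(1)[OF i]
  proof (intro integral_mono slab_integral(2)[OF i] integrable_mult_left integrable_real_indicator)
    show "emeasure lborel {s..T} < \<infinity>" by (rule emeasure_bounded_finite) simp
  qed (use K in \<open>auto simp: indicator_def\<close>)
  also have "\<dots> = K * (T - s)" using assms(3) by simp
  finally show ?thesis .
qed

text \<open>Derivatives enter as separate functions with \<open>has_partial\<close> facts, which
  linear combinations of concentrations satisfy directly. \<open>a\<close> is the common valence,
  and \<open>\<rho>\<close> is tied to the evolution only by \<open>poisson\<close>.\<close>

locale drift_diffusion =
  fixes D a :: real and w wt \<rho> :: "real \<Rightarrow> real^3 \<Rightarrow> real"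
    and wx wxx u ux \<phi>x \<phi>xx :: "3 \<Rightarrow> real \<Rightarrow> real^3 \<Rightarrow> real"
  assumes time: "\<And>t x. t > 0 \<Longrightarrow> ((\<lambda>s. w s x) has_real_derivative wt t x) (at t)"
    and space: "\<And>t j. t > 0 \<Longrightarrow> has_partial j (w t) (wx j t)"
      "\<And>t j. t > 0 \<Longrightarrow> has_partial j (wx j t) (wxx j t)"
      "\<And>t j. t > 0 \<Longrightarrow> has_partial j (u j t) (ux j t)"
      "\<And>t j. t > 0 \<Longrightarrow> has_partial j (\<phi>x j t) (\<phi>xx j t)"
    and cont: "continuous_on spacetime (\<lambda>p. w (fst p) (snd p))"
      "continuous_on spacetime (\<lambda>p. wt (fst p) (snd p))"
      "\<And>j. continuous_on spacetime (\<lambda>p. wx j (fst p) (snd p))"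
      "\<And>j. continuous_on spacetime (\<lambda>p. wxx j (fst p) (snd p))"
      "\<And>j. continuous_on spacetime (\<lambda>p. u j (fst p) (snd p))"
      "\<And>j. continuous_on spacetime (\<lambda>p. ux j (fst p) (snd p))"
      "\<And>j. continuous_on spacetime (\<lambda>p. \<phi>x j (fst p) (snd p))"
      "\<And>j. continuous_on spacetime (\<lambda>p. \<phi>xx j (fst p) (snd p))"
      "continuous_on spacetime (\<lambda>p. \<rho> (fst p) (snd p))"
    and div_free: "\<And>t x. t > 0 \<Longrightarrow> (\<Sum>j\<in>UNIV. ux j t x) = 0"
    and poisson: "\<And>t x. t > 0 \<Longrightarrow> (\<Sum>j\<in>UNIV. \<phi>xx j t x) = - \<rho> t x"
    and pde: "\<And>t x. t > 0 \<Longrightarrow> wt t x = - (\<Sum>j\<in>UNIV. u j t x * wx j t x) + D * (\<Sum>j\<in>UNIV. wxx j t x)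
      + a * D * (\<Sum>j\<in>UNIV. wx j t x * \<phi>x j t x + w t x * \<phi>xx j t x)"
begin

text \<open>The terms in which integration by parts has moved a derivative onto the cutoff. The only
  factor involving w is J(w), so the growth of J decides their size.\<close>

definition flux :: "(real \<Rightarrow> real) \<Rightarrow> real \<Rightarrow> real \<Rightarrow> real^3 \<Rightarrow> real" where
  "flux J R t x = J (w t x) * (\<Sum>j\<in>UNIV. u j t x * cutoff_d 0 R j x + D * cutoff_dd 0 R j x
     - a * D * \<phi>x j t x * cutoff_d 0 R j x)"

text \<open>What is left of the drift away from the cutoff's derivatives: w J' - J measures how far
  J is from being homogeneous of degree one, and \<open>poisson\<close> has turned the Laplacian of
  the potential into the charge.\<close>

definition reaction :: "(real \<Rightarrow> real) \<Rightarrow> (real \<Rightarrow> real) \<Rightarrow> real \<Rightarrow> real \<Rightarrow> real^3 \<Rightarrow> real" where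
  "reaction J J' R t x = cutoff 0 R x * ((w t x * J' (w t x) - J (w t x)) * \<rho> t x)"

definition dissipation :: "(real \<Rightarrow> real) \<Rightarrow> real \<Rightarrow> real \<Rightarrow> real^3 \<Rightarrow> real" where
  "dissipation J'' R t x = cutoff 0 R x * (J'' (w t x) * (\<Sum>j\<in>UNIV. (wx j t x)\<^sup>2))"

lemma slice_continuous:
  assumes "continuous_on spacetime (\<lambda>p. g (fst p) (snd p))" "t > 0"
  shows "continuous_on UNIV (g t)"
proof -
  have "continuous_on UNIV (\<lambda>x. (\<lambda>p. g (fst p) (snd p)) (t, x))"
    using assms by (intro continuous_on_compose2[OF assms(1)] continuous_intros) auto
  then show ?thesis by simp
qed

lemma slice_cont:
  assumes "t > 0"
  shows "continuous_on UNIV (w t)" "continuous_on UNIV (wt t)" "continuous_on UNIV (wx j t)"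
    "continuous_on UNIV (wxx j t)" "continuous_on UNIV (u j t)" "continuous_on UNIV (ux j t)"
    "continuous_on UNIV (\<phi>x j t)" "continuous_on UNIV (\<phi>xx j t)" "continuous_on UNIV (\<rho> t)"
  by (intro slice_continuous cont assms)+

context
  fixes J J' J'' :: "real \<Rightarrow> real"
  assumes J: "\<And>y. (J has_real_derivative J' y) (at y)" "\<And>y. (J' has_real_derivative J'' y) (at y)"
    and cJ'': "continuous_on UNIV J''"
begin

lemma cJ: "continuous_on UNIV J" "continuous_on UNIV J'"
  using J by (auto intro!: continuous_at_imp_continuous_on DERIV_isCont)

lemma continuous_compose_w:
  "continuous_on spacetime (\<lambda>p. J (w (fst p) (snd p)))"
  "continuous_on spacetime (\<lambda>p. J' (w (fst p) (snd p)))"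
  "continuous_on spacetime (\<lambda>p. J'' (w (fst p) (snd p)))"
  by (rule continuous_on_compose2[OF cJ(1) cont(1)] continuous_on_compose2[OF cJ(2) cont(1)]
      continuous_on_compose2[OF cJ'' cont(1)], simp)+

lemma continuous_cutoff_snd:
  "continuous_on spacetime (\<lambda>p. cutoff 0 R (snd p))"
  "continuous_on spacetime (\<lambda>p. cutoff_d 0 R j (snd p))"
  "continuous_on spacetime (\<lambda>p. cutoff_dd 0 R j (snd p))"
  by (rule continuous_on_compose2[OF continuous_cutoff(1)[of UNIV] continuous_on_snd[OF continuous_on_id]]
      continuous_on_compose2[OF continuous_cutoff(2)[of UNIV] continuous_on_snd[OF continuous_on_id]]
      continuous_on_compose2[OF continuous_cutoff(3)[of UNIV] continuous_on_snd[OF continuous_on_id]], rule subset_UNIV)+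

lemma continuous_terms:
  "continuous_on spacetime (\<lambda>p. flux J R (fst p) (snd p))"
  "continuous_on spacetime (\<lambda>p. reaction J J' R (fst p) (snd p))"
  "continuous_on spacetime (\<lambda>p. dissipation J'' R (fst p) (snd p))"
  "continuous_on spacetime (\<lambda>p. cutoff 0 R (snd p) * (J' (w (fst p) (snd p)) * wt (fst p) (snd p)))"
  unfolding flux_def reaction_def dissipation_def
  by (intro continuous_intros continuous_compose_w continuous_cutoff_snd cont)+

lemma terms_outside:
  assumes "R > 0" "x \<notin> cball 0 R"
  shows "flux J R t x = 0" "reaction J J' R t x = 0" "dissipation J'' R t x = 0"
    "cutoff 0 R x * (J' (w t x) * wt t x) = 0"
  using cutoff_outside[OF assms(2,1)] by (simp_all add: flux_def reaction_def dissipation_def)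

lemma integrable_terms:
  assumes "R > 0" "t > 0"
  shows "integrable lborel (flux J R t)" "integrable lborel (reaction J J' R t)"
    "integrable lborel (dissipation J'' R t)" "integrable lborel (\<lambda>x. cutoff 0 R x * (J' (w t x) * wt t x))"
    "integrable lborel (\<lambda>x. cutoff 0 R x * J (w t x))"
proof -
  note i = integrable_continuous_compact_support[OF _ compact_cball[of 0 R]]
  show "integrable lborel (flux J R t)"
    by (rule i[OF slice_continuous[OF continuous_terms(1) assms(2)] terms_outside(1)[OF assms(1)]])
  show "integrable lborel (reaction J J' R t)"
    by (rule i[OF slice_continuous[OF continuous_terms(2) assms(2)] terms_outside(2)[OF assms(1)]])
  show "integrable lborel (dissipation J'' R t)"
    by (rule i[OF slice_continuous[OF continuous_terms(3) assms(2)] terms_outside(3)[OF assms(1)]])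
  show "integrable lborel (\<lambda>x. cutoff 0 R x * (J' (w t x) * wt t x))"
    by (rule i[OF slice_continuous[where g="\<lambda>t x. cutoff 0 R x * (J' (w t x) * wt t x)", OF continuous_terms(4) assms(2)]
        terms_outside(4)[OF assms(1)]])
  have "continuous_on UNIV (\<lambda>x. cutoff 0 R x * J (w t x))"
    by (intro continuous_intros continuous_cutoff continuous_on_compose2[OF cJ(1) slice_cont(1)[OF assms(2)]]) auto
  then show "integrable lborel (\<lambda>x. cutoff 0 R x * J (w t x))"
    by (rule i) (use cutoff_outside assms in auto)
qed

lemma integrable_slab_terms:
  assumes "R > 0" "s > 0"
  shows "integrable lborel (slab s T (flux J R))" "integrable lborel (slab s T (reaction J J' R))"
    "integrable lborel (slab s T (dissipation J'' R))"
    "integrable lborel (slab s T (\<lambda>t x. cutoff 0 R x * (J' (w t x) * wt t x)))"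
proof -
  show "integrable lborel (slab s T (flux J R))"
    by (rule integrable_slab[OF continuous_terms(1) assms(2) terms_outside(1)[OF assms(1)]])
  show "integrable lborel (slab s T (reaction J J' R))"
    by (rule integrable_slab[OF continuous_terms(2) assms(2) terms_outside(2)[OF assms(1)]])
  show "integrable lborel (slab s T (dissipation J'' R))"
    by (rule integrable_slab[OF continuous_terms(3) assms(2) terms_outside(3)[OF assms(1)]])
  show "integrable lborel (slab s T (\<lambda>t x. cutoff 0 R x * (J' (w t x) * wt t x)))"
    by (rule integrable_slab[OF continuous_terms(4) assms(2) terms_outside(4)[OF assms(1)]])
qed

text \<open>The equation times \<theta> J'(w) is flux, reaction and dissipation plus the divergence
  of \<theta> (-J u + D J' grad w + a D J grad \<phi>) - D J grad \<theta>. This field has compact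
  support, so its divergence integrates to zero.\<close>

lemma slice_identity:
  assumes R: "R > 0" and t: "t > 0"
  shows "(LINT x|lborel. cutoff 0 R x * (J' (w t x) * wt t x))
    = (LINT x|lborel. flux J R t x) - a * D * (LINT x|lborel. reaction J J' R t x)
      - D * (LINT x|lborel. dissipation J'' R t x)"
proof -
  let ?\<theta> = "cutoff 0 R" and ?\<theta>' = "cutoff_d 0 R" and ?\<theta>'' = "cutoff_dd 0 R"
  let ?J = "\<lambda>x. J (w t x)" and ?J' = "\<lambda>x. J' (w t x)" and ?J'' = "\<lambda>x. J'' (w t x)"
  let ?b = "a * D"
  define B where "B j x = - 1 * (?J x * u j t x) + (D * (?J' x * wx j t x) + ?b * (?J x * \<phi>x j t x))" for j x
  define B' where "B' j x = - 1 * ((?J' x * wx j t x) * u j t x + ?J x * ux j t x)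
      + (D * ((?J'' x * wx j t x) * wx j t x + ?J' x * wxx j t x)
        + ?b * ((?J' x * wx j t x) * \<phi>x j t x + ?J x * \<phi>xx j t x))" for j x
  define F where "F j x = ?\<theta> x * B j x - D * (?J x * ?\<theta>' j x)" for j x
  define F' where "F' j x = (?\<theta>' j x * B j x + ?\<theta> x * B' j x)
      - D * ((?J' x * wx j t x) * ?\<theta>' j x + ?J x * ?\<theta>'' j x)" for j x
  have F: "has_partial j (F j) (F' j)" for j
    unfolding F_def F'_def B_def B'_def
    by (intro has_partial_diff has_partial_add has_partial_cmult has_partial_mult has_partial_cutoff
        has_partial_cutoff_d has_partial_compose[OF J(1)] has_partial_compose[OF J(2)] space t)
  note cs = slice_cont[OF t] continuous_on_compose2[OF cJ(1) slice_cont(1)[OF t]]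
    continuous_on_compose2[OF cJ(2) slice_cont(1)[OF t]] continuous_on_compose2[OF cJ'' slice_cont(1)[OF t]]
  have cF: "continuous_on UNIV (F j)" "continuous_on UNIV (F' j)" for j
    unfolding F_def F'_def B_def B'_def
    by (intro continuous_intros continuous_cutoff cs subset_UNIV)+
  have z: "F j x = 0" "F' j x = 0" if "x \<notin> cball 0 R" for j x
    using cutoff_outside[OF that R] by (simp_all add: F_def F'_def)
  have iF1: "integrable lborel (F' j)" for j
    by (rule integrable_continuous_compact_support[OF cF(2) compact_cball z(2)])
  have iF2: "(LINT x|lborel. F' j x) = 0" for j
    by (rule integral_partial_eq_0[OF F cF z(1)])
  note iF = iF1 iF2
  \<comment> \<open>Pointwise algebra over three coordinates, with the sum abstracted as S so that
    the rule unifies with the goal. Incompressibility and the Poisson equation each eliminate one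
    third component.\<close>
  have alg: "th * (J1 * (- S (\<lambda>j. uj j * wj j) + D * S wjj + b * S (\<lambda>j. wj j * pj j + w0 * pjj j)))
     = J0 * S (\<lambda>j. uj j * tj j + D * tjj j - b * pj j * tj j) - b * (th * ((w0 * J1 - J0) * r))
       - D * (th * (J2 * S (\<lambda>j. (wj j)\<^sup>2)))
       + S (\<lambda>j. (tj j * (- 1 * (J0 * uj j) + (D * (J1 * wj j) + b * (J0 * pj j)))
          + th * (- 1 * ((J1 * wj j) * uj j + J0 * ujj j)
          + (D * ((J2 * wj j) * wj j + J1 * wjj j)
          + b * ((J1 * wj j) * pj j + J0 * pjj j))))
          - D * ((J1 * wj j) * tj j + J0 * tjj j))"
    if S: "S = (\<lambda>f. sum f (UNIV :: 3 set))" and d: "S ujj = 0" and p: "S pjj = - r"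
    for th J0 J1 J2 w0 r b :: real and uj ujj wj wjj pj pjj tj tjj :: "3 \<Rightarrow> real" and S
  proof -
    have d3: "ujj 3 = - ujj 1 - ujj 2" and p3: "pjj 3 = - r - pjj 1 - pjj 2"
      using d p by (simp_all add: S sum_3)
    show ?thesis unfolding S sum_3 d3 p3 by (simp add: algebra_simps power2_eq_square)
  qed
  have pw: "?\<theta> x * (?J' x * wt t x) = flux J R t x - ?b * reaction J J' R t x - D * dissipation J'' R t x
      + (\<Sum>j\<in>UNIV. F' j x)" for x
    unfolding pde[OF t] flux_def reaction_def dissipation_def F'_def B_def B'_def
    by (rule alg[OF refl div_free[OF t] poisson[OF t]])
  show ?thesis
    unfolding pw using integrable_terms[OF R t] iF
    by (simp add: Bochner_Integration.integral_add Bochner_Integration.integral_diff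
        Bochner_Integration.integral_sum Bochner_Integration.integrable_sum)
qed

text \<open>Fubini puts the time integral inside, where the fundamental theorem of calculus applies
  for each fixed x.\<close>

lemma time_identity:
  assumes R: "R > 0" and s: "0 < s" "s \<le> T"
  shows "(LINT p|lborel. slab s T (\<lambda>t x. cutoff 0 R x * (J' (w t x) * wt t x)) p)
    = (LINT x|lborel. cutoff 0 R x * J (w T x)) - (LINT x|lborel. cutoff 0 R x * J (w s x))"
proof -
  have "(LINT t|lborel. indicator {s..T} t * (cutoff 0 R x * (J' (w t x) * wt t x)))
      = cutoff 0 R x * J (w T x) - cutoff 0 R x * J (w s x)" for x
  proof -
    have "(LINT t|lborel. (cutoff 0 R x * (J' (w t x) * wt t x)) * indicator {s..T} t)
      = cutoff 0 R x * J (w T x) - cutoff 0 R x * J (w s x)"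
    proof (rule integral_FTC_Icc_real[OF s(2)])
      fix t assume "s \<le> t" "t \<le> T"
      then have t: "t > 0" using s by linarith
      show "((\<lambda>t. cutoff 0 R x * J (w t x)) has_real_derivative cutoff 0 R x * (J' (w t x) * wt t x)) (at t)"
        by (intro DERIV_cmult DERIV_chain2[OF J(1) time[OF t]])
      have "continuous_on {0<..} (\<lambda>t. (\<lambda>p. cutoff 0 R (snd p) * (J' (w (fst p) (snd p)) * wt (fst p) (snd p))) (t, x))"
        by (rule continuous_on_compose2[OF continuous_terms(4)]) (auto intro!: continuous_intros)
      then show "isCont (\<lambda>t. cutoff 0 R x * (J' (w t x) * wt t x)) t"
        using t by (simp add: continuous_on_eq_continuous_at)
    qed
    then show ?thesis by (simp only: mult.commute)
  qed
  then show ?thesis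
    unfolding slab_integral(3)[OF integrable_slab_terms(4)[OF R s(1)]]
    using integrable_terms(5)[OF R] s by simp
qed

lemma energy_identity:
  assumes R: "R > 0" and s: "0 < s" "s \<le> T"
  shows "(LINT x|lborel. cutoff 0 R x * J (w T x)) + D * (LINT p|lborel. slab s T (dissipation J'' R) p)
    = (LINT x|lborel. cutoff 0 R x * J (w s x)) + (LINT p|lborel. slab s T (flux J R) p)
      - a * D * (LINT p|lborel. slab s T (reaction J J' R) p)"
proof -
  note i = integrable_slab_terms[OF R s(1)]
  have "(LINT p|lborel. slab s T (\<lambda>t x. cutoff 0 R x * (J' (w t x) * wt t x)) p)
    = (LINT t|lborel. indicator {s..T} t * (LINT x|lborel. flux J R t x)
        - a * D * (indicator {s..T} t * (LINT x|lborel. reaction J J' R t x))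
        - D * (indicator {s..T} t * (LINT x|lborel. dissipation J'' R t x)))"
    unfolding slab_integral(1)[OF i(4)]
    by (intro Bochner_Integration.integral_cong refl)
      (use s slice_identity[OF R] in \<open>auto simp: indicator_def\<close>)
  also have "\<dots> = (LINT p|lborel. slab s T (flux J R) p) - a * D * (LINT p|lborel. slab s T (reaction J J' R) p)
      - D * (LINT p|lborel. slab s T (dissipation J'' R) p)"
    unfolding slab_integral(1)[OF i(1)] slab_integral(1)[OF i(2)] slab_integral(1)[OF i(3)]
    using slab_integral(2)[OF i(1)] slab_integral(2)[OF i(2)] slab_integral(2)[OF i(3)]
    by (simp only: Bochner_Integration.integral_diff Bochner_Integration.integrable_diff
        integral_mult_right_zero integrable_mult_right)
  finally show ?thesis using time_identity[OF R s] by linarith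
qed

text \<open>For R >= 1 both derivatives of the cutoff are O(1/R). The product |w| |u| then costs two
  squared L^2 norms and the terms in |w| alone cost the L^1 norm, so the slope \<kappa> of J divided
  by R governs the error.\<close>

lemma flux_le:
  assumes R: "R \<ge> 1" and t: "t > 0" and \<kappa>: "\<And>y. \<bar>J y\<bar> \<le> \<kappa> * \<bar>y\<bar>" and D: "D \<ge> 0" and K0: "K \<ge> 0"
    and i: "integrable lborel (w t)" "integrable lborel (\<lambda>x. (w t x)\<^sup>2)" "\<And>j. integrable lborel (\<lambda>x. (u j t x)\<^sup>2)"
    and K: "(LINT x|lborel. \<bar>w t x\<bar>) \<le> K" "(LINT x|lborel. (w t x)\<^sup>2) \<le> K" "\<And>j. (LINT x|lborel. (u j t x)\<^sup>2) \<le> K"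
      "\<And>j x. \<bar>\<phi>x j t x\<bar> \<le> K"
  shows "(LINT x|lborel. flux J R t x) \<le> \<kappa> / R * (18 * K + (90 * D + 18 * \<bar>a\<bar> * D * K) * K)"
proof -
  have \<kappa>0: "\<kappa> \<ge> 0" using \<kappa>[of 1] by simp
  \<comment> \<open>Three coordinates times the bounds 30 and 6 for the derivatives of the
    cutoff.\<close>
  let ?M = "90 * D + 18 * \<bar>a\<bar> * D * K"
  have R0: "R > 0" using R by simp
  have pw: "flux J R t x \<le> \<kappa> / R * (9 * (w t x)\<^sup>2 + 3 * (\<Sum>j\<in>UNIV. (u j t x)\<^sup>2) + ?M * \<bar>w t x\<bar>)" for x
  proof -
    let ?S = "\<Sum>j\<in>UNIV. u j t x * cutoff_d 0 R j x + D * cutoff_dd 0 R j x - a * D * \<phi>x j t x * cutoff_d 0 R j x"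
    have "\<bar>u j t x * cutoff_d 0 R j x + D * cutoff_dd 0 R j x - a * D * \<phi>x j t x * cutoff_d 0 R j x\<bar>
        \<le> (6 * \<bar>u j t x\<bar> + 30 * D + 6 * \<bar>a\<bar> * D * K) / R" for j
    proof -
      have 1: "\<bar>u j t x * cutoff_d 0 R j x\<bar> \<le> \<bar>u j t x\<bar> * (6 / R)"
        unfolding abs_mult by (intro mult_left_mono cutoff_d_le R0) auto
      have "R * 1 \<le> R * R" using R R0 by (intro mult_left_mono) auto
      then have "30 / R\<^sup>2 \<le> 30 / R" using R0 by (intro divide_left_mono) (auto simp: power2_eq_square)
      then have "\<bar>cutoff_dd 0 R j x\<bar> \<le> 30 / R" using cutoff_dd_le[OF R0, of 0 j x] by linarith
      then have 2: "\<bar>D * cutoff_dd 0 R j x\<bar> \<le> D * (30 / R)"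
        using D mult_left_mono[of "\<bar>cutoff_dd 0 R j x\<bar>" "30 / R" D] by (simp only: abs_mult abs_of_nonneg)
      have "\<bar>a * D\<bar> * (\<bar>\<phi>x j t x\<bar> * \<bar>cutoff_d 0 R j x\<bar>) \<le> \<bar>a * D\<bar> * (K * (6 / R))"
        by (intro mult_left_mono mult_mono K cutoff_d_le R0 K0) auto
      then have 3: "\<bar>a * D * \<phi>x j t x * cutoff_d 0 R j x\<bar> \<le> \<bar>a\<bar> * D * (K * (6 / R))"
        using D by (simp add: abs_mult mult.assoc)
      have "(6 * \<bar>u j t x\<bar> + 30 * D + 6 * \<bar>a\<bar> * D * K) / R = \<bar>u j t x\<bar> * (6 / R) + D * (30 / R) + \<bar>a\<bar> * D * (K * (6 / R))"
        using R0 by (simp add: field_simps)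
      then show ?thesis using 1 2 3 by linarith
    qed
    then have "\<bar>?S\<bar> \<le> (\<Sum>j\<in>(UNIV :: 3 set). (6 * \<bar>u j t x\<bar> + 30 * D + 6 * \<bar>a\<bar> * D * K) / R)"
      by (intro order_trans[OF sum_abs] sum_mono)
    also have "\<dots> = (6 * (\<Sum>j\<in>UNIV. \<bar>u j t x\<bar>) + ?M) / R"
      by (simp add: sum_divide_distrib[symmetric] sum.distrib sum_distrib_left)
    finally have S: "\<bar>?S\<bar> \<le> (6 * (\<Sum>j\<in>UNIV. \<bar>u j t x\<bar>) + ?M) / R" .
    have "flux J R t x \<le> \<bar>J (w t x)\<bar> * \<bar>?S\<bar>" 
      unfolding flux_def abs_mult[symmetric] by (rule abs_ge_self)
    also have "\<dots> \<le> (\<kappa> * \<bar>w t x\<bar>) * ((6 * (\<Sum>j\<in>UNIV. \<bar>u j t x\<bar>) + ?M) / R)"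
      by (rule mult_mono[OF \<kappa> S mult_nonneg_nonneg[OF \<kappa>0 abs_ge_zero] abs_ge_zero])
    also have "\<dots> = \<kappa> / R * ((\<Sum>j\<in>UNIV. 6 * (\<bar>w t x\<bar> * \<bar>u j t x\<bar>)) + ?M * \<bar>w t x\<bar>)"
    proof -
      have "(k * v) * ((6 * S + M) / R) = k / R * (6 * (v * S) + M * v)" for k v S M :: real
        by (simp add: add_divide_distrib algebra_simps)
      moreover have "6 * (\<bar>w t x\<bar> * (\<Sum>j\<in>UNIV. \<bar>u j t x\<bar>)) = (\<Sum>j\<in>UNIV. 6 * (\<bar>w t x\<bar> * \<bar>u j t x\<bar>))"
        by (simp only: sum_distrib_left)
      ultimately show ?thesis by (simp only:)
    qed
    \<comment> \<open>Young's inequality; summing over three coordinates makes 9 w^2 out of 3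
      w^2.\<close>
    also have "\<dots> \<le> \<kappa> / R * ((\<Sum>j\<in>(UNIV :: 3 set). 3 * (w t x)\<^sup>2 + 3 * (u j t x)\<^sup>2) + ?M * \<bar>w t x\<bar>)"
    proof (intro mult_left_mono add_right_mono sum_mono)
      show "6 * (\<bar>w t x\<bar> * \<bar>u j t x\<bar>) \<le> 3 * (w t x)\<^sup>2 + 3 * (u j t x)\<^sup>2" for j
        using zero_le_power2[of "\<bar>w t x\<bar> - \<bar>u j t x\<bar>"] by (simp add: power2_diff)
    qed (use \<kappa>0 R0 in auto)
    also have "\<dots> = \<kappa> / R * (9 * (w t x)\<^sup>2 + 3 * (\<Sum>j\<in>UNIV. (u j t x)\<^sup>2) + ?M * \<bar>w t x\<bar>)"
      by (simp add: sum.distrib sum_distrib_left)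
    finally show ?thesis .
  qed
  have ir: "integrable lborel (\<lambda>x. 9 * (w t x)\<^sup>2 + 3 * (\<Sum>j\<in>UNIV. (u j t x)\<^sup>2) + ?M * \<bar>w t x\<bar>)"
    by (intro Bochner_Integration.integrable_add integrable_mult_right Bochner_Integration.integrable_sum i integrable_abs)
  have "(LINT x|lborel. flux J R t x) \<le> (LINT x|lborel. \<kappa> / R * (9 * (w t x)\<^sup>2 + 3 * (\<Sum>j\<in>UNIV. (u j t x)\<^sup>2) + ?M * \<bar>w t x\<bar>))"
    by (intro integral_mono pw integrable_terms R0 t integrable_mult_right ir)
  also have "\<dots> = \<kappa> / R * (9 * (LINT x|lborel. (w t x)\<^sup>2) + 3 * (\<Sum>j\<in>UNIV. LINT x|lborel. (u j t x)\<^sup>2) + ?M * (LINT x|lborel. \<bar>w t x\<bar>))"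
    using i by (simp only: integral_mult_right_zero Bochner_Integration.integral_add Bochner_Integration.integrable_add
        integrable_mult_right Bochner_Integration.integral_sum Bochner_Integration.integrable_sum integrable_abs)
  also have "\<dots> \<le> \<kappa> / R * (9 * K + 3 * (\<Sum>j\<in>(UNIV :: 3 set). K) + ?M * K)"
    by (intro mult_left_mono add_mono sum_mono K) (use \<kappa>0 R0 D K0 in auto)
  finally show ?thesis by simp
qed

end

end

section \<open>Bounds for solutions on compact time intervals\<close>

text \<open>Bolzano's bisection plays the role of compactness of [s,T]: bounds on adjacent intervals
  glue to a bound on their union.\<close>

lemma locally_bounded_imp_bounded:
  fixes g :: "real \<Rightarrow> real"
  assumes l: "\<And>t. 0 < t \<Longrightarrow> \<exists>B. eventually (\<lambda>r. g r \<le> B) (at t within {0..})" and s: "0 < s"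
  shows "\<exists>B. \<forall>t\<in>{s..T}. g t \<le> B"
proof (cases "s \<le> T")
  case True
  have "\<exists>B. \<forall>r\<in>{s..T}. 0 \<le> r \<longrightarrow> g r \<le> B"
  proof (rule Bolzano[OF True, where P="\<lambda>a b. \<exists>B. \<forall>r\<in>{a..b}. 0 \<le> r \<longrightarrow> g r \<le> B"])
    fix a b c :: real
    assume "\<exists>B. \<forall>r\<in>{a..b}. 0 \<le> r \<longrightarrow> g r \<le> B" "\<exists>B. \<forall>r\<in>{b..c}. 0 \<le> r \<longrightarrow> g r \<le> B"
    then obtain B C where B: "\<forall>r\<in>{a..b}. 0 \<le> r \<longrightarrow> g r \<le> B" and C: "\<forall>r\<in>{b..c}. 0 \<le> r \<longrightarrow> g r \<le> C" by blast
    have "g r \<le> max B C" if "r \<in> {a..c}" "0 \<le> r" for r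
    proof (cases "r \<le> b")
      case True
      then have "g r \<le> B" using B that by auto
      then show ?thesis by simp
    next
      case False
      then have "g r \<le> C" using C that by auto
      then show ?thesis by simp
    qed
    then show "\<exists>B. \<forall>r\<in>{a..c}. 0 \<le> r \<longrightarrow> g r \<le> B" by blast
  next
    fix t assume "s \<le> t" "t \<le> T"
    then have "0 < t" using s by linarith
    then obtain B where "eventually (\<lambda>r. g r \<le> B) (at t within {0..})" using l by blast
    then obtain d where d: "d > 0" "\<And>r. r \<in> {0..} \<Longrightarrow> r \<noteq> t \<Longrightarrow> dist r t < d \<Longrightarrow> g r \<le> B"
      unfolding eventually_at by blast
    \<comment> \<open>The filter \<open>at t within {0..}\<close> leaves out t itself, so the value
      there is added by hand.\<close>
    have "g r \<le> max B (g t)" if "a \<le> t" "t \<le> b" "b - a < d" "r \<in> {a..b}" "0 \<le> r" for a b r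
    proof (cases "r = t")
      case False
      have "dist r t < d" using that by (auto simp: dist_real_def)
      then have "g r \<le> B" using d(2)[of r] False that by auto
      then show ?thesis by simp
    qed simp
    then show "\<exists>d>0. \<forall>a b. a \<le> t \<and> t \<le> b \<and> b - a < d \<longrightarrow> (\<exists>B. \<forall>r\<in>{a..b}. 0 \<le> r \<longrightarrow> g r \<le> B)"
      using d(1) by blast
  qed
  then show ?thesis using s by force
qed auto

lemma integrable_square_imp_product:
  fixes f g :: "'a \<Rightarrow> real"
  assumes "f \<in> borel_measurable M" "g \<in> borel_measurable M"
    "integrable M (\<lambda>x. (f x)\<^sup>2)" "integrable M (\<lambda>x. (g x)\<^sup>2)"
  shows "integrable M (\<lambda>x. f x * g x)"
proof (rule Bochner_Integration.integrable_bound)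
  show "integrable M (\<lambda>x. (f x)\<^sup>2 + (g x)\<^sup>2)" using assms by simp
  have "\<bar>f x * g x\<bar> \<le> (f x)\<^sup>2 + (g x)\<^sup>2" for x
  proof -
    have "2 * (\<bar>f x\<bar> * \<bar>g x\<bar>) \<le> (f x)\<^sup>2 + (g x)\<^sup>2"
      using zero_le_power2[of "\<bar>f x\<bar> - \<bar>g x\<bar>"] by (simp add: power2_diff)
    moreover have "0 \<le> \<bar>f x\<bar> * \<bar>g x\<bar>" by simp
    ultimately show ?thesis unfolding abs_mult by linarith
  qed
  then show "AE x in M. norm (f x * g x) \<le> norm ((f x)\<^sup>2 + (g x)\<^sup>2)" by simp
qed (use assms in measurable)

lemma integrable_square_diff:
  fixes f g :: "'a \<Rightarrow> real"
  assumes "f \<in> borel_measurable M" "g \<in> borel_measurable M"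
    "integrable M (\<lambda>x. (f x)\<^sup>2)" "integrable M (\<lambda>x. (g x)\<^sup>2)"
  shows "integrable M (\<lambda>x. (f x - g x)\<^sup>2)"
  using assms integrable_square_imp_product[OF assms] by (simp add: power2_diff mult.assoc)

lemma integral_square_le_diff:
  fixes f g :: "'a \<Rightarrow> real"
  assumes "f \<in> borel_measurable M" "g \<in> borel_measurable M"
    "integrable M (\<lambda>x. (f x)\<^sup>2)" "integrable M (\<lambda>x. (g x)\<^sup>2)"
  shows "(LINT x|M. (f x)\<^sup>2) \<le> 2 * (LINT x|M. (f x - g x)\<^sup>2) + 2 * (LINT x|M. (g x)\<^sup>2)"
proof -
  have "(LINT x|M. (f x)\<^sup>2) \<le> (LINT x|M. 2 * (f x - g x)\<^sup>2 + 2 * (g x)\<^sup>2)"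
  proof (rule integral_mono)
    show "(f x)\<^sup>2 \<le> 2 * (f x - g x)\<^sup>2 + 2 * (g x)\<^sup>2" for x
      using zero_le_power2[of "f x - 2 * g x"] by (simp add: power2_eq_square algebra_simps)
  qed (use assms integrable_square_diff[OF assms] in auto)
  then show ?thesis using assms integrable_square_diff[OF assms] by simp
qed

text \<open>The norm is written with chosen weak derivatives; their integrals are exchanged for
  those of the classical ones, about which the bounds are needed.\<close>

lemma H1_norm_bounds:
  assumes f: "\<And>j. has_partial j f (f' j)" "continuous_on UNIV f" "\<And>j. continuous_on UNIV (f' j)"
    and H: "H1_norm f \<le> 1"
  shows "(LINT x|lborel. (f x)\<^sup>2) \<le> 1" "(LINT x|lborel. (f' j x)\<^sup>2) \<le> 1"
proof -
  let ?W = "\<lambda>j. LINT x|lborel. (weak_partial j f x)\<^sup>2"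
  have nn: "0 \<le> (LINT x|lborel. (f x)\<^sup>2)" "0 \<le> ?W j" for j by simp_all
  have "sqrt ((LINT x|lborel. (f x)\<^sup>2) + (\<Sum>j\<in>UNIV. ?W j)) \<le> 1" using H by (simp add: H1_norm_def)
  then have 1: "(LINT x|lborel. (f x)\<^sup>2) + (\<Sum>j\<in>UNIV. ?W j) \<le> 1" by simp
  have 2: "0 \<le> (\<Sum>j\<in>UNIV. ?W j)" by (intro sum_nonneg nn)
  have 3: "?W j \<le> (\<Sum>j\<in>UNIV. ?W j)" using nn(2) by (intro member_le_sum) auto
  have "has_weak_partial j f (f' j)" by (rule has_weak_partial_classical[OF f])
  then have "has_weak_partial j f (weak_partial j f)"
    unfolding weak_partial_def by (rule someI[of "has_weak_partial j f"])
  then have [measurable]: "weak_partial j f \<in> borel_measurable borel"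
    using locally_integrable_measurable by (auto simp: has_weak_partial_def)
  have [measurable]: "f' j \<in> borel_measurable borel" by (rule borel_measurable_continuous_onI[OF f(3)])
  have "?W j = (LINT x|lborel. (f' j x)\<^sup>2)"
  proof (rule integral_cong_AE)
    show "AE x in lborel. (weak_partial j f x)\<^sup>2 = (f' j x)\<^sup>2"
      using weak_partial_classical[OF f(1)[of j] f(2) f(3)[of j]] by eventually_elim simp
  qed auto
  then show "(LINT x|lborel. (f x)\<^sup>2) \<le> 1" "(LINT x|lborel. (f' j x)\<^sup>2) \<le> 1"
    using 1 2 3 nn by linarith+
qed

text \<open>v is itself an admissible divergence-free field, so f - v is orthogonal to v. Young's
  inequality for the product of f and v then lets half of the squared norm of v be absorbed.\<close>

lemma leray_projection_integrable:
  assumes "leray_projection f v"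
  shows "integrable lborel (\<lambda>x. (norm (v x))\<^sup>2)" "(LINT x|lborel. (norm (v x))\<^sup>2) \<le> (LINT x|lborel. (norm (f x))\<^sup>2)"
proof -
  have f: "f \<in> borel_measurable borel" "integrable lborel (\<lambda>x. (norm (f x))\<^sup>2)"
    and v: "v \<in> borel_measurable borel" "integrable lborel (\<lambda>x. (norm (v x))\<^sup>2)"
    and z: "(LINT x|lborel. (f x - v x) \<bullet> v x) = 0"
    using assms by (auto simp: leray_projection_def in_L2_def)
  note [measurable] = f(1) v(1)
  show "integrable lborel (\<lambda>x. (norm (v x))\<^sup>2)" by (rule v(2))
  have le: "f x \<bullet> v x \<le> 1/2 * (norm (f x))\<^sup>2 + 1/2 * (norm (v x))\<^sup>2" "\<bar>f x \<bullet> v x\<bar> \<le> (norm (f x))\<^sup>2 + (norm (v x))\<^sup>2" for x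
  proof -
    have 1: "\<bar>f x \<bullet> v x\<bar> \<le> norm (f x) * norm (v x)" by (rule Cauchy_Schwarz_ineq2)
    have 2: "2 * (norm (f x) * norm (v x)) \<le> (norm (f x))\<^sup>2 + (norm (v x))\<^sup>2"
      using zero_le_power2[of "norm (f x) - norm (v x)"] by (simp add: power2_diff)
    show "f x \<bullet> v x \<le> 1/2 * (norm (f x))\<^sup>2 + 1/2 * (norm (v x))\<^sup>2" using 1 2 by linarith
    show "\<bar>f x \<bullet> v x\<bar> \<le> (norm (f x))\<^sup>2 + (norm (v x))\<^sup>2"
      using 1 2 zero_le_power2[of "norm (f x)"] zero_le_power2[of "norm (v x)"] by linarith
  qed
  have i: "integrable lborel (\<lambda>x. f x \<bullet> v x)"
  proof (rule Bochner_Integration.integrable_bound)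
    show "integrable lborel (\<lambda>x. (norm (f x))\<^sup>2 + (norm (v x))\<^sup>2)" using f v by simp
  qed (use le(2) in auto)
  have "(LINT x|lborel. (norm (v x))\<^sup>2) = (LINT x|lborel. f x \<bullet> v x)"
    using z i v(2) by (simp add: inner_diff_left dot_square_norm)
  also have "\<dots> \<le> (LINT x|lborel. 1/2 * (norm (f x))\<^sup>2 + 1/2 * (norm (v x))\<^sup>2)"
    using i f v le(1) by (intro integral_mono) auto
  also have "\<dots> = 1/2 * (LINT x|lborel. (norm (f x))\<^sup>2) + 1/2 * (LINT x|lborel. (norm (v x))\<^sup>2)"
    using f v by simp
  finally show "(LINT x|lborel. (norm (v x))\<^sup>2) \<le> (LINT x|lborel. (norm (f x))\<^sup>2)" by simp
qed

lemma sum_square_le_card: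
  fixes f :: "'i \<Rightarrow> real"
  assumes "finite I"
  shows "(\<Sum>i\<in>I. f i)\<^sup>2 \<le> card I * (\<Sum>i\<in>I. (f i)\<^sup>2)"
  using sum_squared_le_sum_of_squares[of f I] by (simp add: mult.commute)

section \<open>Norm bounds for the Nernst-Planck-Darcy system\<close>

locale npd =
  fixes N :: nat and D \<zeta> :: real and z :: "nat \<Rightarrow> real"
    and c :: "nat \<Rightarrow> real \<Rightarrow> real^3 \<Rightarrow> real"
    and u :: "real \<Rightarrow> real^3 \<Rightarrow> real^3"
    and p \<phi> :: "real \<Rightarrow> real^3 \<Rightarrow> real"
  assumes D: "D > 0" and z: "\<And>i. i \<in> {1..N} \<Longrightarrow> \<bar>z i\<bar> = \<zeta>" and sol: "npd_solution N D z c u p \<phi>"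
begin

abbreviation \<rho> :: "real \<Rightarrow> real^3 \<Rightarrow> real" where "\<rho> \<equiv> charge_density N z c"

text \<open>One notion serves three purposes: the charge density (weights \<open>z\<close>), a
  single concentration (weight 1 on a singleton) and the total concentration of all species of equal
  valence (weight 1).\<close>

definition comb :: "(nat \<Rightarrow> real) \<Rightarrow> nat set \<Rightarrow> real \<Rightarrow> real^3 \<Rightarrow> real" where
  "comb k I t x = (\<Sum>i\<in>I. k i * c i t x)"

definition comb_t :: "(nat \<Rightarrow> real) \<Rightarrow> nat set \<Rightarrow> real \<Rightarrow> real^3 \<Rightarrow> real" where
  "comb_t k I t x = (\<Sum>i\<in>I. k i * deriv (\<lambda>s. c i s x) t)"

definition comb_d :: "(nat \<Rightarrow> real) \<Rightarrow> nat set \<Rightarrow> 3 \<Rightarrow> real \<Rightarrow> real^3 \<Rightarrow> real" where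
  "comb_d k I j t x = (\<Sum>i\<in>I. k i * partial j (c i t) x)"

definition comb_dd :: "(nat \<Rightarrow> real) \<Rightarrow> nat set \<Rightarrow> 3 \<Rightarrow> real \<Rightarrow> real^3 \<Rightarrow> real" where
  "comb_dd k I j t x = (\<Sum>i\<in>I. k i * partial j (partial j (c i t)) x)"

lemma rho_eq: "\<rho> = comb z {1..N}"
  by (rule ext)+ (simp add: charge_density_def comb_def)

lemma smooth:
  "i \<in> {1..N} \<Longrightarrow> smooth_on spacetime (\<lambda>(t, x). c i t x)"
  "smooth_on spacetime (\<lambda>(t, x). \<phi> t x)"
  "smooth_on spacetime (\<lambda>(t, x). u t x $ j)"
proof -
  show "i \<in> {1..N} \<Longrightarrow> smooth_on spacetime (\<lambda>(t, x). c i t x)" "smooth_on spacetime (\<lambda>(t, x). \<phi> t x)"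
    using sol by (auto simp: npd_solution_def)
  have "smooth_on spacetime (\<lambda>(t, x). u t x)" using sol by (auto simp: npd_solution_def)
  from smooth_on_vec_nth[OF open_spacetime this, of j]
  show "smooth_on spacetime (\<lambda>(t, x). u t x $ j)" by (simp add: case_prod_beta')
qed

lemma continuous_fst_snd:
  "smooth_on spacetime (\<lambda>(t, x). f t x) \<Longrightarrow> continuous_on spacetime (\<lambda>p. f (fst p) (snd p))"
  by (drule smooth_on_continuous_on) (simp add: case_prod_beta')

lemma c_integrable:
  assumes "i \<in> {1..N}" "t \<ge> 0"
  shows "sobolev 1 (c i t)" "integrable lborel (c i t)"
    "((\<lambda>s. H1_norm (\<lambda>x. c i s x - c i t x)) \<longlongrightarrow> 0) (at t within {0..})"
    "((\<lambda>s. LINT x|lborel. \<bar>c i s x - c i t x\<bar>) \<longlongrightarrow> 0) (at t within {0..})"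
  using sol assms by (auto simp: npd_solution_def)

lemma pde_c:
  assumes i: "i \<in> {1..N}" and t: "t > 0"
  shows "deriv (\<lambda>s. c i s x) t = - (\<Sum>j\<in>UNIV. u t x $ j * partial j (c i t) x)
    + D * (\<Sum>j\<in>UNIV. partial j (partial j (c i t)) x)
    + z i * D * (\<Sum>j\<in>UNIV. partial j (c i t) x * partial j (\<phi> t) x + c i t x * partial j (partial j (\<phi> t)) x)"
proof -
  have "deriv (\<lambda>s. c i s x) t + u t x \<bullet> grad (c i t) x - D * laplacian (c i t) x
          - z i * D * divergence (\<lambda>y. c i t y *\<^sub>R grad (\<phi> t) y) x = 0"
    using sol i t by (simp add: npd_solution_def)
  moreover have "divergence (\<lambda>y. c i t y *\<^sub>R grad (\<phi> t) y) x
    = (\<Sum>j\<in>UNIV. partial j (c i t) x * partial j (\<phi> t) x + c i t x * partial j (partial j (\<phi> t)) x)"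
  proof -
    have "partial j (\<lambda>y. c i t y * partial j (\<phi> t) y) x
        = partial j (c i t) x * partial j (\<phi> t) x + c i t x * partial j (partial j (\<phi> t)) x" for j
    proof (rule has_partial_partial_eq)
      show "(\<lambda>y. c i t y * partial j (\<phi> t) y) differentiable at x"
        by (intro differentiable_mult smooth_slice_differentiable[OF smooth(1)[OF i] t]
            smooth_slice_differentiable[OF smooth_partial[OF smooth(2)] t])
      show "has_partial j (\<lambda>y. c i t y * partial j (\<phi> t) y)
        (\<lambda>x. partial j (c i t) x * partial j (\<phi> t) x + c i t x * partial j (partial j (\<phi> t)) x)"
        by (intro has_partial_mult smooth_has_partial[OF smooth(1)[OF i] t]
            smooth_has_partial[OF smooth_partial[OF smooth(2)] t])
    qed
    then show ?thesis by (simp add: divergence_def grad_def)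
  qed
  ultimately show ?thesis by (simp add: inner_grad smooth_slice_laplacian)
qed

text \<open>With u and \<phi> regarded as given the equations are linear, and the drift coefficient
  is common to all species in I; hence any weighted sum over I solves the same equation.\<close>

lemma comb_drift_diffusion:
  assumes I: "I \<subseteq> {1..N}" and a: "\<And>i. i \<in> I \<Longrightarrow> z i = a"
  shows "drift_diffusion D a (comb k I) (comb_t k I) \<rho> (comb_d k I) (comb_dd k I)
    (\<lambda>j t x. u t x $ j) (\<lambda>j t. partial j (\<lambda>y. u t y $ j)) (\<lambda>j t. partial j (\<phi> t)) (\<lambda>j t. partial j (partial j (\<phi> t)))"
proof
  note sm = smooth(1)[OF subsetD[OF I]]
  show "((\<lambda>s. comb k I s x) has_real_derivative comb_t k I t x) (at t)" if "t > 0" for t x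
    unfolding comb_def comb_t_def by (intro DERIV_sum DERIV_cmult smooth_has_deriv sm that)
  show "has_partial j (comb k I t) (comb_d k I j t)" if "t > 0" for t j
    unfolding comb_def[abs_def] comb_d_def[abs_def]
    by (intro has_partial_sum has_partial_cmult smooth_has_partial sm that)
  show "has_partial j (comb_d k I j t) (comb_dd k I j t)" if "t > 0" for t j
    unfolding comb_dd_def[abs_def] comb_d_def[abs_def]
    by (intro has_partial_sum has_partial_cmult smooth_has_partial[where f="\<lambda>t. partial j (c i t)" for i] smooth_partial sm that)
  show "has_partial j (\<lambda>x. u t x $ j) (partial j (\<lambda>y. u t y $ j))" if "t > 0" for t j
    by (intro smooth_has_partial[where f="\<lambda>t y. u t y $ j"] smooth that)
  show "has_partial j (partial j (\<phi> t)) (partial j (partial j (\<phi> t)))" if "t > 0" for t j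
    by (intro smooth_has_partial[where f="\<lambda>t. partial j (\<phi> t)"] smooth_partial smooth that)
  show "continuous_on spacetime (\<lambda>p. comb k I (fst p) (snd p))"
    unfolding comb_def by (intro continuous_on_sum continuous_on_mult continuous_on_const continuous_fst_snd sm)
  show "continuous_on spacetime (\<lambda>p. comb_t k I (fst p) (snd p))"
    unfolding comb_t_def by (intro continuous_on_sum continuous_on_mult continuous_on_const
        continuous_fst_snd[where f="\<lambda>t x. deriv (\<lambda>s. c i s x) t" for i] smooth_deriv sm)
  show "continuous_on spacetime (\<lambda>p. comb_d k I j (fst p) (snd p))" for j
    unfolding comb_d_def by (intro continuous_on_sum continuous_on_mult continuous_on_const
        continuous_fst_snd[where f="\<lambda>t. partial j (c i t)" for i] smooth_partial sm)
  show "continuous_on spacetime (\<lambda>p. comb_dd k I j (fst p) (snd p))" for j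
    unfolding comb_dd_def by (intro continuous_on_sum continuous_on_mult continuous_on_const
        continuous_fst_snd[where f="\<lambda>t. partial j (partial j (c i t))" for i] smooth_partial sm)
  show "continuous_on spacetime (\<lambda>p. u (fst p) (snd p) $ j)" for j
    by (intro continuous_fst_snd[where f="\<lambda>t x. u t x $ j"] smooth)
  show "continuous_on spacetime (\<lambda>p. partial j (\<lambda>y. u (fst p) y $ j) (snd p))" for j
    by (intro continuous_fst_snd[where f="\<lambda>t. partial j (\<lambda>y. u t y $ j)"] smooth_partial smooth)
  show "continuous_on spacetime (\<lambda>p. partial j (\<phi> (fst p)) (snd p))" for j
    by (intro continuous_fst_snd[where f="\<lambda>t. partial j (\<phi> t)"] smooth_partial smooth)
  show "continuous_on spacetime (\<lambda>p. partial j (partial j (\<phi> (fst p))) (snd p))" for j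
    by (intro continuous_fst_snd[where f="\<lambda>t. partial j (partial j (\<phi> t))"] smooth_partial smooth)
  show "continuous_on spacetime (\<lambda>p. \<rho> (fst p) (snd p))"
    unfolding charge_density_def by (intro continuous_on_sum continuous_on_mult continuous_on_const continuous_fst_snd smooth)
  show "(\<Sum>j\<in>UNIV. partial j (\<lambda>y. u t y $ j) x) = 0" if "t > 0" for t x
    using sol that by (simp add: npd_solution_def divergence_def)
  show "(\<Sum>j\<in>UNIV. partial j (partial j (\<phi> t)) x) = - \<rho> t x" if "t > 0" for t x
  proof -
    have "- laplacian (\<phi> t) x = \<rho> t x" using sol that unfolding npd_solution_def by blast
    then show ?thesis by (simp add: smooth_slice_laplacian)
  qed
  show "comb_t k I t x = - (\<Sum>j\<in>UNIV. u t x $ j * comb_d k I j t x) + D * (\<Sum>j\<in>UNIV. comb_dd k I j t x)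
      + a * D * (\<Sum>j\<in>UNIV. comb_d k I j t x * partial j (\<phi> t) x + comb k I t x * partial j (partial j (\<phi> t)) x)"
    if "t > 0" for t x
  proof -
    have "comb_t k I t x = (\<Sum>i\<in>I. k i * (- (\<Sum>j\<in>UNIV. u t x $ j * partial j (c i t) x)
        + D * (\<Sum>j\<in>UNIV. partial j (partial j (c i t)) x)
        + a * D * (\<Sum>j\<in>UNIV. partial j (c i t) x * partial j (\<phi> t) x + c i t x * partial j (partial j (\<phi> t)) x)))"
      unfolding comb_t_def
    proof (rule sum.cong[OF refl])
      fix i assume i: "i \<in> I"
      show "k i * deriv (\<lambda>s. c i s x) t = k i * (- (\<Sum>j\<in>UNIV. u t x $ j * partial j (c i t) x)
        + D * (\<Sum>j\<in>UNIV. partial j (partial j (c i t)) x)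
        + a * D * (\<Sum>j\<in>UNIV. partial j (c i t) x * partial j (\<phi> t) x + c i t x * partial j (partial j (\<phi> t)) x))"
        using pde_c[OF subsetD[OF I i] that] a[OF i] by simp
    qed
    also have "\<dots> = - (\<Sum>j\<in>UNIV. u t x $ j * comb_d k I j t x) + D * (\<Sum>j\<in>UNIV. comb_dd k I j t x)
      + a * D * (\<Sum>j\<in>UNIV. comb_d k I j t x * partial j (\<phi> t) x + comb k I t x * partial j (partial j (\<phi> t)) x)"
      unfolding comb_def comb_d_def comb_dd_def sum_3
      by (induction I rule: infinite_finite_induct) (simp_all add: algebra_simps)
    finally show ?thesis .
  qed
qed

lemma c_square_integrable:
  assumes "i \<in> {1..N}" "t \<ge> 0"
  shows "c i t \<in> borel_measurable borel" "integrable lborel (\<lambda>x. (c i t x)\<^sup>2)"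
  using c_integrable(1)[OF assms] unfolding One_nat_def by (auto simp: in_L2_def)

lemma c_slice:
  assumes "i \<in> {1..N}" "t > 0"
  shows "has_partial j (c i t) (partial j (c i t))" "continuous_on UNIV (c i t)"
    "continuous_on UNIV (partial j (c i t))" "integrable lborel (\<lambda>x. (partial j (c i t) x)\<^sup>2)"
proof -
  show p: "has_partial j (c i t) (partial j (c i t))"
    by (rule smooth_has_partial[OF smooth(1)[OF assms(1)] assms(2)])
  show c: "continuous_on UNIV (c i t)"
    by (rule smooth_continuous_slice[OF smooth_on_continuous_on[OF smooth(1)[OF assms(1)]] assms(2)])
  show c': "continuous_on UNIV (partial j (c i t))"
    by (rule smooth_continuous_slice[where f="\<lambda>t. partial j (c i t)",
          OF smooth_on_continuous_on[OF smooth_partial[OF smooth(1)[OF assms(1)]]] assms(2)])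
  show "integrable lborel (\<lambda>x. (partial j (c i t) x)\<^sup>2)"
    using sobolev_classical[OF c_integrable(1)[OF assms(1)] p c c'] assms(2) by (simp add: in_L2_def)
qed

text \<open>Once the state is within H^1 and L^1 distance 1 of the state at time t, all its norms
  are controlled by those at time t.\<close>

lemma c_locally_bounded:
  assumes i: "i \<in> {1..N}" and t: "t > 0"
  shows "\<exists>B. eventually (\<lambda>s. (LINT x|lborel. \<bar>c i s x\<bar>) + (LINT x|lborel. (c i s x)\<^sup>2)
      + (\<Sum>j\<in>UNIV. LINT x|lborel. (partial j (c i s) x)\<^sup>2) \<le> B) (at t within {0..})"
proof -
  have "eventually (\<lambda>s. H1_norm (\<lambda>x. c i s x - c i t x) < 1) (at t within {0..})"
    "eventually (\<lambda>s. (LINT x|lborel. \<bar>c i s x - c i t x\<bar>) < 1) (at t within {0..})"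
    using order_tendstoD(2)[OF c_integrable(3)[OF i]] order_tendstoD(2)[OF c_integrable(4)[OF i]] t by auto
  moreover have "eventually (\<lambda>s. s > 0) (at t within {0..})"
    using t eventually_nhds_in_open[of "{0<..}" t] by (auto simp: eventually_at_filter elim: eventually_mono)
  ultimately have "eventually (\<lambda>s. (LINT x|lborel. \<bar>c i s x\<bar>) + (LINT x|lborel. (c i s x)\<^sup>2)
      + (\<Sum>j\<in>UNIV. LINT x|lborel. (partial j (c i s) x)\<^sup>2)
      \<le> (1 + (LINT x|lborel. \<bar>c i t x\<bar>)) + (2 * 1 + 2 * (LINT x|lborel. (c i t x)\<^sup>2))
      + (\<Sum>j\<in>UNIV. 2 * 1 + 2 * (LINT x|lborel. (partial j (c i t) x)\<^sup>2))) (at t within {0..})"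
  proof eventually_elim
    case (elim s)
    have m: "f \<in> borel_measurable lborel" if "continuous_on UNIV f" for f :: "real^3 \<Rightarrow> real"
      using borel_measurable_continuous_onI[OF that] by simp
    have "H1_norm (\<lambda>x. c i s x - c i t x) \<le> 1" using elim by simp
    note H = H1_norm_bounds[OF has_partial_diff[OF c_slice(1)[OF i] c_slice(1)[OF i]]
        continuous_on_diff[OF c_slice(2)[OF i] c_slice(2)[OF i]]
        continuous_on_diff[OF c_slice(3)[OF i] c_slice(3)[OF i]] this, OF elim(3) t elim(3) t elim(3) t]
    have "(LINT x|lborel. \<bar>c i s x\<bar>) \<le> (LINT x|lborel. \<bar>c i s x - c i t x\<bar> + \<bar>c i t x\<bar>)"
      using c_integrable(2)[OF i] elim(3) t by (intro integral_mono) auto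
    also have "\<dots> = (LINT x|lborel. \<bar>c i s x - c i t x\<bar>) + (LINT x|lborel. \<bar>c i t x\<bar>)"
      using c_integrable(2)[OF i] elim(3) t by (intro Bochner_Integration.integral_add) auto
    finally have 1: "(LINT x|lborel. \<bar>c i s x\<bar>) \<le> 1 + (LINT x|lborel. \<bar>c i t x\<bar>)" using elim(2) by simp
    have 2: "(LINT x|lborel. (c i s x)\<^sup>2) \<le> 2 * 1 + 2 * (LINT x|lborel. (c i t x)\<^sup>2)"
      using integral_square_le_diff[OF m[OF c_slice(2)[OF i elim(3)]] m[OF c_slice(2)[OF i t]]]
        c_square_integrable(2)[OF i] H(1) elim(3) t by force
    have 3: "(LINT x|lborel. (partial j (c i s) x)\<^sup>2) \<le> 2 * 1 + 2 * (LINT x|lborel. (partial j (c i t) x)\<^sup>2)" for j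
      using integral_square_le_diff[OF m[OF c_slice(3)[OF i elim(3), of j]] m[OF c_slice(3)[OF i t, of j]]
        c_slice(4)[OF i elim(3), of j] c_slice(4)[OF i t, of j]] H(2)[of j] by linarith
    show ?case by (intro add_mono sum_mono 1 2 3)
  qed
  then show ?thesis by blast
qed

lemma c_bounded:
  assumes i: "i \<in> {1..N}" and s: "s > 0"
  shows "\<exists>B. \<forall>t\<in>{s..T}. (LINT x|lborel. \<bar>c i t x\<bar>) \<le> B \<and> (LINT x|lborel. (c i t x)\<^sup>2) \<le> B
      \<and> (\<forall>j. (LINT x|lborel. (partial j (c i t) x)\<^sup>2) \<le> B)"
proof -
  obtain B where B: "\<And>t. t \<in> {s..T} \<Longrightarrow> (LINT x|lborel. \<bar>c i t x\<bar>) + (LINT x|lborel. (c i t x)\<^sup>2)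
      + (\<Sum>j\<in>UNIV. LINT x|lborel. (partial j (c i t) x)\<^sup>2) \<le> B"
    using locally_bounded_imp_bounded[OF c_locally_bounded[OF i] s, where T=T] by blast
  have "(LINT x|lborel. \<bar>c i t x\<bar>) \<le> B \<and> (LINT x|lborel. (c i t x)\<^sup>2) \<le> B
      \<and> (\<forall>j. (LINT x|lborel. (partial j (c i t) x)\<^sup>2) \<le> B)" if "t \<in> {s..T}" for t
  proof -
    let ?P = "\<lambda>j. LINT x|lborel. (partial j (c i t) x)\<^sup>2"
    have a: "0 \<le> (LINT x|lborel. \<bar>c i t x\<bar>)" "0 \<le> (LINT x|lborel. (c i t x)\<^sup>2)" "\<And>j. 0 \<le> ?P j" by simp_all
    have b: "?P j \<le> (\<Sum>j\<in>UNIV. ?P j)" for j using a(3) by (intro member_le_sum) auto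
    have c: "0 \<le> (\<Sum>j\<in>UNIV. ?P j)" by (intro sum_nonneg a)
    have "?P j \<le> B" for j using b[of j] a(1,2) B[OF that] by linarith
    moreover have "(LINT x|lborel. \<bar>c i t x\<bar>) \<le> B" "(LINT x|lborel. (c i t x)\<^sup>2) \<le> B"
      using a(1,2) c B[OF that] by linarith+
    ultimately show ?thesis by blast
  qed
  then show ?thesis by blast
qed

lemma comb_integrable:
  assumes I: "I \<subseteq> {1..N}" and t: "t \<ge> 0"
  shows "integrable lborel (comb k I t)" "integrable lborel (\<lambda>x. (comb k I t x)\<^sup>2)"
    "t > 0 \<Longrightarrow> integrable lborel (\<lambda>x. (comb_d k I j t x)\<^sup>2)"
proof -
  have fin: "finite I" using I finite_subset by blast
  have sq: "integrable lborel (\<lambda>x. (\<Sum>i\<in>I. k i * f i x)\<^sup>2)"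
    if f: "\<And>i. i \<in> I \<Longrightarrow> f i \<in> borel_measurable borel" "\<And>i. i \<in> I \<Longrightarrow> integrable lborel (\<lambda>x. (f i x)\<^sup>2)"
    for f :: "nat \<Rightarrow> real^3 \<Rightarrow> real"
  proof -
    have "(\<lambda>x. (\<Sum>i\<in>I. k i * f i x)\<^sup>2) = (\<lambda>x. \<Sum>i\<in>I. \<Sum>j\<in>I. (k i * k j) * (f i x * f j x))"
      by (simp add: power2_eq_square sum_product algebra_simps)
    moreover have "integrable lborel (\<lambda>x. f i x * f j x)" if "i \<in> I" "j \<in> I" for i j
      using f that by (intro integrable_square_imp_product) auto
    ultimately show ?thesis
      by (auto intro!: Bochner_Integration.integrable_sum integrable_mult_right)
  qed
  show "integrable lborel (comb k I t)"
    unfolding comb_def[abs_def] using c_integrable(2) I t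
    by (intro Bochner_Integration.integrable_sum integrable_mult_right) auto
  show "integrable lborel (\<lambda>x. (comb k I t x)\<^sup>2)"
    unfolding comb_def using c_square_integrable I t by (intro sq) auto
  show "integrable lborel (\<lambda>x. (comb_d k I j t x)\<^sup>2)" if "t > 0"
    unfolding comb_d_def using c_slice(3,4) I that
    by (intro sq) (auto intro!: borel_measurable_continuous_onI)
qed

lemma comb_bounded:
  assumes I: "I \<subseteq> {1..N}" and s: "s > 0"
  shows "\<exists>B\<ge>0. \<forall>t\<in>{s..T}. (LINT x|lborel. \<bar>comb k I t x\<bar>) \<le> B \<and> (LINT x|lborel. (comb k I t x)\<^sup>2) \<le> B
      \<and> (\<forall>j. (LINT x|lborel. (comb_d k I j t x)\<^sup>2) \<le> B)"
proof -
  have fin: "finite I" using I finite_subset by blast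
  obtain B where B: "\<And>i t. i \<in> I \<Longrightarrow> t \<in> {s..T} \<Longrightarrow> (LINT x|lborel. \<bar>c i t x\<bar>) \<le> B i \<and> (LINT x|lborel. (c i t x)\<^sup>2) \<le> B i
      \<and> (\<forall>j. (LINT x|lborel. (partial j (c i t) x)\<^sup>2) \<le> B i)"
    using c_bounded[OF subsetD[OF I] s, where T=T] by metis
  let ?B1 = "\<Sum>i\<in>I. \<bar>k i\<bar> * \<bar>B i\<bar>" and ?B2 = "card I * (\<Sum>i\<in>I. (k i)\<^sup>2 * \<bar>B i\<bar>)"
  have sq: "(LINT x|lborel. (\<Sum>i\<in>I. k i * f i x)\<^sup>2) \<le> ?B2"
    if f: "\<And>i. i \<in> I \<Longrightarrow> integrable lborel (\<lambda>x. (f i x)\<^sup>2)" "\<And>i. i \<in> I \<Longrightarrow> (LINT x|lborel. (f i x)\<^sup>2) \<le> B i"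
     "integrable lborel (\<lambda>x. (\<Sum>i\<in>I. k i * f i x)\<^sup>2)"
    for f :: "nat \<Rightarrow> real^3 \<Rightarrow> real"
  proof -
    have "(LINT x|lborel. (\<Sum>i\<in>I. k i * f i x)\<^sup>2) \<le> (LINT x|lborel. card I * (\<Sum>i\<in>I. (k i)\<^sup>2 * (f i x)\<^sup>2))"
      using sum_square_le_card[OF fin, of "\<lambda>i. k i * f i x" for x] f
      by (intro integral_mono integrable_mult_right Bochner_Integration.integrable_sum) (auto simp: power_mult_distrib)
    also have "\<dots> = card I * (\<Sum>i\<in>I. (k i)\<^sup>2 * (LINT x|lborel. (f i x)\<^sup>2))"
      using f by (simp add: Bochner_Integration.integral_sum)
    also have "\<dots> \<le> ?B2"
    proof (intro mult_left_mono sum_mono)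
      show "(LINT x|lborel. (f i x)\<^sup>2) \<le> \<bar>B i\<bar>" if "i \<in> I" for i using f(2)[OF that] by linarith
    qed auto
    finally show ?thesis .
  qed
  have "(LINT x|lborel. \<bar>comb k I t x\<bar>) \<le> ?B1 \<and> (LINT x|lborel. (comb k I t x)\<^sup>2) \<le> ?B2
      \<and> (\<forall>j. (LINT x|lborel. (comb_d k I j t x)\<^sup>2) \<le> ?B2)" if t: "t \<in> {s..T}" for t
  proof (intro conjI allI)
    have t0: "t > 0" "t \<ge> 0" using t s by auto
    have ic: "integrable lborel (\<lambda>x. \<bar>c i t x\<bar>)" if "i \<in> I" for i
      using c_integrable(2) I that t0 by (intro integrable_abs) auto
    have "(LINT x|lborel. \<bar>comb k I t x\<bar>) \<le> (LINT x|lborel. (\<Sum>i\<in>I. \<bar>k i\<bar> * \<bar>c i t x\<bar>))"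
    proof (rule integral_mono)
      show "integrable lborel (\<lambda>x. \<bar>comb k I t x\<bar>)" by (intro integrable_abs comb_integrable I t0)
      show "\<bar>comb k I t x\<bar> \<le> (\<Sum>i\<in>I. \<bar>k i\<bar> * \<bar>c i t x\<bar>)" for x
        unfolding comb_def abs_mult[symmetric] by (rule sum_abs)
    qed (intro Bochner_Integration.integrable_sum integrable_mult_right ic)
    also have "\<dots> = (\<Sum>i\<in>I. \<bar>k i\<bar> * (LINT x|lborel. \<bar>c i t x\<bar>))"
      using ic by (simp add: Bochner_Integration.integral_sum)
    also have "\<dots> \<le> ?B1"
    proof (intro sum_mono mult_left_mono)
      show "(LINT x|lborel. \<bar>c i t x\<bar>) \<le> \<bar>B i\<bar>" if "i \<in> I" for i using B[OF that t] by linarith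
    qed auto
    finally show "(LINT x|lborel. \<bar>comb k I t x\<bar>) \<le> ?B1" .
    show "(LINT x|lborel. (comb k I t x)\<^sup>2) \<le> ?B2"
      using sq[of "\<lambda>i. c i t"] c_square_integrable(2) B t comb_integrable(2)[OF I t0(2), of k] I t0
      unfolding comb_def by blast
    show "(LINT x|lborel. (comb_d k I j t x)\<^sup>2) \<le> ?B2" for j
      using sq[of "\<lambda>i. partial j (c i t)"] c_slice(4) B t comb_integrable(3)[OF I t0(2) t0(1), of k j] I t0
      unfolding comb_d_def by blast
  qed
  note b = this
  show ?thesis
  proof (intro exI[of _ "?B1 + ?B2"] conjI ballI)
    have "0 \<le> ?B1" "0 \<le> ?B2" by (intro sum_nonneg mult_nonneg_nonneg; simp)+
    then show "0 \<le> ?B1 + ?B2" by linarith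
    fix t assume "t \<in> {s..T}"
    note b[OF this] \<open>0 \<le> ?B1\<close> \<open>0 \<le> ?B2\<close>
    then show "(LINT x|lborel. \<bar>comb k I t x\<bar>) \<le> ?B1 + ?B2" "(LINT x|lborel. (comb k I t x)\<^sup>2) \<le> ?B1 + ?B2"
      "\<forall>j. (LINT x|lborel. (comb_d k I j t x)\<^sup>2) \<le> ?B1 + ?B2" by (auto intro: add_increasing add_increasing2)
  qed
qed

lemma comb_slice:
  assumes I: "I \<subseteq> {1..N}" and t: "t > 0"
  shows "has_partial j (comb k I t) (comb_d k I j t)" "continuous_on UNIV (comb k I t)" "continuous_on UNIV (comb_d k I j t)"
  unfolding comb_def[abs_def] comb_d_def[abs_def] using I t
  by (intro has_partial_sum has_partial_cmult continuous_on_sum continuous_on_mult continuous_on_const c_slice; auto)+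

text \<open>\<open>riesz_bound\<close> applied to the charge density: the three gradient components
  contribute 4 * 3 B and the L^1 norm one more B, whence 13 B.\<close>

lemma potential_gradient_le:
  assumes t: "t > 0" and B: "(LINT x|lborel. \<bar>\<rho> t x\<bar>) \<le> B" "\<And>j. (LINT x|lborel. (comb_d z {1..N} j t x)\<^sup>2) \<le> B"
  shows "\<bar>partial j (\<phi> t) x\<bar> \<le> 13 * B + riesz_const"
proof -
  note sl = comb_slice[OF subset_refl t, where k=z] and i = comb_integrable[OF subset_refl less_imp_le[OF t], where k=z]
  have r: "integrable lborel (\<lambda>y. \<bar>\<rho> t y\<bar> / (dist x y)\<^sup>2)"
    "(LINT y|lborel. \<bar>\<rho> t y\<bar> / (dist x y)\<^sup>2) \<le> 13 * B + riesz_const" for x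
  proof -
    note R = riesz_bound[where f="comb z {1..N} t" and f'="\<lambda>j. comb_d z {1..N} j t", OF sl(1) sl(2) sl(3) i(2) i(3)[OF t] integrable_abs[OF i(1)]]
    show "integrable lborel (\<lambda>y. \<bar>\<rho> t y\<bar> / (dist x y)\<^sup>2)" unfolding rho_eq by (rule R(1))
    have "(LINT y|lborel. (\<Sum>j\<in>UNIV. (comb_d z {1..N} j t y)\<^sup>2)) = (\<Sum>j\<in>UNIV. LINT y|lborel. (comb_d z {1..N} j t y)\<^sup>2)"
      using i(3)[OF t] by (simp add: Bochner_Integration.integral_sum)
    also have "\<dots> \<le> (\<Sum>j\<in>(UNIV :: 3 set). B)" by (intro sum_mono B)
    finally show "(LINT y|lborel. \<bar>\<rho> t y\<bar> / (dist x y)\<^sup>2) \<le> 13 * B + riesz_const"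
      using R(2)[of x] B(1) unfolding rho_eq by simp
  qed
  have "\<phi> t = newtonian_potential (\<rho> t)" using sol t by (simp add: npd_solution_def)
  moreover have "\<bar>newtonian_potential (\<rho> t) x - newtonian_potential (\<rho> t) x'\<bar> \<le> (13 * B + riesz_const) * dist x x'" for x x'
    by (rule newtonian_potential_lipschitz[OF _ _ r])
      (use i(1) borel_measurable_continuous_onI[OF sl(2)] in \<open>simp_all add: rho_eq\<close>)
  ultimately have "\<And>x x'. \<bar>\<phi> t x - \<phi> t x'\<bar> \<le> (13 * B + riesz_const) * dist x x'" by simp
  with smooth_has_partial[OF smooth(2) t] show ?thesis by (rule has_partial_le_lipschitz)
qed

text \<open>Up to sign u is the Leray projection of \<rho> grad \<phi>, hence no larger in L^2; the
  squared gradient is at most 3 C^2.\<close>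

lemma velocity_integral_le:
  assumes t: "t > 0" and B: "(LINT x|lborel. (\<rho> t x)\<^sup>2) \<le> B" "\<And>j x. \<bar>partial j (\<phi> t) x\<bar> \<le> C"
  shows "integrable lborel (\<lambda>x. (u t x $ j)\<^sup>2)" "(LINT x|lborel. (u t x $ j)\<^sup>2) \<le> 3 * C\<^sup>2 * B"
proof -
  have "leray_projection (\<lambda>x. \<rho> t x *\<^sub>R grad (\<phi> t) x) (\<lambda>x. - u t x)"
    using sol t unfolding npd_solution_def by blast
  note L = leray_projection_integrable[OF this]
  have iL: "integrable lborel (\<lambda>x. (norm (\<rho> t x *\<^sub>R grad (\<phi> t) x))\<^sup>2)"
    using \<open>leray_projection _ _\<close> by (simp add: leray_projection_def in_L2_def)
  have le: "(u t x $ j)\<^sup>2 \<le> (norm (- u t x))\<^sup>2" for x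
    using component_le_norm_cart[of "u t x" j] by (simp add: abs_le_square_iff[symmetric])
  have "continuous_on UNIV (\<lambda>x. u t x $ j)"
    by (rule smooth_continuous_slice[where f="\<lambda>t x. u t x $ j", OF smooth_on_continuous_on[OF smooth(3)] t])
  from borel_measurable_continuous_onI[OF this]
  have m [measurable]: "(\<lambda>x. u t x $ j) \<in> borel_measurable borel" .
  show i: "integrable lborel (\<lambda>x. (u t x $ j)\<^sup>2)"
    by (rule Bochner_Integration.integrable_bound[OF L(1)]) (use le in auto)
  have "(LINT x|lborel. (u t x $ j)\<^sup>2) \<le> (LINT x|lborel. (norm (- u t x))\<^sup>2)"
    by (intro integral_mono i L(1) le)
  also have "\<dots> \<le> (LINT x|lborel. (norm (\<rho> t x *\<^sub>R grad (\<phi> t) x))\<^sup>2)" by (rule L(2))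
  also have "\<dots> \<le> (LINT x|lborel. 3 * C\<^sup>2 * (\<rho> t x)\<^sup>2)"
  proof (intro integral_mono iL integrable_mult_right)
    show "integrable lborel (\<lambda>x. (\<rho> t x)\<^sup>2)"
      unfolding rho_eq by (rule comb_integrable(2)) (use t in auto)
    show "(norm (\<rho> t x *\<^sub>R grad (\<phi> t) x))\<^sup>2 \<le> 3 * C\<^sup>2 * (\<rho> t x)\<^sup>2" for x
    proof -
      have "(partial j (\<phi> t) x)\<^sup>2 \<le> C\<^sup>2" for j
        using B(2)[of j x] by (subst abs_le_square_iff[symmetric]) linarith
      then have "(\<Sum>j\<in>UNIV. (partial j (\<phi> t) x)\<^sup>2) \<le> (\<Sum>j\<in>(UNIV :: 3 set). C\<^sup>2)" by (intro sum_mono)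
      then have "(norm (grad (\<phi> t) x))\<^sup>2 \<le> 3 * C\<^sup>2" by (simp add: norm_sq_eq_sum grad_def)
      from mult_right_mono[OF this, of "(\<rho> t x)\<^sup>2"] show ?thesis
        by (simp add: power_mult_distrib mult.commute)
    qed
  qed
  also have "\<dots> \<le> 3 * C\<^sup>2 * B" using mult_left_mono[OF B(1), of "3 * C\<^sup>2"] by simp
  finally show "(LINT x|lborel. (u t x $ j)\<^sup>2) \<le> 3 * C\<^sup>2 * B" .
qed

lemma velocity_integrable:
  assumes "t > 0"
  shows "integrable lborel (\<lambda>x. (u t x $ j)\<^sup>2)"
proof -
  \<comment> \<open>Bounds at a single time are read off from the degenerate interval
    \<open>{t..t}\<close>.\<close>
  obtain B where "\<forall>t\<in>{t..t}. (LINT x|lborel. \<bar>comb z {1..N} t x\<bar>) \<le> B \<and> (LINT x|lborel. (comb z {1..N} t x)\<^sup>2) \<le> B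
      \<and> (\<forall>j. (LINT x|lborel. (comb_d z {1..N} j t x)\<^sup>2) \<le> B)"
    using comb_bounded[OF subset_refl assms, where T=t and k=z] by blast
  then have B: "(LINT x|lborel. \<bar>\<rho> t x\<bar>) \<le> B" "(LINT x|lborel. (\<rho> t x)\<^sup>2) \<le> B"
    "\<And>j. (LINT x|lborel. (comb_d z {1..N} j t x)\<^sup>2) \<le> B" by (auto simp: rho_eq)
  show ?thesis by (rule velocity_integral_le[OF assms B(2) potential_gradient_le[OF assms B(1,3)]])
qed

text \<open>K may grow with T and as s approaches 0. This is harmless, since it only multiplies
  quantities that tend to 0 with s and T fixed.\<close>

lemma uniform_bounds:
  assumes I: "I \<subseteq> {1..N}" and s: "s > 0"
  obtains K where "K \<ge> 0" "\<And>t. t \<in> {s..T} \<Longrightarrow> (LINT x|lborel. \<bar>comb k I t x\<bar>) \<le> K"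
    "\<And>t. t \<in> {s..T} \<Longrightarrow> (LINT x|lborel. (comb k I t x)\<^sup>2) \<le> K"
    "\<And>t j. t \<in> {s..T} \<Longrightarrow> (LINT x|lborel. (u t x $ j)\<^sup>2) \<le> K"
    "\<And>t j x. t \<in> {s..T} \<Longrightarrow> \<bar>partial j (\<phi> t) x\<bar> \<le> K"
    "\<And>t. t \<in> {s..T} \<Longrightarrow> (LINT x|lborel. \<bar>\<rho> t x\<bar>) \<le> K"
proof -
  obtain A where A: "A \<ge> 0" "\<And>t. t \<in> {s..T} \<Longrightarrow> (LINT x|lborel. \<bar>comb k I t x\<bar>) \<le> A"
    "\<And>t. t \<in> {s..T} \<Longrightarrow> (LINT x|lborel. (comb k I t x)\<^sup>2) \<le> A"
    using comb_bounded[OF I s, where T=T and k=k] by blast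
  obtain B where B: "B \<ge> 0" "\<And>t. t \<in> {s..T} \<Longrightarrow> (LINT x|lborel. \<bar>\<rho> t x\<bar>) \<le> B"
    "\<And>t. t \<in> {s..T} \<Longrightarrow> (LINT x|lborel. (\<rho> t x)\<^sup>2) \<le> B"
    "\<And>t j. t \<in> {s..T} \<Longrightarrow> (LINT x|lborel. (comb_d z {1..N} j t x)\<^sup>2) \<le> B"
    using comb_bounded[OF subset_refl s, where T=T and k=z] unfolding rho_eq by blast
  define C where "C = 13 * B + riesz_const"
  have C0: "C \<ge> 0" using B(1) by (simp add: C_def riesz_const_def)
  have C: "\<bar>partial j (\<phi> t) x\<bar> \<le> C" if "t \<in> {s..T}" for t j x
    unfolding C_def using that s by (intro potential_gradient_le B) auto
  have U: "(LINT x|lborel. (u t x $ j)\<^sup>2) \<le> 3 * C\<^sup>2 * B" if "t \<in> {s..T}" for t j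
    by (rule velocity_integral_le(2)[OF _ B(3)[OF that] C[OF that]]) (use that s in auto)
  have U0: "0 \<le> 3 * C\<^sup>2 * B" using B(1) by simp
  show thesis
  proof (rule that[of "A + B + C + 3 * C\<^sup>2 * B"])
    show "A + B + C + 3 * C\<^sup>2 * B \<ge> 0" using A(1) B(1) C0 U0 by linarith
  next
    fix t assume t: "t \<in> {s..T}"
    show "(LINT x|lborel. \<bar>comb k I t x\<bar>) \<le> A + B + C + 3 * C\<^sup>2 * B"
      using A(2)[OF t] B(1) C0 U0 by linarith
    show "(LINT x|lborel. (comb k I t x)\<^sup>2) \<le> A + B + C + 3 * C\<^sup>2 * B"
      using A(3)[OF t] B(1) C0 U0 by linarith
    show "(LINT x|lborel. (u t x $ j)\<^sup>2) \<le> A + B + C + 3 * C\<^sup>2 * B" for j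
      using U[OF t, of j] A(1) B(1) C0 by linarith
    show "\<bar>partial j (\<phi> t) x\<bar> \<le> A + B + C + 3 * C\<^sup>2 * B" for j x
      using C[OF t, of j x] A(1) B(1) U0 by linarith
    show "(LINT x|lborel. \<bar>\<rho> t x\<bar>) \<le> A + B + C + 3 * C\<^sup>2 * B"
      using B(2)[OF t] A(1) C0 U0 by linarith
  qed
qed

end

section \<open>Positivity and conservation of mass\<close>

text \<open>A smooth convex substitute for |y| that vanishes at 0 and stays below |y|, so the L^1
  norm dominates it uniformly in e.\<close>

definition soft_abs :: "real \<Rightarrow> real \<Rightarrow> real" where
  "soft_abs e y = sqrt (y\<^sup>2 + e\<^sup>2) - e"

lemma sqrt_square_add_pos: "e > 0 \<Longrightarrow> sqrt (y\<^sup>2 + e\<^sup>2) > 0"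
  by (simp add: add_nonneg_pos)

lemma DERIV_soft_abs:
  assumes "e > 0"
  shows "(soft_abs e has_real_derivative y / sqrt (y\<^sup>2 + e\<^sup>2)) (at y)"
proof -
  have "y\<^sup>2 + e\<^sup>2 > 0" using assms by (simp add: add_nonneg_pos)
  then show ?thesis unfolding soft_abs_def
    by (auto intro!: derivative_eq_intros simp: field_simps)
qed

lemma DERIV_soft_abs':
  assumes "e > 0"
  shows "((\<lambda>y. y / sqrt (y\<^sup>2 + e\<^sup>2)) has_real_derivative e\<^sup>2 / sqrt (y\<^sup>2 + e\<^sup>2) ^ 3) (at y)"
proof -
  let ?r = "sqrt (y\<^sup>2 + e\<^sup>2)"
  have pos: "y\<^sup>2 + e\<^sup>2 > 0" and r: "?r > 0" using assms by (simp_all add: add_nonneg_pos)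
  have s: "((\<lambda>y. sqrt (y\<^sup>2 + e\<^sup>2)) has_real_derivative y / ?r) (at y)"
    using pos by (auto intro!: derivative_eq_intros simp: field_simps)
  have "((\<lambda>y. y / sqrt (y\<^sup>2 + e\<^sup>2)) has_real_derivative (1 * ?r - y * (y / ?r)) / (?r * ?r)) (at y)"
    by (rule DERIV_divide[OF DERIV_ident s]) (use r in auto)
  moreover have "(1 * ?r - y * (y / ?r)) / (?r * ?r) = e\<^sup>2 / ?r ^ 3"
  proof -
    have rr: "?r * ?r = y\<^sup>2 + e\<^sup>2" using pos by simp
    have "1 * q - y * (y / q) = (q * q - y\<^sup>2) / q" if "q > 0" for q
      using that by (simp add: diff_divide_distrib power2_eq_square)
    from this[OF r] have "1 * ?r - y * (y / ?r) = (?r * ?r - y\<^sup>2) / ?r" .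
    also have "\<dots> = e\<^sup>2 / ?r" by (simp only: rr) simp
    finally show ?thesis by (simp add: power3_eq_cube mult.assoc)
  qed
  ultimately show ?thesis by simp
qed

text \<open>The reaction function equals e - e^2 / sqrt(y^2 + e^2) and so lies between 0 and e: the
  reaction term vanishes with e whatever the sign of the charge.\<close>

lemma soft_abs_bounds:
  assumes "e > 0"
  shows "0 \<le> soft_abs e y" "soft_abs e y \<le> \<bar>y\<bar>"
    "0 \<le> y * (y / sqrt (y\<^sup>2 + e\<^sup>2)) - soft_abs e y" "y * (y / sqrt (y\<^sup>2 + e\<^sup>2)) - soft_abs e y \<le> e"
    "y * (y / sqrt (y\<^sup>2 + e\<^sup>2)) - soft_abs e y = e - e\<^sup>2 / sqrt (y\<^sup>2 + e\<^sup>2)"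
proof -
  let ?r = "sqrt (y\<^sup>2 + e\<^sup>2)"
  have r: "?r > 0" by (rule sqrt_square_add_pos[OF assms])
  have re: "e \<le> ?r" using assms by (intro real_le_rsqrt) simp
  then show "0 \<le> soft_abs e y" by (simp add: soft_abs_def)
  have "?r \<le> \<bar>y\<bar> + e" using assms by (intro real_le_lsqrt) (auto simp: power2_sum)
  then show "soft_abs e y \<le> \<bar>y\<bar>" by (simp add: soft_abs_def)
  have "y * (y / q) = q - e\<^sup>2 / q" if "q > 0" "q * q = y\<^sup>2 + e\<^sup>2" for q
  proof -
    have "y * y = q * q - e\<^sup>2" using that(2) by (simp add: power2_eq_square)
    then have "y * (y / q) = (q * q - e\<^sup>2) / q" by simp
    then show ?thesis using that(1) by (simp add: diff_divide_distrib)
  qed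
  from this[OF r] have "y * (y / ?r) = ?r - e\<^sup>2 / ?r" by simp
  then show eq: "y * (y / ?r) - soft_abs e y = e - e\<^sup>2 / ?r" by (simp add: soft_abs_def)
  have "e\<^sup>2 / ?r \<le> e\<^sup>2 / e" using re assms by (intro divide_left_mono) (auto intro: mult_pos_pos r)
  then have "e\<^sup>2 / ?r \<le> e" using assms by (simp add: power2_eq_square)
  moreover have "0 \<le> e\<^sup>2 / ?r" using r by simp
  ultimately show "0 \<le> y * (y / ?r) - soft_abs e y" "y * (y / ?r) - soft_abs e y \<le> e"
    unfolding eq by linarith+
qed

lemma soft_abs_reaction_mono:
  assumes "e > 0" "0 \<le> x" "x \<le> y"
  shows "x * (x / sqrt (x\<^sup>2 + e\<^sup>2)) - soft_abs e x \<le> y * (y / sqrt (y\<^sup>2 + e\<^sup>2)) - soft_abs e y"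
proof -
  have "sqrt (x\<^sup>2 + e\<^sup>2) \<le> sqrt (y\<^sup>2 + e\<^sup>2)" using assms by (simp add: power_mono)
  then have "e\<^sup>2 / sqrt (y\<^sup>2 + e\<^sup>2) \<le> e\<^sup>2 / sqrt (x\<^sup>2 + e\<^sup>2)"
    using sqrt_square_add_pos[OF assms(1)] by (intro divide_left_mono) (auto intro: mult_pos_pos)
  then show ?thesis unfolding soft_abs_bounds(5)[OF assms(1)] by simp
qed

lemma continuous_soft_abs'': "e > 0 \<Longrightarrow> continuous_on UNIV (\<lambda>y. e\<^sup>2 / sqrt (y\<^sup>2 + e\<^sup>2) ^ 3)"
proof (intro continuous_intros ballI)
  fix y :: real assume "e > 0"
  then show "sqrt (y\<^sup>2 + e\<^sup>2) ^ 3 \<noteq> 0" using sqrt_square_add_pos[of e y] by simp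
qed

lemma slab_integral_abs_le:
  assumes i: "integrable lborel (slab s T g)" and K: "\<And>t. s \<le> t \<Longrightarrow> t \<le> T \<Longrightarrow> \<bar>LINT x|lborel. g t x\<bar> \<le> K"
    and "s \<le> T"
  shows "\<bar>LINT p|lborel. slab s T g p\<bar> \<le> K * (T - s)"
proof -
  have eq: "slab s T (\<lambda>t x. - g t x) = (\<lambda>p. - slab s T g p)" by (simp add: slab_def fun_eq_iff)
  have "(LINT p|lborel. slab s T g p) \<le> K * (T - s)"
    by (rule slab_integral_le[OF i _ assms(3)]) (use K in \<open>meson abs_le_D1\<close>)
  moreover have "(LINT p|lborel. slab s T (\<lambda>t x. - g t x) p) \<le> K * (T - s)"
  proof (rule slab_integral_le[OF _ _ assms(3)])
    show "integrable lborel (slab s T (\<lambda>t x. - g t x))" unfolding eq using i by simp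
    show "(LINT x|lborel. - g t x) \<le> K" if "s \<le> t" "t \<le> T" for t
      using K[OF that] by simp
  qed
  ultimately show ?thesis unfolding eq by simp
qed

section \<open>Monotone L^1 functionals and positivity\<close>

context npd
begin

lemma comb_single: "comb (\<lambda>_. 1) {i} = c i"
  by (rule ext)+ (simp add: comb_def)

text \<open>The linear part b y drops out of both J'' and y J' - J. The value b = 0 gives the L^1
  norm, b = -1 gives twice the integral of the negative part, and the range [-1,0] keeps |J| <= 2
  |y|. A single index n sends R to infinity and e to 0 together.\<close>

lemma L1_functional_mono:
  assumes i: "i \<in> {1..N}" and b: "- 1 \<le> b" "b \<le> 0" and s: "0 < s" "s \<le> T"
  shows "(LINT x|lborel. \<bar>c i T x\<bar> + b * c i T x) \<le> (LINT x|lborel. \<bar>c i s x\<bar> + b * c i s x)"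
proof -
  have I: "{i} \<subseteq> {1..N}" using i by simp
  interpret drift_diffusion D "z i" "c i" "comb_t (\<lambda>_. 1) {i}" \<rho> "comb_d (\<lambda>_. 1) {i}" "comb_dd (\<lambda>_. 1) {i}"
    "\<lambda>j t x. u t x $ j" "\<lambda>j t. partial j (\<lambda>y. u t y $ j)" "\<lambda>j t. partial j (\<phi> t)" "\<lambda>j t. partial j (partial j (\<phi> t))"
    using comb_drift_diffusion[OF I, of "z i" "\<lambda>_. 1"] by (simp add: comb_single)
  obtain K where K: "K \<ge> 0" "\<And>t. t \<in> {s..T} \<Longrightarrow> (LINT x|lborel. \<bar>c i t x\<bar>) \<le> K"
    "\<And>t. t \<in> {s..T} \<Longrightarrow> (LINT x|lborel. (c i t x)\<^sup>2) \<le> K"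
    "\<And>t j. t \<in> {s..T} \<Longrightarrow> (LINT x|lborel. (u t x $ j)\<^sup>2) \<le> K"
    "\<And>t j x. t \<in> {s..T} \<Longrightarrow> \<bar>partial j (\<phi> t) x\<bar> \<le> K"
    "\<And>t. t \<in> {s..T} \<Longrightarrow> (LINT x|lborel. \<bar>\<rho> t x\<bar>) \<le> K"
    using uniform_bounds[OF I s(1), where T=T and k="\<lambda>_. 1"] unfolding comb_single by metis
  define m where "m n = real n + 1" for n
  have m: "m n > 0" "m n \<ge> 1" for n by (simp_all add: m_def)
  define e where "e n = 1 / m n" for n
  have e: "e n > 0" for n using m by (simp add: e_def)
  have mlim: "filterlim m at_top sequentially"
    by (rule filterlim_at_top_mono[OF filterlim_real_sequentially]) (simp add: m_def)
  have elim: "e \<longlonglongrightarrow> 0"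
    unfolding e_def by (intro tendsto_divide_0[OF tendsto_const] filterlim_at_top_imp_at_infinity mlim)
  define J where "J n y = soft_abs (e n) y + b * y" for n y
  define J' where "J' n y = y / sqrt (y\<^sup>2 + (e n)\<^sup>2) + b" for n y
  define J'' where "J'' n y = (e n)\<^sup>2 / sqrt (y\<^sup>2 + (e n)\<^sup>2) ^ 3" for n y
  have dJ: "(J n has_real_derivative J' n y) (at y)" for n y
    unfolding J_def[abs_def] J'_def
    by (rule DERIV_add[OF DERIV_soft_abs[OF e] DERIV_cmult_Id])
  have dJ': "(J' n has_real_derivative J'' n y) (at y)" for n y
    unfolding J'_def[abs_def] J''_def
    by (rule DERIV_cong[OF DERIV_add[OF DERIV_soft_abs'[OF e] DERIV_const]]) simp
  have cJ'': "continuous_on UNIV (J'' n)" for n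
    unfolding J''_def[abs_def] by (rule continuous_soft_abs''[OF e])
  have Jle: "\<bar>J n y\<bar> \<le> 2 * \<bar>y\<bar>" for n y
  proof -
    have "\<bar>b * y\<bar> \<le> 1 * \<bar>y\<bar>" unfolding abs_mult by (intro mult_right_mono) (use b in auto)
    then show ?thesis using soft_abs_bounds(1,2)[OF e, of n y] unfolding J_def by linarith
  qed
  have G: "\<bar>y * J' n y - J n y\<bar> \<le> e n" for n y
  proof -
    have "y * J' n y - J n y = y * (y / sqrt (y\<^sup>2 + (e n)\<^sup>2)) - soft_abs (e n) y"
      by (simp add: J_def J'_def algebra_simps)
    then show ?thesis using soft_abs_bounds(3,4)[OF e, of y n] by linarith
  qed
  let ?F = "\<lambda>n t. LINT x|lborel. cutoff 0 (m n) x * J n (c i t x)"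
  let ?C = "18 * K + (90 * D + 18 * \<bar>z i\<bar> * D * K) * K"
  \<comment> \<open>The transport error, of the order of slope over radius, and the reaction error,
    proportional to e.\<close>
  let ?err = "\<lambda>n. (2 / m n * ?C) * (T - s) + \<bar>z i * D\<bar> * (e n * K * (T - s))"
  have step: "?F n T \<le> ?F n s + ?err n" for n
  proof -
    note id = energy_identity[OF dJ[of n] dJ'[of n] cJ''[of n] m(1)[of n] s]
    note iS = integrable_slab_terms[OF dJ[of n] dJ'[of n] cJ''[of n] m(1)[of n] s(1), where T=T]
    \<comment> \<open>J is convex, so the dissipation has a sign and can be discarded.\<close>
    have 1: "0 \<le> (LINT p|lborel. slab s T (dissipation (J'' n) (m n)) p)"
    proof (rule Bochner_Integration.integral_nonneg)
      fix p
      have "0 \<le> J'' n y" for y unfolding J''_def by simp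
      then show "0 \<le> slab s T (dissipation (J'' n) (m n)) p"
        unfolding slab_def dissipation_def
        by (intro mult_nonneg_nonneg sum_nonneg cutoff_nonneg) auto
    qed
    have 2: "(LINT p|lborel. slab s T (flux (J n) (m n)) p) \<le> (2 / m n * ?C) * (T - s)"
    proof (rule slab_integral_le[OF iS(1) _ s(2)])
      fix t assume t: "s \<le> t" "t \<le> T"
      then have t0: "t > 0" "t \<ge> 0" "t \<in> {s..T}" using s by auto
      show "(LINT x|lborel. flux (J n) (m n) t x) \<le> 2 / m n * ?C"
        by (rule flux_le[OF dJ dJ' cJ'' m(2) t0(1) Jle less_imp_le[OF D] K(1) c_integrable(2)[OF i t0(2)]
            c_square_integrable(2)[OF i t0(2)] velocity_integrable[OF t0(1)] K(2-5)[OF t0(3)]])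
    qed
    have 3: "\<bar>LINT p|lborel. slab s T (reaction (J n) (J' n) (m n)) p\<bar> \<le> e n * K * (T - s)"
    proof (rule slab_integral_abs_le[OF iS(2) _ s(2)])
      fix t assume t: "s \<le> t" "t \<le> T"
      then have t0: "t > 0" "t \<ge> 0" "t \<in> {s..T}" using s by auto
      have ir: "integrable lborel (\<lambda>x. \<bar>\<rho> t x\<bar>)"
        unfolding rho_eq by (intro integrable_abs comb_integrable t0 subset_refl)
      have pw: "\<bar>reaction (J n) (J' n) (m n) t x\<bar> \<le> e n * \<bar>\<rho> t x\<bar>" for x
      proof -
        have "\<bar>cutoff 0 (m n) x\<bar> * (\<bar>c i t x * J' n (c i t x) - J n (c i t x)\<bar> * \<bar>\<rho> t x\<bar>) \<le> 1 * (e n * \<bar>\<rho> t x\<bar>)"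
          using cutoff_nonneg[of 0 "m n" x] cutoff_le_1[of 0 "m n" x] e[of n]
          by (intro mult_mono mult_right_mono G) auto
        then show ?thesis by (simp add: reaction_def abs_mult)
      qed
      have "\<bar>LINT x|lborel. reaction (J n) (J' n) (m n) t x\<bar> \<le> (LINT x|lborel. \<bar>reaction (J n) (J' n) (m n) t x\<bar>)"
        by (rule integral_abs_bound)
      also have "\<dots> \<le> (LINT x|lborel. e n * \<bar>\<rho> t x\<bar>)"
        by (intro integral_mono pw integrable_abs integrable_mult_right ir
            integrable_terms(2)[OF dJ dJ' cJ'' m(1) t0(1)])
      also have "\<dots> \<le> e n * K" using mult_left_mono[OF K(6)[OF t0(3)], of "e n"] e[of n] by simp
      finally show "\<bar>LINT x|lborel. reaction (J n) (J' n) (m n) t x\<bar> \<le> e n * K" .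
    qed
    have "- (z i * D * (LINT p|lborel. slab s T (reaction (J n) (J' n) (m n)) p))
      \<le> \<bar>z i * D\<bar> * \<bar>LINT p|lborel. slab s T (reaction (J n) (J' n) (m n)) p\<bar>"
      unfolding abs_mult[symmetric] by (rule abs_ge_minus_self)
    also have "\<dots> \<le> \<bar>z i * D\<bar> * (e n * K * (T - s))" by (rule mult_left_mono[OF 3 abs_ge_zero])
    finally show ?thesis using id 2 mult_nonneg_nonneg[OF less_imp_le[OF D] 1] by linarith
  qed
  have lim: "(\<lambda>n. ?F n t) \<longlonglongrightarrow> (LINT x|lborel. \<bar>c i t x\<bar> + b * c i t x)" if t: "t > 0" for t
  proof (rule integral_dominated_convergence[where w="\<lambda>x. 2 * \<bar>c i t x\<bar>"])
    have t0: "t \<ge> 0" using t by simp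
    have cm [measurable]: "c i t \<in> borel_measurable borel" by (rule c_square_integrable(1)[OF i t0])
    show "(\<lambda>x. \<bar>c i t x\<bar> + b * c i t x) \<in> borel_measurable lborel" by measurable
    show "(\<lambda>x. cutoff 0 (m n) x * J n (c i t x)) \<in> borel_measurable lborel" for n
      using integrable_terms(5)[OF dJ dJ' cJ'' m(1) t] by (rule borel_measurable_integrable)
    show "integrable lborel (\<lambda>x. 2 * \<bar>c i t x\<bar>)"
      by (intro integrable_mult_right integrable_abs c_integrable(2)[OF i t0])
    show "AE x in lborel. norm (cutoff 0 (m n) x * J n (c i t x)) \<le> 2 * \<bar>c i t x\<bar>" for n
    proof (rule AE_I2)
      fix x
      have "\<bar>cutoff 0 (m n) x\<bar> * \<bar>J n (c i t x)\<bar> \<le> 1 * (2 * \<bar>c i t x\<bar>)"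
        using cutoff_nonneg[of 0 "m n" x] cutoff_le_1[of 0 "m n" x] by (intro mult_mono Jle) auto
      then show "norm (cutoff 0 (m n) x * J n (c i t x)) \<le> 2 * \<bar>c i t x\<bar>" by (simp add: abs_mult)
    qed
    show "AE x in lborel. (\<lambda>n. cutoff 0 (m n) x * J n (c i t x)) \<longlonglongrightarrow> \<bar>c i t x\<bar> + b * c i t x"
    proof (rule AE_I2)
      fix x
      have "(\<lambda>n. J n y) \<longlonglongrightarrow> (sqrt (y\<^sup>2 + 0\<^sup>2) - 0) + b * y" for y
        unfolding J_def soft_abs_def by (intro tendsto_intros elim)
      then have "(\<lambda>n. cutoff 0 (m n) x * J n (c i t x)) \<longlonglongrightarrow> 1 * ((sqrt ((c i t x)\<^sup>2 + 0\<^sup>2) - 0) + b * c i t x)"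
        by (intro tendsto_mult cutoff_tendsto_1 mlim)
      then show "(\<lambda>n. cutoff 0 (m n) x * J n (c i t x)) \<longlonglongrightarrow> \<bar>c i t x\<bar> + b * c i t x" by simp
    qed
  qed
  have "(\<lambda>n. 2 / m n) \<longlonglongrightarrow> 0"
    by (intro tendsto_divide_0[OF tendsto_const] filterlim_at_top_imp_at_infinity mlim)
  then have "?err \<longlonglongrightarrow> (0 * ?C) * (T - s) + \<bar>z i * D\<bar> * (0 * K * (T - s))"
    by (intro tendsto_intros elim)
  then have "?err \<longlonglongrightarrow> 0" by simp
  from tendsto_add[OF lim[OF s(1)] this]
  have "(\<lambda>n. ?F n s + ?err n) \<longlonglongrightarrow> (LINT x|lborel. \<bar>c i s x\<bar> + b * c i s x)" by simp
  from LIMSEQ_le[OF lim this] show ?thesis using s step by auto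
qed

lemma L1_norm_mono:
  assumes "i \<in> {1..N}" "0 < s" "s \<le> T"
  shows "(LINT x|lborel. \<bar>c i T x\<bar>) \<le> (LINT x|lborel. \<bar>c i s x\<bar>)"
  using L1_functional_mono[OF assms(1) _ _ assms(2,3), of 0] by simp

text \<open>The integral of |c| - c does not increase over positive times. Nonnegativity of the data
  bounds it at time s by twice the L^1 distance between c(s) and c(0), so letting s decrease to 0
  makes it vanish.\<close>

lemma concentration_nonneg:
  assumes i: "i \<in> {1..N}" and c0: "AE x in lborel. c i 0 x \<ge> 0" and t: "t > 0"
  shows "AE x in lborel. c i t x \<ge> 0"
proof -
  let ?h = "\<lambda>s. LINT x|lborel. \<bar>c i s x\<bar> + (- 1) * c i s x"
  have ih: "integrable lborel (\<lambda>x. \<bar>c i s x\<bar> + (- 1) * c i s x)" if "s \<ge> 0" for s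
    using c_integrable(2)[OF i that] by (intro Bochner_Integration.integrable_add integrable_mult_right) auto
  have le: "?h t \<le> 2 * (LINT x|lborel. \<bar>c i s x - c i 0 x\<bar>)" if s: "0 < s" "s \<le> t" for s
  proof -
    have "?h t \<le> ?h s" by (rule L1_functional_mono[OF i _ _ s]) auto
    also have "\<dots> \<le> (LINT x|lborel. 2 * \<bar>c i s x - c i 0 x\<bar>)"
    proof (rule integral_mono_AE)
      show "integrable lborel (\<lambda>x. 2 * \<bar>c i s x - c i 0 x\<bar>)"
        using c_integrable(2)[OF i] s by auto
      show "AE x in lborel. \<bar>c i s x\<bar> + (- 1) * c i s x \<le> 2 * \<bar>c i s x - c i 0 x\<bar>"
      proof -
        \<comment> \<open>For r >= 0 the left side is 0; for r < 0 it is -2r, which is at most 2 (q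
          - r).\<close>
        have "0 \<le> q \<Longrightarrow> \<bar>r\<bar> + (- 1) * r \<le> 2 * \<bar>r - q\<bar>" for q r :: real by (auto simp: abs_if)
        with c0 show ?thesis by auto
      qed
    qed (use ih s in auto)
    finally show ?thesis by simp
  qed
  have "?h t \<le> 2 * 0"
  proof (rule tendsto_lowerbound)
    show "((\<lambda>s. 2 * (LINT x|lborel. \<bar>c i s x - c i 0 x\<bar>)) \<longlongrightarrow> 2 * 0) (at_right 0)"
      using c_integrable(4)[OF i order_refl] by (intro tendsto_intros) (simp add: at_within_Ici_at_right)
    have "eventually (\<lambda>s. s \<in> {0<..t}) (at_right 0)" 
      using t unfolding eventually_at_right_field by (intro exI[of _ t]) auto
    then show "eventually (\<lambda>s. ?h t \<le> 2 * (LINT x|lborel. \<bar>c i s x - c i 0 x\<bar>)) (at_right 0)"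
      by eventually_elim (use le in auto)
  qed simp
  moreover have nn: "0 \<le> \<bar>c i t x\<bar> + (- 1) * c i t x" for x by simp
  ultimately have "?h t = 0" by (simp add: order_antisym Bochner_Integration.integral_nonneg)
  then have "AE x in lborel. \<bar>c i t x\<bar> + (- 1) * c i t x = 0"
    using integral_nonneg_eq_0_iff_AE[OF ih] nn t by auto
  then show ?thesis by eventually_elim linarith
qed

end

section \<open>Dissipation of the quadratic energy\<close>

text \<open>Close to y^2 while |y| is small against m, of slope at most 2m elsewhere. The factor 2m
  normalises the second derivative at 0 to 2.\<close>

definition soft_sq :: "real \<Rightarrow> real \<Rightarrow> real" where
  "soft_sq m y = 2 * m * soft_abs m y"

definition soft_sq' :: "real \<Rightarrow> real \<Rightarrow> real" where
  "soft_sq' m y = 2 * m * (y / sqrt (y\<^sup>2 + m\<^sup>2))"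

definition soft_sq'' :: "real \<Rightarrow> real \<Rightarrow> real" where
  "soft_sq'' m y = 2 * m * (m\<^sup>2 / sqrt (y\<^sup>2 + m\<^sup>2) ^ 3)"

lemma DERIV_soft_sq:
  assumes "m > 0"
  shows "(soft_sq m has_real_derivative soft_sq' m y) (at y)"
    "(soft_sq' m has_real_derivative soft_sq'' m y) (at y)"
    "continuous_on UNIV (soft_sq'' m)"
  unfolding soft_sq_def[abs_def] soft_sq'_def[abs_def] soft_sq''_def[abs_def]
  by (intro DERIV_cmult DERIV_soft_abs DERIV_soft_abs' continuous_on_mult continuous_on_const
      continuous_soft_abs'' assms)+

lemma sqrt_scale:
  assumes "m > 0"
  shows "sqrt (y\<^sup>2 + m\<^sup>2) = m * sqrt ((y / m)\<^sup>2 + 1)"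
proof -
  have "m * sqrt ((y / m)\<^sup>2 + 1) = sqrt (m\<^sup>2 * ((y / m)\<^sup>2 + 1))"
    using assms by (simp add: real_sqrt_mult)
  also have "m\<^sup>2 * ((y / m)\<^sup>2 + 1) = y\<^sup>2 + m\<^sup>2"
    using assms by (simp add: distrib_left power_divide)
  finally show ?thesis by simp
qed

text \<open>Rationalising the difference exhibits y^2 both as an upper bound and as the limit for
  large m, which the cancellation in the definition conceals.\<close>

lemma soft_sq_eq:
  assumes "m > 0"
  shows "soft_sq m y = 2 * y\<^sup>2 / (sqrt ((y / m)\<^sup>2 + 1) + 1)"
proof -
  define q where "q = sqrt ((y / m)\<^sup>2 + 1)"
  have q: "q \<ge> 1" "q * q = (y / m)\<^sup>2 + 1" by (simp_all add: q_def)
  have "y\<^sup>2 = m\<^sup>2 * (q * q - 1)" using assms by (simp add: q(2) power_divide)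
  then have "2 * y\<^sup>2 = (2 * m * (m * q - m)) * (q + 1)" by (simp add: power2_eq_square algebra_simps)
  then have "2 * y\<^sup>2 / (q + 1) = 2 * m * (m * q - m)" using q(1) by simp
  then show ?thesis unfolding soft_sq_def soft_abs_def sqrt_scale[OF assms] q_def[symmetric] by simp
qed

lemma soft_sq''_eq:
  assumes "m > 0"
  shows "soft_sq'' m y = 2 / sqrt ((y / m)\<^sup>2 + 1) ^ 3"
proof -
  have "2 * m * (m\<^sup>2 / (m * q) ^ 3) = 2 / q ^ 3" for q
    using assms by (simp add: power_mult_distrib power2_eq_square power3_eq_cube)
  then show ?thesis unfolding soft_sq''_def sqrt_scale[OF assms] .
qed

lemma soft_sq_bounds:
  assumes "m > 0"
  shows "0 \<le> soft_sq m y" "soft_sq m y \<le> y\<^sup>2" "\<bar>soft_sq m y\<bar> \<le> 2 * m * \<bar>y\<bar>" "0 \<le> soft_sq'' m y"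
proof -
  have q: "sqrt ((y / m)\<^sup>2 + 1) \<ge> 1" by simp
  then show "0 \<le> soft_sq m y" unfolding soft_sq_eq[OF assms] by (intro divide_nonneg_nonneg) auto
  have "2 * y\<^sup>2 / (sqrt ((y / m)\<^sup>2 + 1) + 1) \<le> 2 * y\<^sup>2 / 2"
    by (rule frac_le) (use q in auto)
  then show "soft_sq m y \<le> y\<^sup>2" unfolding soft_sq_eq[OF assms] by simp
  have "2 * m * soft_abs m y \<le> 2 * m * \<bar>y\<bar>"
    using assms by (intro mult_left_mono soft_abs_bounds) auto
  then show "\<bar>soft_sq m y\<bar> \<le> 2 * m * \<bar>y\<bar>"
    using \<open>0 \<le> soft_sq m y\<close> by (simp add: soft_sq_def)
  show "0 \<le> soft_sq'' m y" unfolding soft_sq''_eq[OF assms] by simp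
qed

text \<open>By the identity in \<open>soft_abs_bounds\<close> the function is 2m (m - m^2 / sqrt(y^2
  + m^2)). It is even, so monotonicity is confined to nonnegative arguments; it provides the sign of
  the combined reaction term.\<close>

lemma soft_sq_reaction_mono:
  assumes "m > 0" "0 \<le> x" "x \<le> y"
  shows "x * soft_sq' m x - soft_sq m x \<le> y * soft_sq' m y - soft_sq m y"
proof -
  have eq: "y * soft_sq' m y - soft_sq m y = 2 * m * (y * (y / sqrt (y\<^sup>2 + m\<^sup>2)) - soft_abs m y)" for y
    by (simp add: soft_sq_def soft_sq'_def algebra_simps)
  show ?thesis unfolding eq using assms by (intro mult_left_mono soft_abs_reaction_mono) auto
qed

lemma soft_sq_tendsto:
  assumes m: "filterlim m at_top sequentially" "\<And>n. m n > 0"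
  shows "(\<lambda>n. soft_sq (m n) y) \<longlonglongrightarrow> y\<^sup>2" "(\<lambda>n. soft_sq'' (m n) y) \<longlonglongrightarrow> 2"
proof -
  have "(\<lambda>n. y / m n) \<longlonglongrightarrow> 0"
    by (intro tendsto_divide_0[OF tendsto_const] filterlim_at_top_imp_at_infinity m)
  then have q: "(\<lambda>n. sqrt ((y / m n)\<^sup>2 + 1)) \<longlonglongrightarrow> sqrt (0\<^sup>2 + 1)" by (intro tendsto_intros)
  have "(\<lambda>n. 2 * y\<^sup>2 / (sqrt ((y / m n)\<^sup>2 + 1) + 1)) \<longlonglongrightarrow> 2 * y\<^sup>2 / (sqrt (0\<^sup>2 + 1) + 1)"
    by (intro tendsto_divide tendsto_add tendsto_const q) simp
  then show "(\<lambda>n. soft_sq (m n) y) \<longlonglongrightarrow> y\<^sup>2" unfolding soft_sq_eq[OF m(2)] by simp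
  have "(\<lambda>n. 2 / sqrt ((y / m n)\<^sup>2 + 1) ^ 3) \<longlonglongrightarrow> 2 / sqrt (0\<^sup>2 + 1) ^ 3"
    by (intro tendsto_divide tendsto_power tendsto_const q) simp
  then show "(\<lambda>n. soft_sq'' (m n) y) \<longlonglongrightarrow> 2" unfolding soft_sq''_eq[OF m(2)] by simp
qed

section \<open>The energy of the two total concentrations\<close>

locale npd_nonneg = npd +
  assumes nonneg_0: "\<And>i. i \<in> {1..N} \<Longrightarrow> AE x in lborel. c i 0 x \<ge> 0"
begin

text \<open>Booleans index the two valences, so sums over \<open>UNIV\<close> run over both. If
  \<zeta> = 0, every species belongs to \<open>species True\<close> and the other class is
  empty.\<close>

definition species :: "bool \<Rightarrow> nat set" where
  "species b = {i \<in> {1..N}. (z i = \<zeta>) = b}"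

definition charge :: "bool \<Rightarrow> real" where
  "charge b = (if b then \<zeta> else - \<zeta>)"

definition \<sigma> :: "bool \<Rightarrow> real \<Rightarrow> real^3 \<Rightarrow> real" where
  "\<sigma> b = comb (\<lambda>_. 1) (species b)"

definition \<sigma>' :: "bool \<Rightarrow> 3 \<Rightarrow> real \<Rightarrow> real^3 \<Rightarrow> real" where
  "\<sigma>' b = comb_d (\<lambda>_. 1) (species b)"

definition energy :: "real \<Rightarrow> real" where
  "energy t = (\<Sum>b\<in>UNIV. LINT x|lborel. (\<sigma> b t x)\<^sup>2)"

text \<open>This and \<open>diss\<close> copy \<open>reaction\<close> and \<open>dissipation\<close>
  with the radius m^2 built in. They live outside \<open>drift_diffusion\<close>, which is
  interpreted separately for each valence, so that the terms of both valences can be added.\<close>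

definition reac :: "real \<Rightarrow> bool \<Rightarrow> real \<Rightarrow> real^3 \<Rightarrow> real" where
  "reac m b t x = cutoff 0 (m\<^sup>2) x * ((\<sigma> b t x * soft_sq' m (\<sigma> b t x) - soft_sq m (\<sigma> b t x)) * \<rho> t x)"

definition diss :: "real \<Rightarrow> bool \<Rightarrow> real \<Rightarrow> real^3 \<Rightarrow> real" where
  "diss m b t x = cutoff 0 (m\<^sup>2) x * (soft_sq'' m (\<sigma> b t x) * (\<Sum>j\<in>UNIV. (\<sigma>' b j t x)\<^sup>2))"

lemma species_subset: "species b \<subseteq> {1..N}"
  by (auto simp: species_def)

lemma valence_species:
  assumes "i \<in> species b"
  shows "z i = charge b"
proof -
  have "\<bar>z i\<bar> = \<zeta>" "(z i = \<zeta>) = b" using assms z[of i] by (auto simp: species_def)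
  then show ?thesis by (auto simp: charge_def abs_if split: if_splits)
qed

lemma rho_sigma: "\<rho> t x = \<zeta> * (\<sigma> True t x - \<sigma> False t x)"
proof -
  have "\<rho> t x = (\<Sum>i\<in>species True \<union> species False. z i * c i t x)"
    unfolding charge_density_def by (intro sum.cong) (auto simp: species_def)
  also have "\<dots> = (\<Sum>i\<in>species True. z i * c i t x) + (\<Sum>i\<in>species False. z i * c i t x)"
    by (intro sum.union_disjoint) (auto simp: species_def)
  also have "\<dots> = (\<Sum>i\<in>species True. \<zeta> * c i t x) + (\<Sum>i\<in>species False. - \<zeta> * c i t x)"
    using valence_species by (simp add: charge_def)
  finally show ?thesis by (simp add: \<sigma>_def comb_def sum_distrib_left sum_negf right_diff_distrib)
qed

lemma sigma_nonneg:
  assumes "t > 0"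
  shows "AE x in lborel. \<forall>b. 0 \<le> \<sigma> b t x"
proof -
  have "AE x in lborel. \<forall>i\<in>{1..N}. 0 \<le> c i t x"
  proof (rule AE_finite_allI)
    show "AE x in lborel. 0 \<le> c i t x" if "i \<in> {1..N}" for i
      by (rule concentration_nonneg[OF that nonneg_0[OF that] assms])
  qed simp
  then show ?thesis
  proof eventually_elim
    case (elim x)
    show "\<forall>b. 0 \<le> \<sigma> b t x"
    proof
      fix b
      have "0 \<le> (\<Sum>i\<in>species b. 1 * c i t x)"
        by (rule sum_nonneg) (use elim species_subset[of b] in auto)
      then show "0 \<le> \<sigma> b t x" unfolding \<sigma>_def comb_def .
    qed
  qed
qed

lemma sigma_drift_diffusion:
  "drift_diffusion D (charge b) (\<sigma> b) (comb_t (\<lambda>_. 1) (species b)) \<rho> (\<sigma>' b) (comb_dd (\<lambda>_. 1) (species b))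
    (\<lambda>j t x. u t x $ j) (\<lambda>j t. partial j (\<lambda>y. u t y $ j)) (\<lambda>j t. partial j (\<phi> t)) (\<lambda>j t. partial j (partial j (\<phi> t)))"
  unfolding \<sigma>_def \<sigma>'_def by (rule comb_drift_diffusion[OF species_subset valence_species])

lemma sigma_integrable:
  assumes "t \<ge> 0"
  shows "integrable lborel (\<sigma> b t)" "integrable lborel (\<lambda>x. (\<sigma> b t x)\<^sup>2)"
    "t > 0 \<Longrightarrow> integrable lborel (\<lambda>x. (\<sigma>' b j t x)\<^sup>2)"
  unfolding \<sigma>_def \<sigma>'_def by (rule comb_integrable[OF species_subset assms]; assumption?)+

lemma sigma_slice:
  assumes "t > 0"
  shows "has_partial j (\<sigma> b t) (\<sigma>' b j t)" "continuous_on UNIV (\<sigma> b t)" "continuous_on UNIV (\<sigma>' b j t)"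
  unfolding \<sigma>_def \<sigma>'_def by (rule comb_slice[OF species_subset assms])+

lemma energy_terms_integrable:
  assumes m: "m > 0"
  shows "t > 0 \<Longrightarrow> integrable lborel (\<lambda>x. cutoff 0 (m\<^sup>2) x * soft_sq m (\<sigma> b t x))"
    "t > 0 \<Longrightarrow> integrable lborel (reac m b t)"
    "s > 0 \<Longrightarrow> integrable lborel (slab s T (reac m b))"
    "s > 0 \<Longrightarrow> integrable lborel (slab s T (diss m b))"
proof -
  interpret drift_diffusion D "charge b" "\<sigma> b" "comb_t (\<lambda>_. 1) (species b)" \<rho> "\<sigma>' b" "comb_dd (\<lambda>_. 1) (species b)"
    "\<lambda>j t x. u t x $ j" "\<lambda>j t. partial j (\<lambda>y. u t y $ j)" "\<lambda>j t. partial j (\<phi> t)" "\<lambda>j t. partial j (partial j (\<phi> t))"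
    by (rule sigma_drift_diffusion)
  note J = DERIV_soft_sq(1)[OF m] DERIV_soft_sq(2)[OF m] DERIV_soft_sq(3)[OF m]
  have m2: "m\<^sup>2 > 0" using m by simp
  have eq: "reaction (soft_sq m) (soft_sq' m) (m\<^sup>2) = reac m b" "dissipation (soft_sq'' m) (m\<^sup>2) = diss m b"
    by (rule ext, rule ext, simp add: reaction_def reac_def dissipation_def diss_def)+
  note i = integrable_terms[OF J m2] and iS = integrable_slab_terms[OF J m2]
  show "t > 0 \<Longrightarrow> integrable lborel (\<lambda>x. cutoff 0 (m\<^sup>2) x * soft_sq m (\<sigma> b t x))" by (rule i(5))
  show "t > 0 \<Longrightarrow> integrable lborel (reac m b t)" using i(2) unfolding eq .
  show "s > 0 \<Longrightarrow> integrable lborel (slab s T (reac m b))" using iS(2) unfolding eq .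
  show "s > 0 \<Longrightarrow> integrable lborel (slab s T (diss m b))" using iS(3) unfolding eq .
qed

text \<open>Slope 2m against radius m^2 leaves a transport error of the form C/m with C independent
  of m. The reaction term is kept on the left, because only its sum over both valences has a
  sign.\<close>

lemma energy_inequality_species:
  assumes s: "0 < s" "s \<le> T"
  shows "\<exists>C. \<forall>m\<ge>1. (LINT x|lborel. cutoff 0 (m\<^sup>2) x * soft_sq m (\<sigma> b T x)) + D * (LINT p|lborel. slab s T (diss m b) p)
    + charge b * D * (LINT p|lborel. slab s T (reac m b) p) \<le> (LINT x|lborel. (\<sigma> b s x)\<^sup>2) + C / m"
proof -
  interpret drift_diffusion D "charge b" "\<sigma> b" "comb_t (\<lambda>_. 1) (species b)" \<rho> "\<sigma>' b" "comb_dd (\<lambda>_. 1) (species b)"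
    "\<lambda>j t x. u t x $ j" "\<lambda>j t. partial j (\<lambda>y. u t y $ j)" "\<lambda>j t. partial j (\<phi> t)" "\<lambda>j t. partial j (partial j (\<phi> t))"
    by (rule sigma_drift_diffusion)
  obtain K where K: "K \<ge> 0" "\<And>t. t \<in> {s..T} \<Longrightarrow> (LINT x|lborel. \<bar>\<sigma> b t x\<bar>) \<le> K"
    "\<And>t. t \<in> {s..T} \<Longrightarrow> (LINT x|lborel. (\<sigma> b t x)\<^sup>2) \<le> K"
    "\<And>t j. t \<in> {s..T} \<Longrightarrow> (LINT x|lborel. (u t x $ j)\<^sup>2) \<le> K"
    "\<And>t j x. t \<in> {s..T} \<Longrightarrow> \<bar>partial j (\<phi> t) x\<bar> \<le> K"
    using uniform_bounds[OF species_subset[of b] s(1), where T=T and k="\<lambda>_. 1"] unfolding \<sigma>_def by metis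
  let ?C = "18 * K + (90 * D + 18 * \<bar>charge b\<bar> * D * K) * K"
  have "(LINT x|lborel. cutoff 0 (m\<^sup>2) x * soft_sq m (\<sigma> b T x)) + D * (LINT p|lborel. slab s T (diss m b) p)
    + charge b * D * (LINT p|lborel. slab s T (reac m b) p) \<le> (LINT x|lborel. (\<sigma> b s x)\<^sup>2) + (2 * ?C * (T - s)) / m"
    if m1: "m \<ge> 1" for m
  proof -
    have m: "m > 0" using m1 by simp
    have m2: "m\<^sup>2 > 0" "m\<^sup>2 \<ge> 1" using m1 by (auto simp: one_le_power)
    note J = DERIV_soft_sq(1)[OF m] DERIV_soft_sq(2)[OF m] DERIV_soft_sq(3)[OF m]
    have eq: "reaction (soft_sq m) (soft_sq' m) (m\<^sup>2) = reac m b" "dissipation (soft_sq'' m) (m\<^sup>2) = diss m b"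
      by (rule ext, rule ext, simp add: reaction_def reac_def dissipation_def diss_def)+
    have 1: "(LINT p|lborel. slab s T (flux (soft_sq m) (m\<^sup>2)) p) \<le> (2 * m / m\<^sup>2 * ?C) * (T - s)"
    proof (rule slab_integral_le[OF integrable_slab_terms(1)[OF J m2(1) s(1)] _ s(2)])
      fix t assume t: "s \<le> t" "t \<le> T"
      then have t0: "t > 0" "t \<ge> 0" "t \<in> {s..T}" using s by auto
      show "(LINT x|lborel. flux (soft_sq m) (m\<^sup>2) t x) \<le> 2 * m / m\<^sup>2 * ?C"
        by (rule flux_le[OF J m2(2) t0(1) soft_sq_bounds(3)[OF m] less_imp_le[OF D] K(1) sigma_integrable(1)[OF t0(2)]
            sigma_integrable(2)[OF t0(2)] velocity_integrable[OF t0(1)] K(2-5)[OF t0(3)]])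
    qed
    have 2: "(2 * m / m\<^sup>2 * ?C) * (T - s) = (2 * ?C * (T - s)) / m"
      using m by (simp add: power2_eq_square)
    have 3: "(LINT x|lborel. cutoff 0 (m\<^sup>2) x * soft_sq m (\<sigma> b s x)) \<le> (LINT x|lborel. (\<sigma> b s x)\<^sup>2)"
    proof (rule integral_mono)
      show "cutoff 0 (m\<^sup>2) x * soft_sq m (\<sigma> b s x) \<le> (\<sigma> b s x)\<^sup>2" for x
        using mult_mono[OF cutoff_le_1[of 0 "m\<^sup>2" x] soft_sq_bounds(2)[OF m, of "\<sigma> b s x"]] soft_sq_bounds(1)[OF m]
        by simp
    qed (use energy_terms_integrable(1)[OF m s(1)] sigma_integrable(2) s in auto)
    show ?thesis using energy_identity[OF J m2(1) s] 1 2 3 unfolding eq by linarith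
  qed
  then show ?thesis by blast
qed

text \<open>With G(y) = y J'(y) - J(y), and a and b for the two total concentrations, the weighted
  reaction terms add up to \<theta> \<zeta>^2 (G(a) - G(b)) (a - b). Positivity of a and b places
  them where G increases.\<close>

lemma reaction_sum_nonneg:
  assumes m: "m > 0" and s: "0 < s"
  shows "0 \<le> (\<Sum>b\<in>UNIV. charge b * D * (LINT p|lborel. slab s T (reac m b) p))"
proof -
  note iS = energy_terms_integrable(3)[OF m s]
  have pos: "0 \<le> indicator {s..T} t * (\<zeta> * (LINT x|lborel. reac m True t x) - \<zeta> * (LINT x|lborel. reac m False t x))" for t
  proof (cases "t \<in> {s..T}")
    case True
    then have t: "t > 0" using s by auto
    note i = energy_terms_integrable(2)[OF m t]
    let ?G = "\<lambda>y. y * soft_sq' m y - soft_sq m y"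
    have "0 \<le> (LINT x|lborel. \<zeta> * reac m True t x - \<zeta> * reac m False t x)"
    proof (rule integral_nonneg_AE)
      show "AE x in lborel. 0 \<le> \<zeta> * reac m True t x - \<zeta> * reac m False t x"
        using sigma_nonneg[OF t]
      proof eventually_elim
        case (elim x)
        let ?a = "\<sigma> True t x" and ?b = "\<sigma> False t x"
        have "0 \<le> (?G ?a - ?G ?b) * (?a - ?b)"
        proof (cases "?a \<le> ?b")
          case True
          then show ?thesis using soft_sq_reaction_mono[OF m _ True] elim by (intro mult_nonpos_nonpos) auto
        next
          case False
          then show ?thesis using soft_sq_reaction_mono[OF m, of ?b ?a] elim by (intro mult_nonneg_nonneg) auto
        qed
        then have "0 \<le> cutoff 0 (m\<^sup>2) x * (\<zeta>\<^sup>2 * ((?G ?a - ?G ?b) * (?a - ?b)))"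
          by (rule mult_nonneg_nonneg[OF cutoff_nonneg mult_nonneg_nonneg[OF zero_le_power2]])
        also have "\<dots> = \<zeta> * reac m True t x - \<zeta> * reac m False t x"
          unfolding reac_def rho_sigma by (simp add: power2_eq_square algebra_simps)
        finally show ?case .
      qed
    qed
    then show ?thesis using i True by simp
  qed simp
  have "(\<Sum>b\<in>UNIV. charge b * D * (LINT p|lborel. slab s T (reac m b) p))
    = D * (\<zeta> * (LINT p|lborel. slab s T (reac m True) p) - \<zeta> * (LINT p|lborel. slab s T (reac m False) p))"
    by (simp add: UNIV_bool charge_def algebra_simps)
  also have "\<zeta> * (LINT p|lborel. slab s T (reac m True) p) - \<zeta> * (LINT p|lborel. slab s T (reac m False) p)
    = (LINT t|lborel. indicator {s..T} t * (\<zeta> * (LINT x|lborel. reac m True t x) - \<zeta> * (LINT x|lborel. reac m False t x)))"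
  proof -
    have "(LINT t|lborel. indicator {s..T} t * (\<zeta> * (LINT x|lborel. reac m True t x) - \<zeta> * (LINT x|lborel. reac m False t x)))
      = (LINT t|lborel. \<zeta> * (indicator {s..T} t * (LINT x|lborel. reac m True t x)) - \<zeta> * (indicator {s..T} t * (LINT x|lborel. reac m False t x)))"
      by (simp add: algebra_simps)
    also have "\<dots> = \<zeta> * (LINT t|lborel. indicator {s..T} t * (LINT x|lborel. reac m True t x)) - \<zeta> * (LINT t|lborel. indicator {s..T} t * (LINT x|lborel. reac m False t x))"
      using slab_integral(2)[OF iS[of T True]] slab_integral(2)[OF iS[of T False]]
      by (simp only: Bochner_Integration.integral_diff integrable_mult_right integral_mult_right_zero)
    finally show ?thesis unfolding slab_integral(1)[OF iS[of T True]] slab_integral(1)[OF iS[of T False]] by simp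
  qed
  finally show ?thesis 
    by (simp only:) (rule mult_nonneg_nonneg[OF less_imp_le[OF D] Bochner_Integration.integral_nonneg[OF pos]])
qed

lemma energy_inequality:
  assumes s: "0 < s" "s \<le> T"
  shows "\<exists>C. \<forall>m\<ge>1. (\<Sum>b\<in>UNIV. LINT x|lborel. cutoff 0 (m\<^sup>2) x * soft_sq m (\<sigma> b T x))
    + D * (\<Sum>b\<in>UNIV. LINT p|lborel. slab s T (diss m b) p) \<le> energy s + C / m"
proof -
  obtain C1 where C1: "\<And>m. m \<ge> 1 \<Longrightarrow> (LINT x|lborel. cutoff 0 (m\<^sup>2) x * soft_sq m (\<sigma> True T x)) + D * (LINT p|lborel. slab s T (diss m True) p)
    + charge True * D * (LINT p|lborel. slab s T (reac m True) p) \<le> (LINT x|lborel. (\<sigma> True s x)\<^sup>2) + C1 / m"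
    using energy_inequality_species[OF s, of True] by blast
  obtain C2 where C2: "\<And>m. m \<ge> 1 \<Longrightarrow> (LINT x|lborel. cutoff 0 (m\<^sup>2) x * soft_sq m (\<sigma> False T x)) + D * (LINT p|lborel. slab s T (diss m False) p)
    + charge False * D * (LINT p|lborel. slab s T (reac m False) p) \<le> (LINT x|lborel. (\<sigma> False s x)\<^sup>2) + C2 / m"
    using energy_inequality_species[OF s, of False] by blast
  have "(\<Sum>b\<in>UNIV. LINT x|lborel. cutoff 0 (m\<^sup>2) x * soft_sq m (\<sigma> b T x))
    + D * (\<Sum>b\<in>UNIV. LINT p|lborel. slab s T (diss m b) p) \<le> energy s + (C1 + C2) / m" if m: "m \<ge> 1" for m
  proof -
    have "0 \<le> (\<Sum>b\<in>UNIV. charge b * D * (LINT p|lborel. slab s T (reac m b) p))"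
      by (rule reaction_sum_nonneg) (use m s in auto)
    then show ?thesis using C1[OF m] C2[OF m]
      by (simp add: UNIV_bool energy_def add_divide_distrib distrib_left)
  qed
  then show ?thesis by blast
qed

text \<open>Fatou's lemma for m tending to infinity. The two nonnegative terms are treated
  separately, each time dropping the other: one yields monotonicity, the other the gradient bound,
  where the 2 is the limit of \<open>soft_sq''\<close>.\<close>

lemma energy_dissipation:
  assumes s: "0 < s" "s \<le> T"
  shows "energy T \<le> energy s"
    "integrable lborel (slab s T (\<lambda>t x. 2 * (\<Sum>b\<in>UNIV. \<Sum>j\<in>UNIV. (\<sigma>' b j t x)\<^sup>2)))"
    "(LINT p|lborel. slab s T (\<lambda>t x. 2 * (\<Sum>b\<in>UNIV. \<Sum>j\<in>UNIV. (\<sigma>' b j t x)\<^sup>2)) p) \<le> energy s / D"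
proof -
  obtain C where C: "\<And>m. m \<ge> 1 \<Longrightarrow> (\<Sum>b\<in>UNIV. LINT x|lborel. cutoff 0 (m\<^sup>2) x * soft_sq m (\<sigma> b T x))
    + D * (\<Sum>b\<in>UNIV. LINT p|lborel. slab s T (diss m b) p) \<le> energy s + C / m"
    using energy_inequality[OF s] by blast
  define m where "m n = real n + 1" for n
  have m: "m n > 0" "m n \<ge> 1" for n by (simp_all add: m_def)
  have mlim: "filterlim m at_top sequentially"
    by (rule filterlim_at_top_mono[OF filterlim_real_sequentially]) (simp add: m_def)
  have m2lim: "filterlim (\<lambda>n. (m n)\<^sup>2) at_top sequentially"
    by (intro filterlim_pow_at_top mlim) simp
  have T: "T > 0" using s by linarith
  have "(\<lambda>n. C / m n) \<longlonglongrightarrow> 0"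
    by (intro tendsto_divide_0[OF tendsto_const] filterlim_at_top_imp_at_infinity mlim)
  then have Clim: "(\<lambda>n. energy s + C / m n) \<longlonglongrightarrow> energy s + 0" by (intro tendsto_intros)
  let ?A = "\<lambda>n b. LINT x|lborel. cutoff 0 ((m n)\<^sup>2) x * soft_sq (m n) (\<sigma> b T x)"
  let ?B = "\<lambda>n b. LINT p|lborel. slab s T (diss (m n) b) p"
  have nnA: "0 \<le> cutoff 0 ((m n)\<^sup>2) x * soft_sq (m n) (\<sigma> b T x)" for n b x
    by (intro mult_nonneg_nonneg cutoff_nonneg soft_sq_bounds m)
  have nnB: "0 \<le> slab s T (diss (m n) b) p" for n b p
    unfolding slab_def diss_def
    by (intro mult_nonneg_nonneg sum_nonneg cutoff_nonneg soft_sq_bounds m zero_le_power2) simp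
  have SA: "0 \<le> (\<Sum>b\<in>UNIV. ?A n b)" and SB: "0 \<le> D * (\<Sum>b\<in>UNIV. ?B n b)" for n
    using D by (auto intro!: sum_nonneg mult_nonneg_nonneg Bochner_Integration.integral_nonneg nnA nnB)
  have iA: "integrable lborel (\<lambda>x. cutoff 0 ((m n)\<^sup>2) x * soft_sq (m n) (\<sigma> b T x))" for n b
    by (rule energy_terms_integrable(1)[OF m(1) T])
  have iB: "integrable lborel (slab s T (diss (m n) b))" for n b
    by (rule energy_terms_integrable(4)[OF m(1) s(1)])
  have "(LINT x|lborel. (\<Sum>b\<in>UNIV. (\<sigma> b T x)\<^sup>2)) \<le> energy s + 0"
  proof (rule integral_le_of_tendsto(2)[where f="\<lambda>n x. \<Sum>b\<in>UNIV. cutoff 0 ((m n)\<^sup>2) x * soft_sq (m n) (\<sigma> b T x)", OF _ _ _ Clim])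
    show "integrable lborel (\<lambda>x. \<Sum>b\<in>UNIV. cutoff 0 ((m n)\<^sup>2) x * soft_sq (m n) (\<sigma> b T x))" for n
      by (intro Bochner_Integration.integrable_sum iA)
    show "0 \<le> (\<Sum>b\<in>UNIV. cutoff 0 ((m n)\<^sup>2) x * soft_sq (m n) (\<sigma> b T x))" for n x by (intro sum_nonneg nnA)
    show "(LINT x|lborel. (\<Sum>b\<in>UNIV. cutoff 0 ((m n)\<^sup>2) x * soft_sq (m n) (\<sigma> b T x))) \<le> energy s + C / m n" for n
      using C[OF m(2)[of n]] SB[of n] iA[of n] by (simp only: Bochner_Integration.integral_sum)
    show "(\<lambda>x. \<Sum>b\<in>UNIV. (\<sigma> b T x)\<^sup>2) \<in> borel_measurable lborel"
      using sigma_integrable(2)[OF less_imp_le[OF T]] by (intro borel_measurable_sum borel_measurable_integrable)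
    show "AE x in lborel. (\<lambda>n. \<Sum>b\<in>UNIV. cutoff 0 ((m n)\<^sup>2) x * soft_sq (m n) (\<sigma> b T x)) \<longlonglongrightarrow> (\<Sum>b\<in>UNIV. (\<sigma> b T x)\<^sup>2)"
    proof (intro AE_I2 tendsto_sum)
      fix x b
      have "(\<lambda>n. cutoff 0 ((m n)\<^sup>2) x * soft_sq (m n) (\<sigma> b T x)) \<longlonglongrightarrow> 1 * (\<sigma> b T x)\<^sup>2"
        by (intro tendsto_mult cutoff_tendsto_1 m2lim soft_sq_tendsto mlim m)
      then show "(\<lambda>n. cutoff 0 ((m n)\<^sup>2) x * soft_sq (m n) (\<sigma> b T x)) \<longlonglongrightarrow> (\<sigma> b T x)\<^sup>2" by simp
    qed
  qed
  then show "energy T \<le> energy s"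
    using sigma_integrable(2)[OF less_imp_le[OF T]] by (simp add: energy_def Bochner_Integration.integral_sum)
  have Blim: "(\<lambda>n. (energy s + C / m n) / D) \<longlonglongrightarrow> (energy s + 0) / D"
    using D by (intro tendsto_divide Clim tendsto_const) simp
  let ?g = "slab s T (\<lambda>t x. 2 * (\<Sum>b\<in>UNIV. \<Sum>j\<in>UNIV. (\<sigma>' b j t x)\<^sup>2))"
  have l: "(\<lambda>n. \<Sum>b\<in>UNIV. slab s T (diss (m n) b) p) \<longlonglongrightarrow> ?g p" for p
  proof -
    have 1: "(\<lambda>n. slab s T (diss (m n) b) p) \<longlonglongrightarrow> indicator {s..T} (fst p) * (1 * (2 * (\<Sum>j\<in>UNIV. (\<sigma>' b j (fst p) (snd p))\<^sup>2)))" for b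
      unfolding slab_def diss_def
      by (intro tendsto_mult tendsto_const cutoff_tendsto_1 m2lim soft_sq_tendsto(2) mlim m)
    have "(\<lambda>n. \<Sum>b\<in>UNIV. slab s T (diss (m n) b) p) \<longlonglongrightarrow> (\<Sum>b\<in>UNIV. indicator {s..T} (fst p) * (1 * (2 * (\<Sum>j\<in>UNIV. (\<sigma>' b j (fst p) (snd p))\<^sup>2))))"
      by (intro tendsto_sum 1)
    moreover have "(\<Sum>b\<in>UNIV. indicator {s..T} (fst p) * (1 * (2 * (\<Sum>j\<in>UNIV. (\<sigma>' b j (fst p) (snd p))\<^sup>2)))) = ?g p"
      unfolding slab_def sum_distrib_left by simp
    ultimately show ?thesis by simp
  qed
  have iSB: "integrable lborel (\<lambda>p. \<Sum>b\<in>UNIV. slab s T (diss (m n) b) p)" for n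
    by (intro Bochner_Integration.integrable_sum iB)
  have nSB: "0 \<le> (\<Sum>b\<in>UNIV. slab s T (diss (m n) b) p)" for n p by (intro sum_nonneg nnB)
  have leSB: "(LINT p|lborel. (\<Sum>b\<in>UNIV. slab s T (diss (m n) b) p)) \<le> (energy s + C / m n) / D" for n
  proof -
    have "D * (\<Sum>b\<in>UNIV. ?B n b) \<le> energy s + C / m n" using C[OF m(2)[of n]] SA[of n] by linarith
    then have "(\<Sum>b\<in>UNIV. ?B n b) \<le> (energy s + C / m n) / D" using D by (simp add: pos_le_divide_eq mult.commute)
    then show ?thesis using iB by (simp only: Bochner_Integration.integral_sum)
  qed
  have mg: "?g \<in> borel_measurable lborel"
    by (rule borel_measurable_LIMSEQ_real[OF l borel_measurable_integrable[OF iSB]])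
  note F = integral_le_of_tendsto[OF iSB nSB leSB Blim mg AE_I2[OF l]]
  show "integrable lborel ?g" by (rule F(1))
  show "(LINT p|lborel. ?g p) \<le> energy s / D" using F(2) by simp
qed

text \<open>\<open>L1_norm_mono\<close> compares positive times, so time 1 serves as the
  origin.\<close>

lemma sigma_L1_le:
  assumes "1 \<le> t"
  shows "(LINT x|lborel. \<bar>\<sigma> b t x\<bar>) \<le> (\<Sum>i\<in>{1..N}. LINT x|lborel. \<bar>c i 1 x\<bar>)"
proof -
  have t: "t \<ge> 0" using assms by simp
  have i: "integrable lborel (\<lambda>x. \<bar>c i t x\<bar>)" if "i \<in> {1..N}" for i
    by (intro integrable_abs c_integrable(2) that t)
  have "(LINT x|lborel. \<bar>\<sigma> b t x\<bar>) \<le> (LINT x|lborel. (\<Sum>i\<in>{1..N}. \<bar>c i t x\<bar>))"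
  proof (rule integral_mono)
    show "integrable lborel (\<lambda>x. \<bar>\<sigma> b t x\<bar>)" by (intro integrable_abs sigma_integrable t)
    show "integrable lborel (\<lambda>x. \<Sum>i\<in>{1..N}. \<bar>c i t x\<bar>)" by (intro Bochner_Integration.integrable_sum i)
    show "\<bar>\<sigma> b t x\<bar> \<le> (\<Sum>i\<in>{1..N}. \<bar>c i t x\<bar>)" for x
    proof -
      have "\<bar>\<sigma> b t x\<bar> \<le> (\<Sum>i\<in>species b. \<bar>c i t x\<bar>)" unfolding \<sigma>_def comb_def by simp
      also have "\<dots> \<le> (\<Sum>i\<in>{1..N}. \<bar>c i t x\<bar>)" by (intro sum_mono2 species_subset) auto
      finally show ?thesis .
    qed
  qed
  also have "\<dots> = (\<Sum>i\<in>{1..N}. LINT x|lborel. \<bar>c i t x\<bar>)" by (intro Bochner_Integration.integral_sum i)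
  also have "\<dots> \<le> (\<Sum>i\<in>{1..N}. LINT x|lborel. \<bar>c i 1 x\<bar>)" using assms by (intro sum_mono L1_norm_mono) auto
  finally show ?thesis .
qed

end

section \<open>Nash's inequality\<close>

text \<open>Cauchy-Schwarz, from the nonnegative integral of (g - k)^2 with k the mean of g over
  [0,h].\<close>

lemma square_integral_le:
  fixes g :: "real \<Rightarrow> real"
  assumes h: "h > 0" and g: "continuous_on UNIV g"
  shows "(LINT t|lborel. indicator {0..h} t * g t)\<^sup>2 \<le> h * (LINT t|lborel. indicator {0..h} t * (g t)\<^sup>2)"
proof -
  have ig: "integrable lborel (\<lambda>t. indicator {0..h} t * f t)" if "continuous_on UNIV f" for f :: "real \<Rightarrow> real"
    using borel_integrable_compact[of "{0..h}" f] continuous_on_subset[OF that] by simp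
  let ?A = "LINT t|lborel. indicator {0..h} t * g t" and ?B = "LINT t|lborel. indicator {0..h} t * (g t)\<^sup>2"
  define k where "k = ?A / h"
  have i: "integrable lborel (\<lambda>t. indicator {0..h} t * g t)" "integrable lborel (\<lambda>t. indicator {0..h} t * (g t)\<^sup>2)"
    "integrable lborel (\<lambda>t. indicator {0..h} t * 1 :: real)"
    by (intro ig g continuous_intros)+
  have "0 \<le> (LINT t|lborel. indicator {0..h} t * (g t - k)\<^sup>2)"
    by (intro Bochner_Integration.integral_nonneg) simp
  also have "\<dots> = (LINT t|lborel. indicator {0..h} t * (g t)\<^sup>2 - 2 * k * (indicator {0..h} t * g t) + k\<^sup>2 * (indicator {0..h} t * 1))"
    by (intro Bochner_Integration.integral_cong refl) (simp add: power2_diff algebra_simps)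
  also have "\<dots> = ?B - 2 * k * ?A + k\<^sup>2 * (LINT t|lborel. indicator {0..h} t * 1)"
    using i by (simp only: Bochner_Integration.integral_diff Bochner_Integration.integral_add
        Bochner_Integration.integrable_diff integrable_mult_right integral_mult_right_zero)
  also have "(LINT t|lborel. indicator {0..h} t * 1 :: real) = h" using h by simp
  finally have "0 \<le> ?B - 2 * k * ?A + k\<^sup>2 * h" .
  moreover have "k * h = ?A" using h by (simp add: k_def)
  then have "2 * k * ?A = 2 * (k\<^sup>2 * h)" by (simp add: power2_eq_square flip: \<open>k * h = ?A\<close>)
  ultimately have "k\<^sup>2 * h \<le> ?B" by linarith
  then have "h * (k\<^sup>2 * h) \<le> h * ?B" using h by (intro mult_left_mono) auto
  moreover have "h * (k\<^sup>2 * h) = (k * h)\<^sup>2" by (simp add: power2_eq_square)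
  ultimately show ?thesis by (simp only: \<open>k * h = ?A\<close>)
qed

text \<open>The increment is an integral of f' over a segment. Cauchy-Schwarz contributes one factor
  h and integration over the segment another; working with nonnegative integrals lets the order be
  exchanged without joint integrability.\<close>

lemma integral_shift_axis_le:
  fixes f :: "real^3 \<Rightarrow> real"
  assumes f: "has_partial j f f'" "continuous_on UNIV f" "continuous_on UNIV f'"
    and i: "integrable lborel (\<lambda>x. (f x)\<^sup>2)" "integrable lborel (\<lambda>x. (f' x)\<^sup>2)" and h: "h \<ge> 0"
  shows "integrable lborel (\<lambda>x. (f (x + h *\<^sub>R axis j 1) - f x)\<^sup>2)"
    "(LINT x|lborel. (f (x + h *\<^sub>R axis j 1) - f x)\<^sup>2) \<le> h\<^sup>2 * (LINT x|lborel. (f' x)\<^sup>2)"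
proof -
  let ?e = "axis j 1 :: real^3"
  have m [measurable]: "f \<in> borel_measurable borel" "f' \<in> borel_measurable borel"
    using f by (auto intro: borel_measurable_continuous_onI)
  show id: "integrable lborel (\<lambda>x. (f (x + h *\<^sub>R ?e) - f x)\<^sup>2)"
    by (rule integrable_square_diff) (use integrable_translate[OF i(1)] i in auto)
  show "(LINT x|lborel. (f (x + h *\<^sub>R ?e) - f x)\<^sup>2) \<le> h\<^sup>2 * (LINT x|lborel. (f' x)\<^sup>2)"
  proof (cases "h = 0")
    case False
    then have h: "h > 0" using h by simp
    let ?F = "LINT x|lborel. (f' x)\<^sup>2"
    have F0: "0 \<le> ?F" by simp
    have cg: "continuous_on UNIV (\<lambda>t. f' (x + t *\<^sub>R ?e))" for x
      by (rule continuous_on_compose2[OF f(3)]) (auto intro!: continuous_intros)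
    have pw: "ennreal ((f (x + h *\<^sub>R ?e) - f x)\<^sup>2) \<le> (\<integral>\<^sup>+t. ennreal (h * (indicator {0..h} t * (f' (x + t *\<^sub>R ?e))\<^sup>2)) \<partial>lborel)" for x
    proof -
      have "(LINT t|lborel. f' (x + t *\<^sub>R ?e) * indicator {0..h} t) = f (x + h *\<^sub>R ?e) - f (x + 0 *\<^sub>R ?e)"
        by (rule integral_FTC_Icc_real) (use h has_partial_line[OF f(1)] cg in \<open>auto simp: continuous_on_eq_continuous_at\<close>)
      then have "f (x + h *\<^sub>R ?e) - f x = (LINT t|lborel. indicator {0..h} t * f' (x + t *\<^sub>R ?e))"
        by (simp add: mult.commute)
      then have "(f (x + h *\<^sub>R ?e) - f x)\<^sup>2 \<le> h * (LINT t|lborel. indicator {0..h} t * (f' (x + t *\<^sub>R ?e))\<^sup>2)"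
        using square_integral_le[OF h cg[of x]] by simp
      also have "\<dots> = (LINT t|lborel. h * (indicator {0..h} t * (f' (x + t *\<^sub>R ?e))\<^sup>2))" by simp
      finally have le: "(f (x + h *\<^sub>R ?e) - f x)\<^sup>2 \<le> (LINT t|lborel. h * (indicator {0..h} t * (f' (x + t *\<^sub>R ?e))\<^sup>2))" .
      have "integrable lborel (\<lambda>t. indicator {0..h} t *\<^sub>R (f' (x + t *\<^sub>R ?e))\<^sup>2)"
        by (intro borel_integrable_compact continuous_on_subset[OF continuous_on_power[OF cg]]) auto
      then have "integrable lborel (\<lambda>t. h * (indicator {0..h} t * (f' (x + t *\<^sub>R ?e))\<^sup>2))" by simp
      from nn_integral_eq_integral[OF this] h le show ?thesis by (simp add: ennreal_leI)
    qed
    have inner: "(\<integral>\<^sup>+x. ennreal (h * (indicator {0..h} t * (f' (x + t *\<^sub>R ?e))\<^sup>2)) \<partial>lborel)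
        = ennreal (h * ?F) * indicator {0..h} t" for t
    proof -
      have it: "integrable lborel (\<lambda>x. (f' (x + t *\<^sub>R ?e))\<^sup>2)"
        using integrable_translate[OF i(2), of "t *\<^sub>R ?e"] .
      have "(LINT x|lborel. (f' (x + t *\<^sub>R ?e))\<^sup>2) = ?F"
        using integral_translate[of "\<lambda>x. (f' x)\<^sup>2" "t *\<^sub>R ?e"] by simp
      then have "(LINT x|lborel. h * (indicator {0..h} t * (f' (x + t *\<^sub>R ?e))\<^sup>2)) = h * (indicator {0..h} t * ?F)" by simp
      moreover have "integrable lborel (\<lambda>x. h * (indicator {0..h} t * (f' (x + t *\<^sub>R ?e))\<^sup>2))" using it by simp
      ultimately show ?thesis using nn_integral_eq_integral[of lborel "\<lambda>x. h * (indicator {0..h} t * (f' (x + t *\<^sub>R ?e))\<^sup>2)"] h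
        by (simp add: indicator_def)
    qed
    have "ennreal (LINT x|lborel. (f (x + h *\<^sub>R ?e) - f x)\<^sup>2) = (\<integral>\<^sup>+x. ennreal ((f (x + h *\<^sub>R ?e) - f x)\<^sup>2) \<partial>lborel)"
      by (rule nn_integral_eq_integral[OF id, symmetric]) simp
    also have "\<dots> \<le> (\<integral>\<^sup>+x. (\<integral>\<^sup>+t. ennreal (h * (indicator {0..h} t * (f' (x + t *\<^sub>R ?e))\<^sup>2)) \<partial>lborel) \<partial>lborel)"
      by (intro nn_integral_mono pw)
    also have "\<dots> = (\<integral>\<^sup>+t. (\<integral>\<^sup>+x. ennreal (h * (indicator {0..h} t * (f' (x + t *\<^sub>R ?e))\<^sup>2)) \<partial>lborel) \<partial>lborel)"
      by (rule lborel_pair.Fubini') simp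
    also have "\<dots> = ennreal (h * ?F) * ennreal h"
      unfolding inner using h by (subst nn_integral_cmult_indicator) auto
    also have "\<dots> = ennreal (h\<^sup>2 * ?F)"
      using h F0 by (simp add: ennreal_mult[symmetric] power2_eq_square algebra_simps)
    finally show ?thesis using F0 by (simp add: ennreal_le_iff)
  qed simp
qed

text \<open>The shift is made along the three axes in turn. The 3 comes from (a + b + c)^2 <= 3 (a^2
  + b^2 + c^2), and translation invariance removes the intermediate base points.\<close>

lemma integral_shift_le:
  fixes f :: "real^3 \<Rightarrow> real"
  assumes f: "\<And>j. has_partial j f (f' j)" "continuous_on UNIV f" "\<And>j. continuous_on UNIV (f' j)"
    and i: "integrable lborel (\<lambda>x. (f x)\<^sup>2)" "\<And>j. integrable lborel (\<lambda>x. (f' j x)\<^sup>2)"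
    and y: "\<And>j. 0 \<le> y $ j" "\<And>j. y $ j \<le> L"
  shows "(LINT x|lborel. (f (x + y) - f x)\<^sup>2) \<le> 3 * L\<^sup>2 * (\<Sum>j\<in>UNIV. LINT x|lborel. (f' j x)\<^sup>2)"
proof -
  define q where "q j x = (f (x + y $ j *\<^sub>R axis j 1) - f x)\<^sup>2" for j x
  let ?v1 = "y $ 1 *\<^sub>R axis 1 1 :: real^3" and ?v2 = "y $ 2 *\<^sub>R axis 2 1 :: real^3" and ?v3 = "y $ 3 *\<^sub>R axis 3 1 :: real^3"
  have m [measurable]: "f \<in> borel_measurable borel"
    using f by (auto intro: borel_measurable_continuous_onI)
  have mq [measurable]: "q j \<in> borel_measurable borel" for j unfolding q_def by measurable
  have yv: "y = ?v1 + ?v2 + ?v3"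
    by (auto simp: vec_eq_iff forall_3 axis_def)
  have iq: "integrable lborel (q j)" "(LINT x|lborel. q j x) \<le> L\<^sup>2 * (LINT x|lborel. (f' j x)\<^sup>2)" for j
  proof -
    note S = integral_shift_axis_le[OF f(1)[of j] f(2) f(3)[of j] i(1) i(2)[of j] y(1)[of j]]
    show "integrable lborel (q j)" using S(1) by (simp add: q_def[abs_def])
    have "(y $ j)\<^sup>2 * (LINT x|lborel. (f' j x)\<^sup>2) \<le> L\<^sup>2 * (LINT x|lborel. (f' j x)\<^sup>2)"
      using y by (intro mult_right_mono power_mono) auto
    then show "(LINT x|lborel. q j x) \<le> L\<^sup>2 * (LINT x|lborel. (f' j x)\<^sup>2)" using S(2) by (simp add: q_def)
  qed
  have it: "integrable lborel (\<lambda>x. q j (x + v))" "(LINT x|lborel. q j (x + v)) = (LINT x|lborel. q j x)" for j v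
    by (rule integrable_translate[OF iq(1)]) (rule integral_translate[OF mq])
  have pw: "(f (x + y) - f x)\<^sup>2 \<le> 3 * q 1 x + 3 * q 2 (x + ?v1) + 3 * q 3 (x + (?v1 + ?v2))" for x
  proof -
    have sq: "(a + b + c)\<^sup>2 \<le> 3 * a\<^sup>2 + 3 * b\<^sup>2 + 3 * c\<^sup>2" for a b c :: real
      using zero_le_power2[of "a - b"] zero_le_power2[of "b - c"] zero_le_power2[of "a - c"]
      by (simp add: power2_eq_square algebra_simps)
    have "f (x + y) - f x = (f (x + ?v1) - f x) + (f ((x + ?v1) + ?v2) - f (x + ?v1))
      + (f ((x + (?v1 + ?v2)) + ?v3) - f (x + (?v1 + ?v2)))"
      by (subst yv) (simp add: add.assoc)
    then show ?thesis using sq by (simp only: q_def)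
  qed
  have "(LINT x|lborel. (f (x + y) - f x)\<^sup>2) \<le> (LINT x|lborel. 3 * q 1 x + 3 * q 2 (x + ?v1) + 3 * q 3 (x + (?v1 + ?v2)))"
  proof (rule integral_mono)
    show "integrable lborel (\<lambda>x. (f (x + y) - f x)\<^sup>2)"
      by (rule integrable_square_diff) (use integrable_translate[OF i(1)] i in auto)
  qed (use pw iq it in auto)
  also have "\<dots> = 3 * (LINT x|lborel. q 1 x) + 3 * (LINT x|lborel. q 2 x) + 3 * (LINT x|lborel. q 3 x)"
    using iq(1) it by (simp only: Bochner_Integration.integral_add Bochner_Integration.integrable_add
        integrable_mult_right integral_mult_right_zero)
  also have "\<dots> \<le> 3 * L\<^sup>2 * (\<Sum>j\<in>UNIV. LINT x|lborel. (f' j x)\<^sup>2)"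
    using iq(2)[of 1] iq(2)[of 2] iq(2)[of 3] by (simp add: sum_3 distrib_left)
  finally show ?thesis .
qed

text \<open>Expanding the squared difference of f and its translate by y shows that their
  correlation is at least the bracket, for every y in a cube of side L. Averaging over the cube
  bounds L^3 times the bracket by the square of the L^1 norm. L stays free; optimising it would give
  the usual multiplicative form.\<close>

lemma nash_inequality:
  fixes f :: "real^3 \<Rightarrow> real"
  assumes f: "\<And>j. has_partial j f (f' j)" "continuous_on UNIV f" "\<And>j. continuous_on UNIV (f' j)"
    and i: "integrable lborel (\<lambda>x. (f x)\<^sup>2)" "\<And>j. integrable lborel (\<lambda>x. (f' j x)\<^sup>2)" and i1: "integrable lborel f"
    and L: "L > 0"
  shows "L ^ 3 * ((LINT x|lborel. (f x)\<^sup>2) - 3 / 2 * L\<^sup>2 * (\<Sum>j\<in>UNIV. LINT x|lborel. (f' j x)\<^sup>2)) \<le> (LINT x|lborel. \<bar>f x\<bar>)\<^sup>2"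
proof -
  let ?E = "LINT x|lborel. (f x)\<^sup>2" and ?M = "LINT x|lborel. \<bar>f x\<bar>"
  \<comment> \<open>Half of the constant 3 in \<open>integral_shift_le\<close>, because the cross
    term of the expanded square carries a factor 2.\<close>
  define \<delta> where "\<delta> = ?E - 3 / 2 * L\<^sup>2 * (\<Sum>j\<in>UNIV. LINT x|lborel. (f' j x)\<^sup>2)"
  have m [measurable]: "f \<in> borel_measurable borel"
    using f by (auto intro: borel_measurable_continuous_onI)
  have M0: "0 \<le> ?M" by simp
  show ?thesis
  proof (cases "\<delta> \<le> 0")
    case True
    then have "L ^ 3 * \<delta> \<le> 0" using L by (intro mult_nonneg_nonpos) auto
    then show ?thesis unfolding \<delta>_def[symmetric] using zero_le_power2[of ?M] by linarith
  next
    case False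
    let ?Q = "cbox 0 (L *\<^sub>R One) :: (real^3) set"
    have lower: "ennreal \<delta> \<le> (\<integral>\<^sup>+x. ennreal (\<bar>f x\<bar> * \<bar>f (x + y)\<bar>) \<partial>lborel)" if "y \<in> ?Q" for y
    proof -
      have y: "0 \<le> y $ j" "y $ j \<le> L" for j
      proof -
        have j: "axis j 1 \<in> (Basis :: (real^3) set)" by simp
        have "(0::real^3) \<bullet> axis j 1 \<le> y \<bullet> axis j 1 \<and> y \<bullet> axis j 1 \<le> (L *\<^sub>R One :: real^3) \<bullet> axis j 1"
          using bspec[OF that[unfolded mem_box] j] .
        moreover have "(L *\<^sub>R One) \<bullet> (axis j 1 :: real^3) = L"
          by (simp only: inner_scaleR_left inner_sum_Basis[OF j] mult_1_right)
        ultimately have "0 \<le> y \<bullet> axis j 1 \<and> y \<bullet> axis j 1 \<le> L" by (simp only: inner_zero_left)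
        then show "0 \<le> y $ j" "y $ j \<le> L" by (simp_all add: inner_axis)
      qed
      have it: "integrable lborel (\<lambda>x. (f (x + y))\<^sup>2)" using integrable_translate[OF i(1)] .
      have ip: "integrable lborel (\<lambda>x. f x * f (x + y))"
        by (rule integrable_square_imp_product) (use i it in auto)
      have "(LINT x|lborel. (f (x + y) - f x)\<^sup>2) = (LINT x|lborel. (f (x + y))\<^sup>2 + (f x)\<^sup>2 - 2 * (f x * f (x + y)))"
        by (intro Bochner_Integration.integral_cong refl) (simp add: power2_diff algebra_simps)
      also have "\<dots> = (LINT x|lborel. (f (x + y))\<^sup>2) + ?E - 2 * (LINT x|lborel. f x * f (x + y))"
        using i it ip by simp
      also have "(LINT x|lborel. (f (x + y))\<^sup>2) = ?E" by (rule integral_translate[of "\<lambda>x. (f x)\<^sup>2"]) simp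
      finally have "\<delta> \<le> (LINT x|lborel. f x * f (x + y))"
        using integral_shift_le[OF f i y] by (simp add: \<delta>_def)
      also have "\<dots> \<le> (LINT x|lborel. \<bar>f x\<bar> * \<bar>f (x + y)\<bar>)"
        using integral_abs_bound[of lborel "\<lambda>x. f x * f (x + y)"] by (simp add: abs_mult)
      finally show ?thesis
        using integrable_abs[OF ip] by (subst nn_integral_eq_integral) (auto simp: abs_mult intro: ennreal_leI)
    qed
    have nnM: "(\<integral>\<^sup>+y. ennreal \<bar>f (x + y)\<bar> \<partial>lborel) = ennreal ?M" for x
    proof -
      have "(LINT y|lborel. \<bar>f (y + x)\<bar>) = ?M" by (rule integral_translate[of "\<lambda>x. \<bar>f x\<bar>"]) simp
      then show ?thesis
        using nn_integral_eq_integral[OF integrable_translate[OF integrable_abs[OF i1], of x]] by (simp add: add.commute)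
    qed
    have nnM0: "(\<integral>\<^sup>+x. ennreal \<bar>f x\<bar> \<partial>lborel) = ennreal ?M"
      by (rule nn_integral_eq_integral[OF integrable_abs[OF i1]]) simp
    have "ennreal (L ^ 3 * \<delta>) = ennreal \<delta> * emeasure lborel ?Q"
    proof -
      have "emeasure lborel ?Q = ennreal (\<Prod>b\<in>(Basis :: (real^3) set). (L *\<^sub>R One - 0) \<bullet> b)"
        using L by (intro emeasure_lborel_cbox) simp
      also have "(\<Prod>b\<in>(Basis :: (real^3) set). (L *\<^sub>R One - 0) \<bullet> b) = L ^ 3" by simp
      finally show ?thesis using L False by (simp add: ennreal_mult[symmetric] mult.commute)
    qed
    also have "\<dots> = (\<integral>\<^sup>+y. ennreal \<delta> * indicator ?Q y \<partial>lborel)"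
      by (rule nn_integral_cmult_indicator[symmetric]) simp
    also have "\<dots> \<le> (\<integral>\<^sup>+y. (\<integral>\<^sup>+x. ennreal (\<bar>f x\<bar> * \<bar>f (x + y)\<bar>) \<partial>lborel) \<partial>lborel)"
      by (intro nn_integral_mono) (use lower in \<open>auto simp: indicator_def\<close>)
    also have "\<dots> = (\<integral>\<^sup>+x. (\<integral>\<^sup>+y. ennreal (\<bar>f x\<bar> * \<bar>f (x + y)\<bar>) \<partial>lborel) \<partial>lborel)"
      by (rule lborel_pair.Fubini'[symmetric]) simp
    also have "\<dots> = (\<integral>\<^sup>+x. ennreal \<bar>f x\<bar> * ennreal ?M \<partial>lborel)"
      by (simp add: ennreal_mult nn_integral_cmult nnM)
    also have "\<dots> = ennreal ?M * ennreal ?M" by (simp add: nn_integral_multc nnM0)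
    also have "\<dots> = ennreal (?M\<^sup>2)" using M0 by (simp add: ennreal_mult power2_eq_square)
    finally have "ennreal (L ^ 3 * \<delta>) \<le> ennreal (?M\<^sup>2)" .
    then show ?thesis unfolding \<delta>_def by simp
  qed
qed

section \<open>Decay\<close>

context npd_nonneg
begin

lemma energy_small:
  assumes \<epsilon>: "\<epsilon> > 0"
  shows "\<exists>t\<ge>1. energy t < \<epsilon>"
proof (rule ccontr)
  assume "\<not> ?thesis"
  then have E: "\<And>t. t \<ge> 1 \<Longrightarrow> \<epsilon> \<le> energy t" by (auto simp: not_less)
  define M where "M = (\<Sum>i\<in>{1..N}. LINT x|lborel. \<bar>c i 1 x\<bar>)"
  \<comment> \<open>This makes 2 M^2 at most L^3 \<epsilon>/2, so the mass term in Nash's inequality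
    accounts for at most half of \<epsilon>.\<close>
  define L where "L = max 1 (4 * M\<^sup>2 / \<epsilon>)"
  have L: "L \<ge> 1" "4 * M\<^sup>2 / \<epsilon> \<le> L" by (simp_all add: L_def)
  \<comment> \<open>The other half, \<epsilon>/2, is at most 3/2 L^2 times the gradient
    integrals.\<close>
  define \<delta> where "\<delta> = \<epsilon> / (3 * L\<^sup>2)"
  have \<delta>: "\<delta> > 0" using \<epsilon> L(1) by (simp add: \<delta>_def)
  let ?F = "\<lambda>t b. \<Sum>j\<in>UNIV. LINT x|lborel. (\<sigma>' b j t x)\<^sup>2"
  have F: "\<delta> \<le> ?F t True + ?F t False" if t: "t \<ge> 1" for t
  proof -
    have t0: "t > 0" "t \<ge> 0" using t by auto
    have n: "L ^ 3 * ((LINT x|lborel. (\<sigma> b t x)\<^sup>2) - 3 / 2 * L\<^sup>2 * ?F t b) \<le> M\<^sup>2" for b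
    proof -
      have "L ^ 3 * ((LINT x|lborel. (\<sigma> b t x)\<^sup>2) - 3 / 2 * L\<^sup>2 * ?F t b) \<le> (LINT x|lborel. \<bar>\<sigma> b t x\<bar>)\<^sup>2"
        by (rule nash_inequality[OF sigma_slice[OF t0(1)] sigma_integrable(2)[OF t0(2)]
              sigma_integrable(3)[OF t0(2) t0(1)] sigma_integrable(1)[OF t0(2)]]) (use L in simp)
      also have "\<dots> \<le> M\<^sup>2"
        using sigma_L1_le[OF t, of b] by (intro power_mono) (auto simp: M_def)
      finally show ?thesis .
    qed
    have "L ^ 3 * (energy t - 3 / 2 * L\<^sup>2 * (?F t True + ?F t False)) \<le> 2 * M\<^sup>2"
      using n[of True] n[of False] by (simp add: energy_def UNIV_bool algebra_simps)
    also have "\<dots> \<le> L * (\<epsilon> / 2)" using L(2) \<epsilon> by (simp add: field_simps)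
    also have "\<dots> \<le> L ^ 3 * (\<epsilon> / 2)"
      using L(1) \<epsilon> power_increasing[of 1 3 L] by (intro mult_right_mono) auto
    finally have "energy t - 3 / 2 * L\<^sup>2 * (?F t True + ?F t False) \<le> \<epsilon> / 2"
      using L(1) by (simp add: mult_le_cancel_left_pos)
    then have "\<epsilon> \<le> 3 * L\<^sup>2 * (?F t True + ?F t False)" using E[OF t] by simp
    then show ?thesis using L(1) by (simp add: \<delta>_def divide_le_eq mult.commute)
  qed
  \<comment> \<open>With this T the accumulated lower bound 2 \<delta> (T - 1) equals 2 \<delta> +
    \<open>energy 1 / D\<close>, more than the dissipation available after time 1.\<close>
  define T where "T = 2 + energy 1 / (D * (2 * \<delta>))"
  have E1: "0 \<le> energy 1" using E[of 1] \<epsilon> by simp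
  have T: "1 \<le> T" using E1 D \<delta> by (simp add: T_def)
  let ?g = "\<lambda>t x. 2 * (\<Sum>b\<in>UNIV. \<Sum>j\<in>UNIV. (\<sigma>' b j t x)\<^sup>2)"
  note ed = energy_dissipation[OF zero_less_one T]
  have "2 * \<delta> * (T - 1) = (LINT t|lborel. indicator {1..T} t * (2 * \<delta>))" using T by simp
  also have "\<dots> \<le> (LINT t|lborel. indicator {1..T} t * (LINT x|lborel. ?g t x))"
  proof (rule integral_mono)
    have "emeasure lborel {1..T} < \<infinity>" by (rule emeasure_bounded_finite) simp
    then show "integrable lborel (\<lambda>t. indicator {1..T} t * (2 * \<delta>))"
      by (intro integrable_mult_left integrable_real_indicator) simp_all
    show "integrable lborel (\<lambda>t. indicator {1..T} t * (LINT x|lborel. ?g t x))"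
      by (rule slab_integral(2)[OF ed(2)])
    show "indicator {1..T} t * (2 * \<delta>) \<le> indicator {1..T} t * (LINT x|lborel. ?g t x)" for t
    proof (cases "t \<in> {1..T}")
      case True
      then have t: "t \<ge> 1" "t > 0" "t \<ge> 0" by auto
      have "(LINT x|lborel. ?g t x) = 2 * (?F t True + ?F t False)"
        using sigma_integrable(3)[OF t(3,2)] by (simp add: UNIV_bool Bochner_Integration.integral_sum Bochner_Integration.integrable_sum)
      then show ?thesis using F[OF t(1)] True by simp
    qed simp
  qed
  also have "\<dots> \<le> energy 1 / D" using ed(3) unfolding slab_integral(1)[OF ed(2)] .
  finally have "2 * \<delta> * (T - 1) \<le> energy 1 / D" .
  moreover have "2 * \<delta> * (T - 1) = 2 * \<delta> + energy 1 / D"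
    using D \<delta> by (simp add: T_def field_simps)
  ultimately show False using \<delta> by simp
qed

lemma energy_nonneg: "0 \<le> energy t"
  unfolding energy_def by (intro sum_nonneg) simp

text \<open>Smallness at one time persists by monotonicity.\<close>

lemma energy_tendsto_0: "(energy \<longlongrightarrow> 0) at_top"
proof (rule tendstoI)
  fix \<epsilon> :: real assume "\<epsilon> > 0"
  then obtain t where t: "t \<ge> 1" "energy t < \<epsilon>" using energy_small by blast
  have "energy s < \<epsilon>" if "s \<ge> t" for s
    using energy_dissipation(1)[of t s] t that by auto
  then show "eventually (\<lambda>s. dist (energy s) 0 < \<epsilon>) at_top"
    unfolding eventually_at_top_linorder using energy_nonneg by (auto simp: dist_real_def)
qed

text \<open>By positivity each concentration is dominated by the total concentration of its
  valence.\<close>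

lemma c_square_le_energy:
  assumes i: "i \<in> {1..N}" and t: "t > 0"
  shows "(LINT x|lborel. (c i t x)\<^sup>2) \<le> energy t"
proof -
  have t0: "t \<ge> 0" using t by simp
  define b where "b = (z i = \<zeta>)"
  have ib: "i \<in> species b" using i by (simp add: species_def b_def)
  have fin: "finite (species b)" by (simp add: species_def)
  have nn: "AE x in lborel. \<forall>k\<in>{1..N}. 0 \<le> c k t x"
  proof (rule AE_finite_allI)
    show "AE x in lborel. 0 \<le> c k t x" if "k \<in> {1..N}" for k
      by (rule concentration_nonneg[OF that nonneg_0[OF that] t])
  qed simp
  have "(LINT x|lborel. (c i t x)\<^sup>2) \<le> (LINT x|lborel. (\<sigma> b t x)\<^sup>2)"
  proof (rule integral_mono_AE[OF c_square_integrable(2)[OF i t0] sigma_integrable(2)[OF t0]])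
    show "AE x in lborel. (c i t x)\<^sup>2 \<le> (\<sigma> b t x)\<^sup>2"
      using nn
    proof eventually_elim
      case (elim x)
      have "c i t x \<le> (\<Sum>k\<in>species b. c k t x)"
        by (rule member_le_sum[OF ib _ fin]) (use elim species_subset[of b] in auto)
      then show ?case using elim i by (intro power_mono) (auto simp: \<sigma>_def comb_def)
    qed
  qed
  also have "\<dots> \<le> energy t"
    unfolding energy_def by (rule member_le_sum[of b UNIV "\<lambda>b. LINT x|lborel. (\<sigma> b t x)\<^sup>2"]) auto
  finally show ?thesis .
qed

text \<open>Below 1 the logarithm costs 2 sqrt(y), above 1 it costs y^2. In turn 2 sqrt(y) is either
  at most \<eta> or, exceeding \<eta>, at most its fourth power 16 y^2 divided by \<eta>^3. At y = 0
  the product is 0, in accordance with the convention for 0 log 0.\<close>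

lemma abs_mult_ln_le:
  fixes y \<eta> :: real
  assumes y: "0 \<le> y" and \<eta>: "0 < \<eta>"
  shows "\<bar>y * ln y\<bar> \<le> \<eta> + (16 / \<eta> ^ 3 + 1) * y\<^sup>2"
proof -
  define r where "r = sqrt y"
  have r: "r \<ge> 0" "y = r\<^sup>2" using y by (simp_all add: r_def)
  have le: "\<bar>y * ln y\<bar> \<le> 2 * r + y\<^sup>2"
  proof (cases "y = 0")
    case False
    then have pos: "y > 0" "r > 0" using y by (auto simp: r_def)
    show ?thesis
    proof (cases "y \<ge> 1")
      case True
      have "y * ln y \<le> y * (y - 1)" using ln_le_minus_one[OF pos(1)] y by (intro mult_left_mono)
      moreover have "0 \<le> y * ln y" using True by simp
      ultimately show ?thesis using r(1) y by (simp add: power2_eq_square algebra_simps)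
    next
      case False
      have "ln y = - (2 * ln (1 / r))" using pos by (simp add: r(2) ln_realpow ln_div)
      moreover have "ln (1 / r) \<le> 1 / r - 1" using pos by (intro ln_le_minus_one) simp
      ultimately have "- ln y \<le> 2 / r" by simp
      then have "y * (- ln y) \<le> y * (2 / r)" using y by (intro mult_left_mono)
      also have "\<dots> = 2 * r" using pos by (simp add: r(2) power2_eq_square)
      finally have "- (y * ln y) \<le> 2 * r" by simp
      moreover have "y * ln y \<le> 0" using False pos by (simp add: mult_le_0_iff)
      ultimately have "\<bar>y * ln y\<bar> \<le> 2 * r" by simp
      then show ?thesis using zero_le_power2[of y] by linarith
    qed
  qed (use r in simp)
  have "2 * r \<le> \<eta> + 16 / \<eta> ^ 3 * y\<^sup>2"
  proof (cases "2 * r \<le> \<eta>")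
    case True
    have "0 \<le> 16 / \<eta> ^ 3 * y\<^sup>2" using \<eta> by simp
    then show ?thesis using True by linarith
  next
    case False
    then have "\<eta> ^ 3 \<le> (2 * r) ^ 3" using \<eta> by (intro power_mono) auto
    then have "2 * r * \<eta> ^ 3 \<le> 2 * r * (2 * r) ^ 3" using r(1) by (intro mult_left_mono) auto
    also have "\<dots> = 16 * y\<^sup>2" by (simp add: r(2) power2_eq_square power3_eq_cube)
    finally have "2 * r \<le> 16 * y\<^sup>2 / \<eta> ^ 3" using \<eta> by (simp add: pos_le_divide_eq)
    then show ?thesis using \<eta> by simp
  qed
  then show ?thesis using le by (simp add: distrib_right)
qed

lemma entropy_tendsto_0:
  assumes i: "i \<in> {1..N}"
  shows "((\<lambda>t. \<bar>LINT x:{x. norm x \<le> A}|lborel. c i t x * ln (c i t x)\<bar>) \<longlongrightarrow> 0) at_top"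
proof (rule tendstoI)
  fix \<epsilon> :: real assume \<epsilon>: "\<epsilon> > 0"
  let ?S = "{x :: real^3. norm x \<le> A}"
  have S: "?S = cball 0 A" by auto
  have Sfin: "emeasure lborel ?S < \<infinity>" unfolding S by (rule emeasure_bounded_finite) simp
  have Sm: "?S \<in> sets lborel" unfolding S by simp
  let ?B = "measure lborel ?S"
  \<comment> \<open>The constant \<eta> will be integrated over the ball, hence the division by its
    volume; adding 1 keeps the denominator positive for every A.\<close>
  define \<eta> where "\<eta> = \<epsilon> / (2 * (?B + 1))"
  have B1: "?B + 1 > 0" by (simp add: add_nonneg_pos)
  have \<eta>: "\<eta> > 0" using \<epsilon> B1 by (simp add: \<eta>_def)
  have "\<eta> * ?B \<le> \<eta> * (?B + 1)" using \<eta> by simp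
  also have "\<dots> = \<epsilon> / 2"
  proof -
    have "\<epsilon> / (2 * q) * q = \<epsilon> / 2" if "q > 0" for q using that by simp
    from this[OF B1] show ?thesis unfolding \<eta>_def .
  qed
  finally have \<eta>B: "\<eta> * ?B \<le> \<epsilon> / 2" .
  let ?C = "16 / \<eta> ^ 3 + 1"
  have bound: "\<bar>LINT x:?S|lborel. c i t x * ln (c i t x)\<bar> \<le> \<epsilon> / 2 + ?C * energy t" if t: "t > 0" for t
  proof -
    have t0: "t \<ge> 0" using t by simp
    have [measurable]: "c i t \<in> borel_measurable borel" by (rule c_square_integrable(1)[OF i t0])
    note [measurable] = Sm
    let ?f = "\<lambda>x. indicator ?S x *\<^sub>R (c i t x * ln (c i t x))" and ?g = "\<lambda>x. \<eta> * indicator ?S x + ?C * (c i t x)\<^sup>2"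
    have ig: "integrable lborel ?g"
      by (intro Bochner_Integration.integrable_add integrable_mult_right integrable_real_indicator
          Sm Sfin c_square_integrable(2)[OF i t0])
    have le: "AE x in lborel. \<bar>?f x\<bar> \<le> ?g x"
      using concentration_nonneg[OF i nonneg_0[OF i] t]
    proof eventually_elim
      case (elim x)
      have "0 \<le> ?C * (c i t x)\<^sup>2" using \<eta> by simp
      then show ?case using abs_mult_ln_le[OF elim \<eta>] by (auto simp: indicator_def)
    qed
    have if': "integrable lborel ?f"
      by (rule Bochner_Integration.integrable_bound[OF ig]) (use le in \<open>auto elim: eventually_mono\<close>)
    have "\<bar>LINT x|lborel. ?f x\<bar> \<le> (LINT x|lborel. \<bar>?f x\<bar>)" by (rule integral_abs_bound)
    also have "\<dots> \<le> (LINT x|lborel. ?g x)" by (rule integral_mono_AE[OF integrable_abs[OF if'] ig le])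
    also have "\<dots> = \<eta> * ?B + ?C * (LINT x|lborel. (c i t x)\<^sup>2)"
      using c_square_integrable(2)[OF i t0] Sfin Sm by (subst Bochner_Integration.integral_add) auto
    also have "\<dots> \<le> \<epsilon> / 2 + ?C * energy t"
      using \<eta>B c_square_le_energy[OF i t] \<eta> by (intro add_mono mult_left_mono) auto
    finally show ?thesis unfolding set_lebesgue_integral_def .
  qed
  have "((\<lambda>t. \<epsilon> / 2 + ?C * energy t) \<longlongrightarrow> \<epsilon> / 2 + ?C * 0) at_top"
    by (intro tendsto_intros energy_tendsto_0)
  moreover have "\<epsilon> / 2 + ?C * 0 < \<epsilon>" using \<epsilon> by simp
  ultimately have "eventually (\<lambda>t. \<epsilon> / 2 + ?C * energy t < \<epsilon>) at_top" by (rule order_tendstoD)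
  with eventually_gt_at_top[of 0]
  show "eventually (\<lambda>t. dist \<bar>LINT x:?S|lborel. c i t x * ln (c i t x)\<bar> 0 < \<epsilon>) at_top"
  proof eventually_elim
    case (elim t)
    then show ?case using bound[of t] by simp
  qed
qed

end

theorem proposition8:
  fixes N :: nat and D A \<zeta> :: real and z :: "nat \<Rightarrow> real"
    and c :: "nat \<Rightarrow> real \<Rightarrow> real^3 \<Rightarrow> real"
    and u :: "real \<Rightarrow> real^3 \<Rightarrow> real^3"
    and p \<phi> :: "real \<Rightarrow> real^3 \<Rightarrow> real"
  assumes "N \<ge> 1" and "D > 0" and "A > 0"
    and "\<forall>i\<in>{1..N}. \<bar>z i\<bar> = \<zeta>"
    and "\<forall>i\<in>{1..N}. AE x in lborel. c i 0 x \<ge> 0"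
    and "\<forall>i\<in>{1..N}. sobolev 2 (c i 0) \<and> integrable lborel (c i 0)"
    and "(LINT x|lborel. charge_density N z c 0 x) = 0"
    and "npd_solution N D z c u p \<phi>"
  shows "\<forall>i\<in>{1..N}.
    ((\<lambda>t. \<bar>LINT x:{x. norm x \<le> A}|lborel. c i t x * ln (c i t x)\<bar>) \<longlongrightarrow> 0) at_top"
proof -
  interpret npd_nonneg N D \<zeta> z c u p \<phi>
    using assms by unfold_locales auto
  show ?thesis using entropy_tendsto_0 by blast
qed

end
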